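(* Let $b\ge 2$ be an integer of the form $b=p^{\alpha}q^{\beta}$ with $p,q$ primes and $\alpha,\beta\ge 0$ integers (that is, $b$ has at most two distinct prime factors), and let $\mathcal{D}\subset\mathbb{Z}$ be a set with $\#\mathcal{D}=b$. If $T(b,\mathcal{D})$ is a self-similar tile, then $T(b,\mathcal{D})$ is a spectral set.
   Context: For an integer $b\ge 2$ and a finite set $\mathcal{D}\subset\mathbb{Z}$ with $\#\mathcal{D}=b$, $T(b,\mathcal{D})$ denotes the unique non-empty compact set $T\subset\mathbb{R}$ satisfying $T=\bigcup_{d\in\mathcal{D}}b^{-1}(T+d)$. It is called a self-similar tile if it has non-empty interior. A Lebesgue measurable set $\Omega\subset\mathbb{R}$ with positive finite Lebesgue measure is a spectral set if there exists $\Lambda\subset\mathbb{R}$ such that $\{e^{2\pi i\lambda x}:\lambda\in\Lambda\}$ is an orthogonal basis of $L^2(\Omega)$ (with respect to Lebesgue measure restricted to $\Omega$). *)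

theory Defs
  imports "HOL-Analysis.Analysis" "HOL-Computational_Algebra.Primes"
begin

definition is_attractor :: "nat \<Rightarrow> int set \<Rightarrow> real set \<Rightarrow> bool" where
  "is_attractor b D T \<longleftrightarrow>
     compact T \<and> T \<noteq> {} \<and> T = (\<Union>d\<in>D. (\<lambda>x. inverse (real b) * (x + of_int d)) ` T)"

text \<open>The description is proper for \<open>b \<ge> 2\<close> and \<open>card D = b\<close>; see \<open>ex1_is_attractor\<close> below.\<close>

definition attractor :: "nat \<Rightarrow> int set \<Rightarrow> real set" where
  "attractor b D = (THE T. is_attractor b D T)"

definition self_similar_tile :: "nat \<Rightarrow> int set \<Rightarrow> bool" where
  "self_similar_tile b D \<longleftrightarrow> interior (attractor b D) \<noteq> {}"

text \<open>Elements of \<open>L\<^sup>2\<close> are represented by functions, not by classes modulo null sets;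
  all notions below depend only on the classes. In an orthogonal basis, distinct functions
  represent distinct classes, since they are orthogonal and of nonzero norm.\<close>

definition L2_space :: "'a measure \<Rightarrow> ('a \<Rightarrow> complex) set" where
  "L2_space M = {f \<in> borel_measurable M. integrable M (\<lambda>x. (cmod (f x))\<^sup>2)}"

definition L2_inner :: "'a measure \<Rightarrow> ('a \<Rightarrow> complex) \<Rightarrow> ('a \<Rightarrow> complex) \<Rightarrow> complex" where
  "L2_inner M f g = (\<integral>x. f x * cnj (g x) \<partial>M)"

definition L2_norm :: "'a measure \<Rightarrow> ('a \<Rightarrow> complex) \<Rightarrow> real" where
  "L2_norm M f = sqrt (\<integral>x. (cmod (f x))\<^sup>2 \<partial>M)"

text \<open>A set of pairwise orthogonal nonzero elements whose linear span is dense.\<close>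

definition L2_orthogonal_basis :: "'a measure \<Rightarrow> ('a \<Rightarrow> complex) set \<Rightarrow> bool" where
  "L2_orthogonal_basis M E \<longleftrightarrow>
     E \<subseteq> L2_space M \<and>
     (\<forall>f\<in>E. L2_norm M f \<noteq> 0) \<and>
     pairwise (\<lambda>f g. L2_inner M f g = 0) E \<and>
     (\<forall>g\<in>L2_space M. \<forall>\<epsilon>>0. \<exists>F c. finite F \<and> F \<subseteq> E \<and>
        L2_norm M (\<lambda>x. g x - (\<Sum>f\<in>F. c f * f x)) < \<epsilon>)"

definition exponential :: "real \<Rightarrow> real \<Rightarrow> complex" where
  "exponential l x = exp (2 * of_real pi * \<i> * of_real l * of_real x)"

definition spectral_set :: "real set \<Rightarrow> bool" where
  "spectral_set \<Omega> \<longleftrightarrow>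
     \<Omega> \<in> sets lebesgue \<and> 0 < emeasure lebesgue \<Omega> \<and> emeasure lebesgue \<Omega> < \<infinity> \<and>
     (\<exists>\<Lambda>. L2_orthogonal_basis (lebesgue_on \<Omega>) (exponential ` \<Lambda>))"

lemma is_attractor_subset:
  assumes b: "b \<ge> 2" and S: "is_attractor b D S" and T: "is_attractor b D T"
  shows "S \<subseteq> T"
proof -
  have cS: "compact S" and nS: "S \<noteq> {}" and cT: "compact T" and nT: "T \<noteq> {}"
    using S T by (auto simp: is_attractor_def)
  have Seq: "S = (\<Union>d\<in>D. (\<lambda>x. inverse (real b) * (x + of_int d)) ` S)"
    and Teq: "T = (\<Union>d\<in>D. (\<lambda>x. inverse (real b) * (x + of_int d)) ` T)"
    using S T unfolding is_attractor_def by blast+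
  have "continuous_on S (\<lambda>x. infdist x T)" by (intro continuous_intros)
  then obtain x where x: "x \<in> S" "\<And>y. y \<in> S \<Longrightarrow> infdist y T \<le> infdist x T"
    using continuous_attains_sup[OF cS nS] by metis
  obtain y d where y: "y \<in> S" "d \<in> D" "x = inverse (real b) * (y + of_int d)"
    using x(1) Seq by blast
  obtain t where t: "t \<in> T" "infdist y T = dist y t"
    using infdist_attains_inf[OF compact_imp_closed[OF cT] nT] by blast
  have "inverse (real b) * (t + of_int d) \<in> T" using Teq t y by blast
  then have "infdist x T \<le> dist x (inverse (real b) * (t + of_int d))" by (rule infdist_le)
  also have "\<dots> = \<bar>inverse (real b) * (y - t)\<bar>"
    by (simp add: y(3) dist_real_def algebra_simps)
  also have "\<dots> = dist y t / real b"
    by (simp add: abs_mult dist_real_def divide_inverse mult.commute)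
  also have "\<dots> \<le> infdist x T / real b" using x(2)[OF y(1)] t by (simp add: divide_right_mono)
  also have "\<dots> \<le> infdist x T / 2"
    using b infdist_nonneg[of x T] by (intro divide_left_mono) auto
  finally have m: "infdist x T \<le> 0" using infdist_nonneg[of x T] by simp
  show ?thesis
  proof
    fix z assume "z \<in> S"
    then have "infdist z T = 0" using x(2) m infdist_nonneg[of z T] by force
    then show "z \<in> T" using in_closed_iff_infdist_zero[OF compact_imp_closed[OF cT] nT] by blast
  qed
qed

lemma ex_is_attractor:
  assumes b: "b \<ge> 2" and D: "finite D" "D \<noteq> {}"
  shows "\<exists>T. is_attractor b D T"
proof -
  define g where "g d x = inverse (real b) * (x + real_of_int d)" for d x
  define F where "F X = (\<Union>d\<in>D. g d ` X)" for X
  define M where "M = Max ((\<lambda>d. \<bar>real_of_int d\<bar>) ` D)"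
  define K where "K i = (F ^^ i) {-M..M}" for i
  have M: "\<bar>real_of_int d\<bar> \<le> M" if "d \<in> D" for d
    unfolding M_def using D that by simp
  have M0: "0 \<le> M" using D(2) M by (metis abs_ge_zero all_not_in_conv order_trans)
  have K0: "K 0 = {-M..M}" and KS: "K (Suc i) = F (K i)" for i by (simp_all add: K_def)
  have ginj: "x = y" if "g d x = g d y" for d x y using that b by (auto simp: g_def)
  have mono: "F X \<subseteq> F Y" if "X \<subseteq> Y" for X Y using that by (auto simp: F_def)
  have comp: "compact (F X)" if "compact X" for X
    unfolding F_def g_def using D that
    by (intro compact_UN compact_continuous_image) (auto intro!: continuous_intros)
  have Kc: "compact (K i)" for i by (induction i) (auto simp: K0 KS comp)
  have Kn: "K i \<noteq> {}" for i by (induction i) (use M0 D in \<open>auto simp: K0 KS F_def\<close>)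
  have "K (Suc 0) \<subseteq> K 0"
  proof
    fix z assume "z \<in> K (Suc 0)"
    then obtain d x where z: "d \<in> D" "-M \<le> x" "x \<le> M" "z = g d x" by (auto simp: KS K0 F_def)
    have "\<bar>x + real_of_int d\<bar> \<le> 2 * M" using z(2,3) M[OF z(1)] by linarith
    also have "\<dots> \<le> real b * M" using b M0 by (intro mult_right_mono) auto
    finally have "\<bar>z\<bar> \<le> M" using b by (simp add: z(4) g_def abs_mult field_simps)
    then show "z \<in> K 0" by (auto simp: K0)
  qed
  then have dec1: "K (Suc i) \<subseteq> K i" for i
    by (induction i) (simp_all only: KS mono)
  have dec: "K j \<subseteq> K i" if "i \<le> j" for i j
    using lift_Suc_antimono_le[of K] dec1 that by blast
  define T where "T = (\<Inter>i. K i)"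
  have "T \<noteq> {}"
    unfolding T_def using compact_nest[of K] Kc Kn dec by blast
  moreover have "compact T" unfolding T_def using Kc by (intro compact_Inter) auto
  moreover have "F T \<subseteq> T"
  proof -
    have "F T \<subseteq> K (Suc i)" for i unfolding KS by (rule mono) (auto simp: T_def)
    then show ?thesis using dec1 by (auto simp: T_def)
  qed
  moreover have "T \<subseteq> F T"
  proof (rule ccontr)
    assume "\<not> T \<subseteq> F T"
    then obtain x where x: "x \<in> T" "x \<notin> F T" by blast
    have "\<exists>i. x \<notin> g d ` K i" if "d \<in> D" for d
    proof (rule ccontr)
      assume "\<not> ?thesis"
      then have all: "\<And>i. x \<in> g d ` K i" by blast
      then obtain u where u: "x = g d u" by blast
      have "u \<in> T" unfolding T_def using all u ginj by blast
      then show False using x(2) u that by (auto simp: F_def)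
    qed
    then obtain n where n: "\<And>d. d \<in> D \<Longrightarrow> x \<notin> g d ` K (n d)" by metis
    have "x \<in> K (Suc (Max (n ` D)))" using x(1) by (auto simp: T_def)
    then obtain d where d: "d \<in> D" "x \<in> g d ` K (Max (n ` D))" by (auto simp: KS F_def)
    moreover have "K (Max (n ` D)) \<subseteq> K (n d)" using D d by (intro dec) simp
    ultimately show False using n by blast
  qed
  ultimately have "compact T \<and> T \<noteq> {} \<and> T = F T" by blast
  then show ?thesis unfolding is_attractor_def F_def g_def by blast
qed

lemma ex1_is_attractor:
  assumes "b \<ge> 2" "card D = b"
  shows "\<exists>!T. is_attractor b D T"
proof -
  have "finite D" "D \<noteq> {}" using assms by (auto intro: card_ge_0_finite)
  then show ?thesis
    using ex_is_attractor[of b D] is_attractor_subset[of b D] assms(1) by blast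
qed

end

theory Submission
  imports Defs "HOL-Computational_Algebra.Polynomial"
begin

text \<open>The attractor \<open>T\<close> is cut into its fibres over the circle: for \<open>y \<in> [0, 1)\<close>, let \<open>A\<^sub>y\<close> be the
finite set of integers \<open>n\<close> with \<open>y + n \<in> T\<close>. If one finite set \<open>L\<close> of frequencies is a
spectrum of almost every \<open>A\<^sub>y\<close>, then \<open>L + \<int>\<close> is a spectrum of \<open>T\<close>: the integer frequencies
resolve \<open>y\<close>, and \<open>L\<close> resolves the position inside the fibre
(\<open>spectral_basis_from_fibres\<close>). So everything comes down to a common spectrum for the fibres, and
that comes from tilings.

Up to null sets the translates of \<open>T\<close> by the digits partition the dilate \<open>b T\<close>. Since \<open>T\<close> contains an
interval, dilating it shows arbitrarily long windows that are tiled by integer translates of \<open>T\<close>. A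
pattern of translates that occurs twice in such a window closes up to a periodic tiling.
Hence there are \<open>N\<close> and \<open>B\<close> such that \<open>A\<^sub>y \<oplus> B\<close> is \<open>\<int>/N\<close> for almost every \<open>y\<close>
(\<open>fibres_tile\<close>). The complement \<open>B\<close> does not depend on \<open>y\<close>, and this is the source of
the common spectrum.

Next, the period is freed from all primes other than the two that may divide \<open>b\<close>. By a theorem
of Tijdeman, multiplying \<open>A\<close> by a prime not dividing its cardinality preserves tilings
(\<open>tiles_dilate_prime\<close>). This removes from \<open>N\<close> all primes that do not divide the cardinality \<open>m\<close>
of the fibres. A prime \<open>r\<close> that does not divide \<open>b\<close> cannot divide \<open>m\<close> either, once the digits are
normalized to contain 0 and to have greatest common divisor 1: the substitution
\<open>B \<mapsto> D + b B\<close> produces further complements of the fibres, whose distribution modulo powers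
of \<open>r\<close> tends to the uniform one. All complements of a given finite set share one bounded period, so
finitely many distributions occur, and a uniform one is reached exactly. That leaves no factor \<open>r\<close>
for \<open>m\<close> (\<open>tiles_card_coprime\<close>).

For periods \<open>p\<^sup>u q\<^sup>v\<close> the argument is that of Coven and Meyerowitz. By a theorem of Sands one of
the two factors lies in a coset of \<open>p\<int>\<close> or \<open>q\<int>\<close> (\<open>tiles_two_primes_coset\<close>), which allows
induction on the period. It shows that the prime powers along which \<open>A\<close> is equidistributed are
exactly those along which \<open>B\<close> is not, so \<open>B\<close> determines them; that they account for the
cardinality of \<open>A\<close>; and that the character sum of \<open>A\<close> vanishes at every frequency whose order
is a product of such powers of different primes. The frequencies
\<open>\<Sum> f\<^sub>j / p\<^sup>j + \<Sum> g\<^sub>j / q\<^sup>j\<close>, with digits \<open>f\<^sub>j < p\<close> and \<open>g\<^sub>j < q\<close> running over these powers,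
are then a spectrum of every complement of \<open>B\<close>, following Laba (\<open>common_spectrum_two_primes\<close>).\<close>

section \<open>Tilings of finite cyclic groups\<close>

text \<open>The factors are sets of integers representing residue classes, not subsets of \<open>{0..<N}\<close>, so
  that fibres, translates and dilates are factors without reduction modulo \<open>N\<close>.\<close>

definition tiles :: "nat \<Rightarrow> int set \<Rightarrow> int set \<Rightarrow> bool" where
  "tiles N A B \<longleftrightarrow> 0 < N \<and> finite A \<and> finite B \<and>
     bij_betw (\<lambda>(a, b). (a + b) mod int N) (A \<times> B) {0..<int N}"

lemma tiles_card: assumes "tiles N A B" shows "card A * card B = N"
proof -
  have "card (A \<times> B) = card {0..<int N}"
    using assms unfolding tiles_def by (intro bij_betw_same_card) auto
  then show ?thesis by (simp add: card_cartesian_product)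
qed

lemma tiles_pos: "tiles N A B \<Longrightarrow> 0 < N" by (simp add: tiles_def)

lemma tiles_finite: assumes "tiles N A B" shows "finite A" "finite B"
  using assms by (simp_all add: tiles_def)

lemma tiles_nonempty: assumes "tiles N A B" shows "A \<noteq> {}" "B \<noteq> {}"
  using tiles_card[OF assms] tiles_pos[OF assms] by auto

lemma tiles_ex:
  assumes "tiles N A B"
  shows "\<exists>a\<in>A. \<exists>b\<in>B. (a + b) mod int N = z mod int N"
proof -
  have "z mod int N \<in> (\<lambda>(a, b). (a + b) mod int N) ` (A \<times> B)"
    using assms unfolding tiles_def bij_betw_def by auto
  then show ?thesis by force
qed

lemma tiles_inj:
  assumes "tiles N A B" "a \<in> A" "b \<in> B" "a' \<in> A" "b' \<in> B" "(a + b) mod int N = (a' + b') mod int N"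
  shows "a = a' \<and> b = b'"
proof -
  have "inj_on (\<lambda>(a, b). (a + b) mod int N) (A \<times> B)"
    using assms unfolding tiles_def bij_betw_def by auto
  from inj_onD[OF this, of "(a,b)" "(a',b')"] assms show ?thesis by auto
qed

lemma tilesI_inj_ex:
  assumes "0 < N" "finite A" "finite B"
    and inj: "\<And>a b a' b'. \<lbrakk>a \<in> A; b \<in> B; a' \<in> A; b' \<in> B; (a + b) mod int N = (a' + b') mod int N\<rbrakk> \<Longrightarrow> a = a' \<and> b = b'"
    and ex: "\<And>z. \<exists>a\<in>A. \<exists>b\<in>B. (a + b) mod int N = z mod int N"
  shows "tiles N A B"
proof -
  have "inj_on (\<lambda>(a, b). (a + b) mod int N) (A \<times> B)"
    by (rule inj_onI) (use inj in force)
  moreover have "(\<lambda>(a, b). (a + b) mod int N) ` (A \<times> B) = {0..<int N}"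
  proof
    show "{0..<int N} \<subseteq> (\<lambda>(a, b). (a + b) mod int N) ` (A \<times> B)"
    proof
      fix z assume "z \<in> {0..<int N}"
      with ex[of z] show "z \<in> (\<lambda>(a, b). (a + b) mod int N) ` (A \<times> B)" by force
    qed
  qed (use assms(1) in auto)
  ultimately show ?thesis using assms unfolding tiles_def bij_betw_def by auto
qed

lemma tilesI_inj_card:
  assumes "0 < N" "finite A" "finite B"
    and inj: "\<And>a b a' b'. \<lbrakk>a \<in> A; b \<in> B; a' \<in> A; b' \<in> B; (a + b) mod int N = (a' + b') mod int N\<rbrakk> \<Longrightarrow> a = a' \<and> b = b'"
    and card: "card A * card B = N"
  shows "tiles N A B"
proof -
  have i: "inj_on (\<lambda>(a, b). (a + b) mod int N) (A \<times> B)"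
    by (rule inj_onI) (use inj in force)
  moreover have "(\<lambda>(a, b). (a + b) mod int N) ` (A \<times> B) = {0..<int N}"
    by (rule card_subset_eq) (use assms(1) card_image[OF i] card in \<open>auto simp: card_cartesian_product\<close>)
  ultimately show ?thesis using assms unfolding tiles_def bij_betw_def by auto
qed

lemma tilesI_ex_card:
  assumes "0 < N" "finite A" "finite B"
    and ex: "\<And>z. \<exists>a\<in>A. \<exists>b\<in>B. (a + b) mod int N = z mod int N"
    and card: "card A * card B = N"
  shows "tiles N A B"
proof -
  let ?f = "\<lambda>(a, b). (a + b) mod int N"
  have im: "?f ` (A \<times> B) = {0..<int N}"
  proof
    show "{0..<int N} \<subseteq> ?f ` (A \<times> B)"
    proof
      fix z assume "z \<in> {0..<int N}"
      with ex[of z] show "z \<in> ?f ` (A \<times> B)" by force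
    qed
  qed (use assms(1) in auto)
  have "inj_on ?f (A \<times> B)"
    by (rule eq_card_imp_inj_on) (use assms im in \<open>auto simp: card_cartesian_product\<close>)
  then show ?thesis using assms im unfolding tiles_def bij_betw_def by auto
qed

lemma tiles_commute: "tiles N A B \<longleftrightarrow> tiles N B A"
proof -
  have "tiles N B A" if "tiles N A B" for A B
  proof (rule tilesI_inj_card)
    fix a b a' b' assume "a \<in> B" "b \<in> A" "a' \<in> B" "b' \<in> A" "(a + b) mod int N = (a' + b') mod int N"
    then show "a = a' \<and> b = b'" using tiles_inj[OF that, of b a b' a'] by (simp add: add.commute)
  qed (use that tiles_card[OF that] tiles_finite[OF that] tiles_pos[OF that] in \<open>auto simp: mult.commute\<close>)
  then show ?thesis by blast
qed

section \<open>Dilation of a factor\<close>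

text \<open>The Frobenius identity in the form of a divisibility, so that it can be used for polynomials
  with integer coefficients.\<close>

lemma prime_dvd_power_sum_diff:
  fixes f :: "'b \<Rightarrow> 'a::comm_ring_1"
  assumes r: "prime r" and "finite A"
  shows "(of_nat r :: 'a) dvd (\<Sum>a\<in>A. f a) ^ r - (\<Sum>a\<in>A. f a ^ r)"
  using assms(2)
proof induction
  case empty
  then show ?case using prime_gt_0_nat[OF r] by (simp add: power_0_left)
next
  case (insert x F)
  define s where "s = (\<Sum>a\<in>F. f a)"
  have r0: "r > 0" using prime_gt_0_nat[OF r] .
  have "(f x + s) ^ r = (\<Sum>k\<le>r. of_nat (r choose k) * f x ^ k * s ^ (r - k))"
    by (rule binomial_ring)
  also have "\<dots> = (\<Sum>k\<in>{0,r}. of_nat (r choose k) * f x ^ k * s ^ (r - k)) + (\<Sum>k\<in>{..r}-{0,r}. of_nat (r choose k) * f x ^ k * s ^ (r - k))"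
    by (rule sum.subset_diff[THEN trans]) (auto simp: add.commute)
  also have "(\<Sum>k\<in>{0,r}. of_nat (r choose k) * f x ^ k * s ^ (r - k)) = s ^ r + f x ^ r"
    using r0 by simp
  finally have e: "(f x + s) ^ r - (f x ^ r + s ^ r) = (\<Sum>k\<in>{..r}-{0,r}. of_nat (r choose k) * f x ^ k * s ^ (r - k))"
    by (simp add: algebra_simps)
  have "(of_nat r :: 'a) dvd (\<Sum>k\<in>{..r}-{0,r}. of_nat (r choose k) * f x ^ k * s ^ (r - k))"
  proof (rule dvd_sum)
    fix k assume "k \<in> {..r} - {0, r}"
    then have "r dvd (r choose k)" using r by (intro dvd_choose_prime) auto
    then have "(of_nat r :: 'a) dvd of_nat (r choose k)" by (metis dvd_def of_nat_mult)
    then show "(of_nat r :: 'a) dvd of_nat (r choose k) * f x ^ k * s ^ (r - k)"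
      by (simp add: dvd_mult2)
  qed
  with e have "(of_nat r :: 'a) dvd (f x + s) ^ r - (f x ^ r + s ^ r)" by simp
  moreover have "(of_nat r :: 'a) dvd s ^ r - (\<Sum>a\<in>F. f a ^ r)" using insert s_def by simp
  ultimately have "(of_nat r :: 'a) dvd ((f x + s) ^ r - (f x ^ r + s ^ r)) + (s ^ r - (\<Sum>a\<in>F. f a ^ r))"
    by (rule dvd_add)
  then show ?case using insert(1,2) by (simp add: s_def algebra_simps)
qed

text \<open>The coefficient at the class of \<open>z\<close> of the image of \<open>P\<close> in the group ring
  \<open>\<int>[X]/(X\<^sup>N - 1)\<close>.\<close>

definition class_sum :: "nat \<Rightarrow> int \<Rightarrow> int poly \<Rightarrow> int" where
  "class_sum N z P = (\<Sum>i\<le>degree P. if int i mod int N = z mod int N then coeff P i else 0)"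

lemma class_sum_upto:
  assumes "degree P \<le> n"
  shows "class_sum N z P = (\<Sum>i\<le>n. if int i mod int N = z mod int N then coeff P i else 0)"
  unfolding class_sum_def
  by (rule sum.mono_neutral_left) (use assms in \<open>auto simp: coeff_eq_0\<close>)

lemma class_sum_add: "class_sum N z (P + Q) = class_sum N z P + class_sum N z Q"
proof -
  define n where "n = max (degree P) (degree Q)"
  have "degree P \<le> n" "degree Q \<le> n" "degree (P + Q) \<le> n"
    by (auto simp: n_def degree_add_le_max)
  then show ?thesis by (simp add: class_sum_upto sum.distrib[symmetric] cong: if_cong) (auto intro: sum.cong)
qed

lemma class_sum_smult: "class_sum N z (smult c P) = c * class_sum N z P"
proof -
  have "degree (smult c P) \<le> degree P" by (rule degree_smult_le)
  then show ?thesis by (simp add: class_sum_upto[of _ "degree P"] sum_distrib_left if_distrib cong: if_cong)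
qed

lemma class_sum_0[simp]: "class_sum N z 0 = 0" by (simp add: class_sum_def cong: if_cong)

lemma class_sum_sum: "class_sum N z (\<Sum>x\<in>S. f x) = (\<Sum>x\<in>S. class_sum N z (f x))"
  by (induction S rule: infinite_finite_induct) (auto simp: class_sum_add)

lemma class_sum_monom: "class_sum N z (monom 1 k) = (if int k mod int N = z mod int N then 1 else 0)"
proof -
  have "class_sum N z (monom 1 k) = (\<Sum>i\<le>k. if i = k then (if int k mod int N = z mod int N then 1 else 0) else 0)"
    by (subst class_sum_upto[of _ k], rule degree_monom_le, rule sum.cong) auto
  then show ?thesis by simp
qed

lemma class_sum_pCons_0: "class_sum N z (pCons 0 P) = class_sum N (z - 1) P"
proof -
  have "int (Suc i) mod int N = z mod int N \<longleftrightarrow> int i mod int N = (z - 1) mod int N" for i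
    by (simp add: mod_eq_dvd_iff algebra_simps)
  then show ?thesis
    by (subst class_sum_upto[OF degree_pCons_le])
       (simp add: sum.atMost_Suc_shift class_sum_def coeff_pCons del: of_nat_Suc sum.atMost_Suc cong: if_cong)
qed

text \<open>In the group ring \<open>W\<close> is the sum of all group elements, and multiplication by \<open>Q\<close> acts on it
  through the augmentation \<open>Q(1)\<close>.\<close>

lemma class_sum_mult_uniform:
  assumes "\<And>z. class_sum N z W = 1"
  shows "class_sum N z (Q * W) = poly Q 1"
proof (induction Q arbitrary: z)
  case 0 then show ?case by simp
next
  case (pCons a Q)
  have "pCons a Q * W = smult a W + pCons 0 (Q * W)" by simp
  then show ?case using assms pCons by (simp add: class_sum_add class_sum_smult class_sum_pCons_0)
qed

text \<open>This is Tijdeman's theorem. With mask polynomials \<open>A(X)\<close> and \<open>B(X)\<close>, the product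
  \<open>A(X)\<^sup>r B(X) = A(X)\<^sup>r\<^sup>-\<^sup>1 (A(X) B(X))\<close> takes the value \<open>|A|\<^sup>r\<^sup>-\<^sup>1\<close> on every residue class, because
  \<open>A\<close> and \<open>B\<close> tile. Modulo \<open>r\<close> it agrees with \<open>A(X\<^sup>r) B(X)\<close>, which counts the representations of a
  class by \<open>r A + B\<close>. As \<open>r\<close> does not divide \<open>|A|\<close>, no class is missed, and the
  cardinalities leave no room for a class to be hit twice.\<close>

lemma tiles_dilate_prime:
  assumes t: "tiles N A B" and r: "prime r" and nd: "\<not> r dvd card A"
  shows "tiles N ((*) (int r) ` A) B"
proof (rule tilesI_ex_card)
  note fin = tiles_finite[OF t]
  have N: "0 < N" using tiles_pos[OF t] .
  have r0: "r > 0" using prime_gt_0_nat[OF r] .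
  define e where "e a = nat (a mod int N)" for a
  have e: "int (e a) = a mod int N" for a using N by (simp add: e_def)
  define PA where "PA = (\<Sum>a\<in>A. monom (1::int) (e a))"
  define PB where "PB = (\<Sum>b\<in>B. monom (1::int) (e b))"
  have cs: "class_sum N z ((\<Sum>a\<in>A. monom 1 (k * e a)) * PB) =
      int (card {(a, b) \<in> A \<times> B. (int k * a + b) mod int N = z mod int N})" for z k
  proof -
    have eq: "int (k * e a + e b) mod int N = (int k * a + b) mod int N" for a b
      by (simp add: e) (metis mod_add_eq mod_mult_right_eq mod_add_right_eq mod_add_left_eq)
    have "(\<Sum>a\<in>A. monom 1 (k * e a)) * PB = (\<Sum>(a,b)\<in>A \<times> B. monom (1::int) (k * e a + e b))"
      unfolding PB_def sum_product sum.cartesian_product by (simp add: mult_monom)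
    then have "class_sum N z ((\<Sum>a\<in>A. monom 1 (k * e a)) * PB)
       = (\<Sum>(a,b)\<in>A \<times> B. if (int k * a + b) mod int N = z mod int N then 1 else 0)"
      using eq by (simp add: class_sum_sum case_prod_unfold class_sum_monom)
    also have "\<dots> = (\<Sum>x\<in>A \<times> B. if (int k * fst x + snd x) mod int N = z mod int N then 1 else 0)"
      by (simp add: case_prod_unfold)
    also have "\<dots> = int (card {(a, b) \<in> A \<times> B. (int k * a + b) mod int N = z mod int N})"
      using fin by (simp add: sum.If_cases) (auto intro!: arg_cong[where f=card])
    finally show ?thesis .
  qed
  \<comment> \<open>The product of the mask polynomials is the sum of all group elements.\<close>
  have "class_sum N z (PA * PB) = 1" for z
  proof -
    obtain a b where ab: "a \<in> A" "b \<in> B" "(a + b) mod int N = z mod int N" using tiles_ex[OF t] by blast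
    then have "{(a, b) \<in> A \<times> B. (int 1 * a + b) mod int N = z mod int N} = {(a,b)}"
      using tiles_inj[OF t] by auto
    then show ?thesis using cs[where k=1 and z=z] by (simp add: PA_def)
  qed
  then have u: "class_sum N z (PA ^ (r - 1) * (PA * PB)) = int (card A) ^ (r - 1)" for z
    by (simp add: class_sum_mult_uniform PA_def poly_sum poly_monom)
  have pw: "PA ^ (r - 1) * (PA * PB) = PA ^ r * PB"
    using r0 by (metis mult.assoc power_minus_mult)
  obtain Q where Q: "PA ^ r - (\<Sum>a\<in>A. monom 1 (e a) ^ r) = of_nat r * Q"
    using prime_dvd_power_sum_diff[OF r fin(1), of "\<lambda>a. monom (1::int) (e a)"] unfolding PA_def by blast
  then have "PA ^ r = (\<Sum>a\<in>A. monom 1 (r * e a)) + smult (int r) Q"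
    by (simp add: monom_power of_nat_poly algebra_simps)
  then have key: "int (card A) ^ (r - 1) = int (card {(a, b) \<in> A \<times> B. (int r * a + b) mod int N = z mod int N})
       + int r * class_sum N z (Q * PB)" for z
    using u[of z] pw cs[of z r] by (simp add: distrib_right class_sum_add class_sum_smult)
  show "\<exists>a\<in>(*) (int r) ` A. \<exists>b\<in>B. (a + b) mod int N = z mod int N" for z
  proof (rule ccontr)
    assume "\<not> ?thesis"
    then have "{(a, b) \<in> A \<times> B. (int r * a + b) mod int N = z mod int N} = {}" by auto
    then have "card {(a, b) \<in> A \<times> B. (int r * a + b) mod int N = z mod int N} = 0" by (metis card.empty)
    then have "int (card A) ^ (r - 1) = int r * class_sum N z (Q * PB)" using key[of z] by simp
    then have "int r dvd int (card A) ^ (r - 1)" by simp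
    then have "int r dvd int (card A)" using r by (meson prime_dvd_power prime_nat_int_transfer)
    then show False using nd by simp
  qed
  have "inj_on ((*) (int r)) A" using r0 by (auto intro: inj_onI)
  then show "card ((*) (int r) ` A) * card B = N" using tiles_card[OF t] by (simp add: card_image)
qed (use tiles_finite[OF t] tiles_pos[OF t] in auto)

lemma tiles_dilate:
  assumes t: "tiles N A B" and k: "k > 0" and nd: "\<And>r. prime r \<Longrightarrow> r dvd k \<Longrightarrow> \<not> r dvd card A"
  shows "tiles N ((*) (int k) ` A) B"
  using k nd
proof (induction k rule: prime_divisors_induct)
  case (factor r k)
  have "k > 0" using factor.prems(1) by auto
  then have t': "tiles N ((*) (int k) ` A) B" using factor.IH factor.prems(2) by (meson dvd_mult)
  have c: "card ((*) (int k) ` A) = card A" using \<open>k > 0\<close> by (intro card_image inj_onI) auto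
  have "\<not> r dvd card A" using factor.prems(2)[OF factor.hyps(1)] by simp
  then have "tiles N ((*) (int r) ` (*) (int k) ` A) B"
    by (intro tiles_dilate_prime[OF t' factor.hyps(1)]) (simp add: c)
  then show ?case by (simp add: image_image mult.assoc)
qed (use t in auto)

section \<open>Restriction to residue classes\<close>

definition residue_part :: "int set \<Rightarrow> nat \<Rightarrow> int \<Rightarrow> int set" where
  "residue_part B s i = {x. i + int s * x \<in> B}"

text \<open>Adding an element of a single coset of \<open>s\<int>\<close> permutes the residue classes modulo \<open>s\<close>, so each
  class of \<open>\<int>/N\<close> is tiled by the part of \<open>B\<close> in one class.\<close>

lemma tiles_residue_part:
  assumes t: "tiles N ((\<lambda>x. c + int s * x) ` A) B" and s: "s > 0" and dv: "s dvd N"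
  shows "tiles (N div s) A (residue_part B s i)"
proof -
  have N: "N > 0" using tiles_pos[OF t] .
  have ns: "int N = int s * int (N div s)" using dv by (metis dvd_mult_div_cancel of_nat_mult)
  have fA: "finite A" using tiles_finite(1)[OF t] s by (auto dest!: finite_imageD simp: inj_on_def)
  have inj: "inj_on (\<lambda>x. i + int s * x) S" for S i using s by (auto intro: inj_onI)
  have fB: "finite (residue_part B s i)"
    by (rule finite_imageD[OF finite_subset[OF _ tiles_finite(2)[OF t]] inj[where i=i]])
       (auto simp: residue_part_def)
  show ?thesis
  proof (rule tilesI_inj_ex)
    show "0 < N div s" using dv N s by (auto elim!: dvdE)
    fix a b a' b' assume *: "a \<in> A" "b \<in> residue_part B s i" "a' \<in> A" "b' \<in> residue_part B s i" "(a + b) mod int (N div s) = (a' + b') mod int (N div s)"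
    then have "int (N div s) dvd (a + b) - (a' + b')" by (simp add: mod_eq_dvd_iff)
    then have "int N dvd int s * ((a + b) - (a' + b'))" unfolding ns by (rule mult_dvd_mono[OF dvd_refl])
    then have "(c + int s * a + (i + int s * b)) mod int N = (c + int s * a' + (i + int s * b')) mod int N"
      by (simp add: mod_eq_dvd_iff algebra_simps)
    then have "c + int s * a = c + int s * a' \<and> i + int s * b = i + int s * b'"
      using * by (intro tiles_inj[OF t]) (auto simp: residue_part_def)
    then show "a = a' \<and> b = b'" using s by auto
  next
    fix z
    obtain a b where ab: "a \<in> A" "b \<in> B" "(c + int s * a + b) mod int N = (c + i + int s * z) mod int N"
      using tiles_ex[OF t, of "c + i + int s * z"] by blast
    then have d: "int N dvd int s * (a - z) + (b - i)" by (simp add: mod_eq_dvd_iff algebra_simps)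
    then have "int s dvd int s * (a - z) + (b - i)" using ns by (metis dvd_mult_left)
    then have "int s dvd b - i" by (simp add: dvd_add_right_iff)
    then obtain x where x: "b = i + int s * x" by (metis dvd_def add_diff_cancel_left' diff_add_cancel add.commute)
    have "int s * int (N div s) dvd int s * (a + x - z)" using d x ns by (simp add: algebra_simps)
    then have "int (N div s) dvd a + x - z" using s by simp
    then show "\<exists>a\<in>A. \<exists>b\<in>residue_part B s i. (a + b) mod int (N div s) = z mod int (N div s)"
      using ab x by (auto simp: residue_part_def mod_eq_dvd_iff)
  qed (use fA fB in auto)
qed

lemma tiles_reduce_prime:
  assumes t: "tiles N A B" and r: "prime r" and dv: "r dvd N" and nd: "\<not> r dvd card A"
  shows "tiles (N div r) A (residue_part B r 0)"
proof -
  have "tiles N ((*) (int r) ` A) B" by (rule tiles_dilate_prime[OF t r nd])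
  then have "tiles N ((\<lambda>x. 0 + int r * x) ` A) B" by simp
  then show ?thesis using prime_gt_0_nat[OF r] dv by (intro tiles_residue_part)
qed

text \<open>After dilation by \<open>r\<close> the factor \<open>A\<close> lies in \<open>r\<int>\<close>, and restriction to \<open>r\<int>\<close> with rescaling restores \<open>A\<close>
  with a period divided by \<open>r\<close>. The new complement is built from the old one alone, which is
  why one choice serves all \<open>A\<close>.\<close>

lemma common_reduced_period:
  assumes "N > 0"
  shows "\<exists>N' B'. (\<forall>r. prime r \<longrightarrow> r dvd N' \<longrightarrow> r dvd m) \<and> (\<forall>A. card A = m \<longrightarrow> tiles N A B \<longrightarrow> tiles N' A B')"
  using assms
proof (induction N arbitrary: B rule: less_induct)
  case (less N)
  show ?case
  proof (cases "\<forall>r. prime r \<longrightarrow> r dvd N \<longrightarrow> r dvd m")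
    case True then show ?thesis by blast
  next
    case False
    then obtain r where r: "prime r" "r dvd N" "\<not> r dvd m" by blast
    have "N div r < N" "N div r > 0" using r less.prems prime_gt_1_nat[OF r(1)]
      by (auto simp: div_less_dividend dvd_div_eq_0_iff)
    from less.IH[OF this, of "residue_part B r 0"] obtain N' B' where
      *: "\<forall>r. prime r \<longrightarrow> r dvd N' \<longrightarrow> r dvd m" "\<forall>A. card A = m \<longrightarrow> tiles (N div r) A (residue_part B r 0) \<longrightarrow> tiles N' A B'"
      by blast
    have "tiles N' A B'" if "card A = m" "tiles N A B" for A
      using * tiles_reduce_prime[OF that(2) r(1,2)] r(3) that by auto
    then show ?thesis using *(1) by blast
  qed
qed

section \<open>Periods with two prime factors\<close>

text \<open>Regard the residues modulo \<open>p\<close> and \<open>q\<close> as coordinates in a grid. If any two points of \<open>A\<close> share a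
  row or a column, then all of them lie in one row or in one column.\<close>

lemma exists_coprime_difference:
  fixes A :: "int set"
  assumes p: "prime p" and q: "prime q" and uv: "u + v > 0"
    and nc: "\<And>s. s \<in> {p, q} \<Longrightarrow> s dvd p ^ u * q ^ v \<Longrightarrow> \<exists>a\<in>A. \<exists>a'\<in>A. \<not> int s dvd a - a'"
  shows "\<exists>a\<in>A. \<exists>a'\<in>A. coprime (a - a') (int (p ^ u * q ^ v))"
proof -
  have cp: "coprime z (int (p ^ u * q ^ v))" if "u > 0 \<longrightarrow> \<not> int p dvd z" "v > 0 \<longrightarrow> \<not> int q dvd z" for z
  proof -
    have "coprime z (int p ^ u)" 
      using that(1) prime_imp_coprime[of "int p" z] p by (cases "u = 0") (auto simp: coprime_commute)
    moreover have "coprime z (int q ^ v)" 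
      using that(2) prime_imp_coprime[of "int q" z] q by (cases "v = 0") (auto simp: coprime_commute)
    ultimately show ?thesis by simp
  qed
  have P: "u > 0 \<Longrightarrow> \<exists>a\<in>A. \<exists>a'\<in>A. \<not> int p dvd a - a'" using nc[of p] by (simp add: dvd_mult2)
  have Q: "v > 0 \<Longrightarrow> \<exists>a\<in>A. \<exists>a'\<in>A. \<not> int q dvd a - a'" using nc[of q] by (simp add: dvd_mult)
  have "\<exists>a\<in>A. \<exists>a'\<in>A. (u > 0 \<longrightarrow> \<not> int p dvd a - a') \<and> (v > 0 \<longrightarrow> \<not> int q dvd a - a')"
  proof (cases "u = 0 \<or> v = 0")
    case True then show ?thesis using P Q uv by auto
  next
    case False
    then obtain a1 a2 a3 a4 where a: "a1 \<in> A" "a2 \<in> A" "\<not> int p dvd a1 - a2" "a3 \<in> A" "a4 \<in> A" "\<not> int q dvd a3 - a4"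
      using P Q by blast
    show ?thesis
    proof (cases "\<not> int q dvd a1 - a2 \<or> \<not> int p dvd a3 - a4")
      case True then show ?thesis using a by blast
    next
      case F: False
      \<comment> \<open>The pair \<open>a3\<close>, \<open>a4\<close> lies in one column, and \<open>a1\<close> or \<open>a2\<close> lies in another one.\<close>
    have "\<not> int p dvd a1 - a3 \<or> \<not> int p dvd a2 - a3"
        using a(3) dvd_diff[of "int p" "a1 - a3" "a2 - a3"] by auto
      then obtain x where x: "x \<in> A" "\<not> int p dvd x - a3" using a by blast
      then have x4: "\<not> int p dvd x - a4" using F dvd_diff[of "int p" "x - a4" "a3 - a4"] by auto
      have "\<not> int q dvd x - a3 \<or> \<not> int q dvd x - a4"
        using a(6) dvd_diff[of "int q" "x - a4" "x - a3"] by auto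
      then show ?thesis using x x4 a by blast
    qed
  qed
  then show ?thesis using cp by blast
qed

text \<open>This is Sands's theorem. Otherwise \<open>A\<close> has a difference \<open>a - a'\<close> and \<open>B\<close> a difference \<open>b' - b\<close>, both prime
  to the period. Some multiplier \<open>k\<close> prime to the period carries the first to the second, and then
  \<open>k a + b\<close> and \<open>k a' + b'\<close> are the same class, although \<open>k A\<close> and \<open>B\<close> still tile.\<close>

lemma tiles_two_primes_coset:
  assumes p: "prime p" and q: "prime q" and uv: "u + v > 0" and t: "tiles (p ^ u * q ^ v) A B"
  shows "\<exists>s\<in>{p, q}. s dvd p ^ u * q ^ v \<and>
     ((\<forall>a\<in>A. \<forall>a'\<in>A. int s dvd a - a') \<or> (\<forall>b\<in>B. \<forall>b'\<in>B. int s dvd b - b'))"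
proof (rule ccontr)
  define N where "N = p ^ u * q ^ v"
  assume "\<not> ?thesis"
  then have nA: "\<And>s. s \<in> {p, q} \<Longrightarrow> s dvd p ^ u * q ^ v \<Longrightarrow> \<exists>a\<in>A. \<exists>a'\<in>A. \<not> int s dvd a - a'"
    and nB: "\<And>s. s \<in> {p, q} \<Longrightarrow> s dvd p ^ u * q ^ v \<Longrightarrow> \<exists>a\<in>B. \<exists>a'\<in>B. \<not> int s dvd a - a'"
    by blast+
  obtain a a' where a: "a \<in> A" "a' \<in> A" "coprime (a - a') (int N)"
    using exists_coprime_difference[OF p q uv nA] unfolding N_def by blast
  obtain b b' where b: "b \<in> B" "b' \<in> B" "coprime (b' - b) (int N)"
    using exists_coprime_difference[OF p q uv nB] unfolding N_def by blast
  have N1: "N > 1"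
  proof -
    have "p ^ u > 1 \<or> q ^ v > 1" using uv prime_gt_1_nat[OF p] prime_gt_1_nat[OF q]
      by (metis add_is_0 neq0_conv one_less_power)
    moreover have "p ^ u > 0" "q ^ v > 0" using prime_gt_0_nat[OF p] prime_gt_0_nat[OF q] by auto
    ultimately show ?thesis unfolding N_def
      by (metis One_nat_def Suc_lessI mult_eq_1_iff nat_0_less_mult_iff nat_neq_iff)
  qed
  obtain x y where xy: "x * (a - a') + y * int N = 1"
    using a(3) bezout_int[of "a - a'" "int N"] by (auto simp: coprime_iff_gcd_eq_1)
  then have cx: "coprime x (int N)"
    by (intro coprimeI) (metis dvd_add dvd_mult2 dvd_mult)
  define k where "k = nat ((x * (b' - b)) mod int N)"
  have k: "int k = (x * (b' - b)) mod int N" using N1 by (simp add: k_def)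
  have "coprime (x * (b' - b)) (int N)" using cx b(3) by simp
  then have "coprime (int k) (int N)" unfolding k using N1 by simp
  then have ck: "coprime k N" by simp
  have k0: "k > 0" using ck N1 by (cases k) auto
  have cA: "card A dvd N" using tiles_card[OF t] unfolding N_def by (metis dvd_triv_left)
  have t': "tiles N ((*) (int k) ` A) B"
  proof (rule tiles_dilate[OF _ k0])
    fix r :: nat assume r: "prime r" "r dvd k"
    then show "\<not> r dvd card A" using ck cA by (meson coprime_common_divisor_nat dvd_trans not_prime_1 coprime_common_divisor not_prime_unit)
  qed (use t N_def in simp)
  have "int k mod int N = (x * (b' - b)) mod int N" using k by simp
  then have "int N dvd int k - x * (b' - b)" by (simp add: mod_eq_dvd_iff)
  then have "int N dvd (int k - x * (b' - b)) * (a - a')" by (rule dvd_mult2)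
  moreover have "int N dvd (y * (b' - b)) * int N" by simp
  moreover have "(int k * a + b) - (int k * a' + b') = (int k - x * (b' - b)) * (a - a') - (y * (b' - b)) * int N"
  proof -
    have "b' - b = (x * (a - a') + y * int N) * (b' - b)" using xy by simp
    then show ?thesis by (simp add: algebra_simps)
  qed
  ultimately have "int N dvd (int k * a + b) - (int k * a' + b')" by (metis dvd_diff)
  then have "int k * a = int k * a'"
    using tiles_inj[OF t' imageI[OF a(1)] b(1) imageI[OF a(2)] b(2)] by (simp add: mod_eq_dvd_iff)
  then have "a = a'" using k0 by simp
  then show False using a(3) N1 by simp
qed

definition cong_class :: "int set \<Rightarrow> nat \<Rightarrow> int \<Rightarrow> int set" where
  "cong_class A M c = {x \<in> A. int M dvd x - c}"

section \<open>Equidistribution along prime powers\<close>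

text \<open>For \<open>a \<ge> 1\<close> this says that the cyclotomic polynomial of order \<open>p\<^sup>a\<close> divides the mask polynomial of
  \<open>A\<close>: every class modulo \<open>p\<^sup>a\<^sup>-\<^sup>1\<close> is evenly spread over the \<open>p\<close> classes modulo \<open>p\<^sup>a\<close> above it.\<close>

definition equidist :: "nat \<Rightarrow> nat \<Rightarrow> int set \<Rightarrow> bool" where
  "equidist p a A \<longleftrightarrow> (\<forall>c. card (cong_class A (p ^ (a - 1)) c) = p * card (cong_class A (p ^ a) c))"

lemma finite_cong_class[simp]: "finite A \<Longrightarrow> finite (cong_class A M c)"
  by (simp add: cong_class_def)

lemma card_cong_class_residue_part:
  assumes s: "s > 0"
  shows "card (cong_class B (s * M) (i + int s * e)) = card (cong_class (residue_part B s i) M e)"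
proof -
  have "bij_betw (\<lambda>x. i + int s * x) (cong_class (residue_part B s i) M e) (cong_class B (s * M) (i + int s * e))"
    unfolding bij_betw_def
  proof
    show "inj_on (\<lambda>x. i + int s * x) (cong_class (residue_part B s i) M e)" using s by (auto intro: inj_onI)
    have d: "int (s * M) dvd (i + int s * x) - (i + int s * e) \<longleftrightarrow> int M dvd x - e" for x
    proof -
      have "(i + int s * x) - (i + int s * e) = int s * (x - e)" by (simp add: algebra_simps)
      then show ?thesis using s by simp
    qed
    show "(\<lambda>x. i + int s * x) ` cong_class (residue_part B s i) M e = cong_class B (s * M) (i + int s * e)"
    proof (intro equalityI subsetI)
      fix y assume y: "y \<in> cong_class B (s * M) (i + int s * e)"
      then have "int s dvd y - (i + int s * e)" by (auto simp: cong_class_def intro: dvd_mult_left)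
      then obtain t where "y = i + int s * e + int s * t" by (metis dvd_def add_diff_cancel_left' diff_add_cancel add.commute)
      then have "y = i + int s * (e + t)" by (simp add: algebra_simps)
      then show "y \<in> (\<lambda>x. i + int s * x) ` cong_class (residue_part B s i) M e"
        using y d by (auto simp: cong_class_def residue_part_def)
    qed (use d in \<open>auto simp: cong_class_def residue_part_def\<close>)
  qed
  from bij_betw_same_card[OF this] show ?thesis by simp
qed

lemma sum_residue_parts:
  assumes s: "s > 0" and B: "finite B"
  shows "sum f B = (\<Sum>i<s. \<Sum>x\<in>residue_part B s (int i). f (int i + int s * x))"
proof -
  have "(\<Sum>i<s. \<Sum>x\<in>residue_part B s (int i). f (int i + int s * x)) = (\<Sum>i<s. sum f {x \<in> B. nat (x mod int s) = i})"
  proof (rule sum.cong[OF refl])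
    fix i assume i: "i \<in> {..<s}"
    show "(\<Sum>x\<in>residue_part B s (int i). f (int i + int s * x)) = sum f {x \<in> B. nat (x mod int s) = i}"
    proof (rule sum.reindex_bij_betw)
      show "bij_betw (\<lambda>x. int i + int s * x) (residue_part B s (int i)) {x \<in> B. nat (x mod int s) = i}"
        unfolding bij_betw_def
      proof
        show "inj_on (\<lambda>x. int i + int s * x) (residue_part B s (int i))" using s by (auto intro: inj_onI)
        show "(\<lambda>x. int i + int s * x) ` residue_part B s (int i) = {x \<in> B. nat (x mod int s) = i}"
        proof (intro equalityI subsetI)
          fix y assume y: "y \<in> {x \<in> B. nat (x mod int s) = i}"
          have "y = int i + int s * (y div int s)" using y s by auto
          then show "y \<in> (\<lambda>x. int i + int s * x) ` residue_part B s (int i)"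
            using y by (auto simp: residue_part_def)
        qed (use i in \<open>auto simp: residue_part_def\<close>)
      qed
    qed
  qed
  also have "\<dots> = sum f B"
    using s B by (intro sum.group) (auto simp: nat_less_iff)
  finally show ?thesis by simp
qed

lemma finite_residue_part: "finite B \<Longrightarrow> s > 0 \<Longrightarrow> finite (residue_part B s i)"
  using finite_vimageI[of B "\<lambda>x. i + int s * x"] by (auto simp: residue_part_def vimage_def inj_def)

text \<open>The class \<open>c\<close> modulo \<open>M\<close> is met by every residue part, in the class of \<open>e i\<close>, because \<open>s\<close> is
  invertible modulo \<open>M\<close>.\<close>

lemma card_cong_class_split_coprime:
  assumes s: "s > 0" and B: "finite B" and cop: "coprime s M"
    and e: "\<And>i. int M dvd int i + int s * e i - c"
  shows "card (cong_class B M c) = (\<Sum>i<s. card (cong_class (residue_part B s (int i)) M (e i)))"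
proof -
  have cc: "card (cong_class S M c) = (\<Sum>x\<in>S. if int M dvd x - c then 1 else 0)" if "finite S" for S c
    using that by (simp add: cong_class_def sum.If_cases Int_def)
  have "int M dvd int i + int s * x - c \<longleftrightarrow> int M dvd x - e i" for i x
  proof -
    have "int M dvd int i + int s * x - c \<longleftrightarrow> int M dvd (int i + int s * x - c) - (int i + int s * e i - c)"
      using e by (metis diff_add_cancel dvd_add_left_iff dvd_diff)
    also have "\<dots> \<longleftrightarrow> int M dvd int s * (x - e i)" by (simp add: algebra_simps)
    also have "\<dots> \<longleftrightarrow> int M dvd x - e i" using cop by (simp add: coprime_dvd_mult_right_iff coprime_commute)
    finally show ?thesis .
  qed
  then show ?thesis using finite_residue_part[OF B s]
    by (simp add: cc[OF B] cc sum_residue_parts[OF s B])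
qed

lemma card_cong_class_split:
  assumes s: "s > 0" and M: "M > 0" and B: "finite B"
  shows "card (cong_class B M c) = (\<Sum>i<s. card (cong_class B (s * M) (c + int M * int i)))"
proof -
  have "cong_class B M c = (\<Union>i<s. cong_class B (s * M) (c + int M * int i))"
  proof (intro equalityI subsetI)
    fix x assume x: "x \<in> cong_class B M c"
    then obtain t where t: "x - c = int M * t" by (auto simp: cong_class_def)
    define i where "i = nat (t mod int s)"
    have i: "int i = t mod int s" "i < s" using s by (auto simp: i_def nat_less_iff)
    have "x - (c + int M * int i) = int (s * M) * (t div int s)"
    proof -
      have "x - (c + int M * int i) = int M * (t - t mod int s)" using t i by (simp add: algebra_simps)
      also have "t - t mod int s = int s * (t div int s)" by (simp add: minus_mod_eq_mult_div)
      finally show ?thesis by simp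
    qed
    then have "x \<in> cong_class B (s * M) (c + int M * int i)" using x unfolding cong_class_def by force
    then show "x \<in> (\<Union>i<s. cong_class B (s * M) (c + int M * int i))" using i(2) by blast
  next
    fix x assume "x \<in> (\<Union>i<s. cong_class B (s * M) (c + int M * int i))"
    then obtain i where "x \<in> B" "int (s * M) dvd x - (c + int M * int i)" by (auto simp: cong_class_def)
    then have "int M dvd x - (c + int M * int i) + int M * int i" by (intro dvd_add) (auto intro: dvd_mult_right)
    then show "x \<in> cong_class B M c" using \<open>x \<in> B\<close> by (simp add: cong_class_def algebra_simps)
  qed
  moreover have "card (\<Union>i\<in>{..<s}. cong_class B (s * M) (c + int M * int i)) = (\<Sum>i<s. card (cong_class B (s * M) (c + int M * int i)))"
  proof (rule card_UN_disjoint)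
    show "\<forall>i\<in>{..<s}. \<forall>j\<in>{..<s}. i \<noteq> j \<longrightarrow> cong_class B (s * M) (c + int M * int i) \<inter> cong_class B (s * M) (c + int M * int j) = {}"
    proof (intro ballI impI)
      fix i j assume ij: "i \<in> {..<s}" "j \<in> {..<s}" "i \<noteq> j"
      show "cong_class B (s * M) (c + int M * int i) \<inter> cong_class B (s * M) (c + int M * int j) = {}"
      proof (rule ccontr)
        assume "\<not> ?thesis"
        then obtain x where x: "int (s * M) dvd x - (c + int M * int i)" "int (s * M) dvd x - (c + int M * int j)"
          by (auto simp: cong_class_def)
        have "int (s * M) dvd (x - (c + int M * int j)) - (x - (c + int M * int i))" using x by (rule dvd_diff[rotated])
        then have "int M * int s dvd int M * (int i - int j)" by (simp add: algebra_simps)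
        then have "int s dvd int i - int j" using M by simp
        then have "int i mod int s = int j mod int s" by (simp add: mod_eq_dvd_iff)
        then show False using ij by simp
      qed
    qed
  qed (use B in auto)
  ultimately show ?thesis by simp
qed

lemma card_cong_class_coset:
  assumes "s > 0" 
  shows "card (cong_class ((\<lambda>x. c + int s * x) ` A) (s * M) (c + int s * e)) = card (cong_class A M e)"
proof -
  have "residue_part ((\<lambda>x. c + int s * x) ` A) s c = A" using assms by (auto simp: residue_part_def)
  then show ?thesis using card_cong_class_residue_part[OF assms, of "(\<lambda>x. c + int s * x) ` A" M c e] by simp
qed

lemma power_pred: "a > 0 \<Longrightarrow> (p::nat) ^ a = p * p ^ (a - 1)"
  by (cases a) auto

text \<open>Passing from \<open>A\<close> to the coset \<open>c + p A\<close> shifts the exponents of \<open>p\<close> by one,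
  while those of another prime stay the same.\<close>

lemma equidist_coset_own:
  assumes p: "p > 0" and a: "a \<ge> 2"
  shows "equidist p a ((\<lambda>x. c + int p * x) ` A) \<longleftrightarrow> equidist p (a - 1) A"
proof
  have pw: "p ^ a = p * p ^ (a - 1)" "p ^ (a - 1) = p * p ^ (a - 1 - 1)" using a by - (rule power_pred, linarith)+
  have C: "card (cong_class ((\<lambda>x. c + int p * x) ` A) (p ^ a) (c + int p * e)) = card (cong_class A (p ^ (a - 1)) e)" 
          "card (cong_class ((\<lambda>x. c + int p * x) ` A) (p ^ (a - 1)) (c + int p * e)) = card (cong_class A (p ^ (a - 1 - 1)) e)" for e
    by (simp_all only: pw(1) card_cong_class_coset[OF p]) (subst pw(2), rule card_cong_class_coset[OF p])
  show "equidist p (a - 1) A" if "equidist p a ((\<lambda>x. c + int p * x) ` A)"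
    unfolding equidist_def using that C by (metis equidist_def)
  show "equidist p a ((\<lambda>x. c + int p * x) ` A)" if E: "equidist p (a - 1) A"
    unfolding equidist_def
  proof
    fix z
    show "card (cong_class ((\<lambda>x. c + int p * x) ` A) (p ^ (a - 1)) z) = p * card (cong_class ((\<lambda>x. c + int p * x) ` A) (p ^ a) z)"
    proof (cases "int p dvd z - c")
      case True
      then obtain e where "z = c + int p * e" by (metis dvd_def add_diff_cancel_left' diff_add_cancel add.commute)
      then show ?thesis using C E by (simp add: equidist_def)
    next
      case False
      have "cong_class ((\<lambda>x. c + int p * x) ` A) (p * M) z = {}" for M
      proof (rule ccontr)
        assume "\<not> ?thesis"
        then obtain x where "int (p * M) dvd c + int p * x - z" by (auto simp: cong_class_def)
        then have "int p dvd c + int p * x - z" by (metis dvd_mult_left of_nat_mult)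
        then have "int p dvd int p * x - (c + int p * x - z)" by (rule dvd_diff[OF dvd_triv_left])
        then show False using False by simp
      qed
      then show ?thesis using pw by (metis card.empty mult_0_right)
    qed
  qed
qed

lemma coprime_solve:
  assumes "coprime s (M::nat)"
  shows "\<exists>e. int M dvd c + int s * e - z"
proof -
  obtain x y where "x * int s + y * int M = 1" using assms bezout_int[of "int s" "int M"] by auto
  then have "z - c = (x * int s + y * int M) * (z - c)" by simp
  then have "c + int s * (x * (z - c)) - z = int M * (y * (c - z))" by (simp add: algebra_simps)
  then show ?thesis by (metis dvd_triv_left)
qed

lemma card_cong_class_coset_coprime:
  assumes s: "s > 0" and cop: "coprime s M" and e: "int M dvd c + int s * e - z" and A: "finite A"
  shows "card (cong_class ((\<lambda>x. c + int s * x) ` A) M z) = card (cong_class A M e)"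
proof -
  have "int M dvd c + int s * x - z \<longleftrightarrow> int M dvd x - e" for x
  proof -
    have "int M dvd c + int s * x - z \<longleftrightarrow> int M dvd (c + int s * x - z) - (c + int s * e - z)"
      using e by (metis diff_add_cancel dvd_add_left_iff dvd_diff)
    also have "\<dots> \<longleftrightarrow> int M dvd int s * (x - e)" by (simp add: algebra_simps)
    also have "\<dots> \<longleftrightarrow> int M dvd x - e" using cop by (simp add: coprime_dvd_mult_right_iff coprime_commute)
    finally show ?thesis .
  qed
  then have "cong_class ((\<lambda>x. c + int s * x) ` A) M z = (\<lambda>x. c + int s * x) ` cong_class A M e"
    by (auto simp: cong_class_def)
  then show ?thesis using s by (simp add: card_image inj_on_def)
qed

lemma equidist_coset_other:
  assumes s: "s > 0" and cop: "coprime s q" and A: "finite A"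
  shows "equidist q b ((\<lambda>x. c + int s * x) ` A) \<longleftrightarrow> equidist q b A"
proof
  have cp: "coprime s (q ^ k)" for k using cop by simp
  have *: "card (cong_class ((\<lambda>x. c + int s * x) ` A) (q ^ b) z) = card (cong_class A (q ^ b) e)"
     "card (cong_class ((\<lambda>x. c + int s * x) ` A) (q ^ (b - 1)) z) = card (cong_class A (q ^ (b - 1)) e)"
     if "int (q ^ b) dvd c + int s * e - z" for e z
  proof -
    have "int (q ^ (b - 1)) dvd int (q ^ b)" by (simp add: le_imp_power_dvd)
    then have "int (q ^ (b - 1)) dvd c + int s * e - z" using that dvd_trans by blast
    then show "card (cong_class ((\<lambda>x. c + int s * x) ` A) (q ^ b) z) = card (cong_class A (q ^ b) e)"
     "card (cong_class ((\<lambda>x. c + int s * x) ` A) (q ^ (b - 1)) z) = card (cong_class A (q ^ (b - 1)) e)"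
      using that by (auto intro!: card_cong_class_coset_coprime[OF s cp _ A])
  qed
  show "equidist q b A" if E: "equidist q b ((\<lambda>x. c + int s * x) ` A)"
    unfolding equidist_def
  proof
    fix e show "card (cong_class A (q ^ (b - 1)) e) = q * card (cong_class A (q ^ b) e)"
      using *[of e "c + int s * e"] E by (simp add: equidist_def)
  qed
  show "equidist q b ((\<lambda>x. c + int s * x) ` A)" if E: "equidist q b A"
    unfolding equidist_def
  proof
    fix z
    obtain e where "int (q ^ b) dvd c + int s * e - z" using coprime_solve[OF cp] by blast
    from *[OF this] E show "card (cong_class ((\<lambda>x. c + int s * x) ` A) (q ^ (b - 1)) z) = q * card (cong_class ((\<lambda>x. c + int s * x) ` A) (q ^ b) z)"
      by (simp add: equidist_def)
  qed
qed

lemma equidist_residue_parts_own: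
  assumes p: "p > 0" and a: "a \<ge> 2"
  shows "equidist p a B \<longleftrightarrow> (\<forall>i. equidist p (a - 1) (residue_part B p i))"
proof -
  have pw: "p ^ a = p * p ^ (a - 1)" "p ^ (a - 1) = p * p ^ (a - 1 - 1)" using a by - (rule power_pred, linarith)+
  have C: "card (cong_class B (p ^ a) (i + int p * e)) = card (cong_class (residue_part B p i) (p ^ (a - 1)) e)" 
          "card (cong_class B (p ^ (a - 1)) (i + int p * e)) = card (cong_class (residue_part B p i) (p ^ (a - 1 - 1)) e)" for i e
    by (simp_all only: pw(1) card_cong_class_residue_part[OF p]) (subst pw(2), rule card_cong_class_residue_part[OF p])
  show ?thesis
  proof
    show "\<forall>i. equidist p (a - 1) (residue_part B p i)" if "equidist p a B"
      unfolding equidist_def C[symmetric] using that by (simp add: equidist_def)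
    show "equidist p a B" if "\<forall>i. equidist p (a - 1) (residue_part B p i)"
    proof -
      have "card (cong_class B (p ^ (a - 1)) (c + int p * 0)) = p * card (cong_class B (p ^ a) (c + int p * 0))" for c
        unfolding C using that by (simp add: equidist_def)
      then show ?thesis by (simp add: equidist_def)
    qed
  qed
qed

lemma equidist_residue_parts_other:
  assumes s: "s > 0" and cop: "coprime s q" and B: "finite B"
    and E: "\<And>i. equidist q b (residue_part B s i)"
  shows "equidist q b B"
  unfolding equidist_def
proof
  fix c
  have cp: "coprime s (q ^ k)" for k using cop by simp
  have "\<forall>i::nat. \<exists>x. int (q ^ b) dvd int i + int s * x - c" using coprime_solve[OF cp] by blast
  then obtain e where e: "\<And>i::nat. int (q ^ b) dvd int i + int s * e i - c" by (auto dest!: choice)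
  have "int (q ^ (b - 1)) dvd int (q ^ b)" by (simp add: le_imp_power_dvd)
  then have e': "int (q ^ (b - 1)) dvd int i + int s * e i - c" for i using e dvd_trans by blast
  have "card (cong_class (residue_part B s i) (q ^ (b - 1)) x) = q * card (cong_class (residue_part B s i) (q ^ b) x)" for i x
    using E by (simp add: equidist_def)
  then show "card (cong_class B (q ^ (b - 1)) c) = q * card (cong_class B (q ^ b) c)"
    by (simp only: card_cong_class_split_coprime[OF s B cp e] card_cong_class_split_coprime[OF s B cp e'] sum_distrib_left)
qed

lemma card_residue_part_tile:
  assumes t: "tiles N ((\<lambda>x. c + int s * x) ` A) B" and s: "s > 0" and dv: "s dvd N"
  shows "s * card (residue_part B s i) = card B"
proof -
  have "inj_on (\<lambda>x. c + int s * x) A" using s by (auto intro: inj_onI)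
  then have cA: "card ((\<lambda>x. c + int s * x) ` A) = card A" by (rule card_image)
  have 1: "card A * card (residue_part B s i) = N div s" using tiles_card[OF tiles_residue_part[OF t s dv]] .
  have 2: "card A * card B = N" using tiles_card[OF t] cA by simp
  have "card A * (s * card (residue_part B s i)) = card A * card B" using 1 2 dv by (metis dvd_mult_div_cancel mult.left_commute)
  moreover have "card A > 0" using 2 tiles_pos[OF t] by (cases "card A = 0") auto
  ultimately show ?thesis by simp
qed

text \<open>Each residue part of \<open>B\<close> complements the same set, so all of them have the same size.\<close>

lemma equidist_one_of_coset:
  assumes t: "tiles N ((\<lambda>x. c + int p * x) ` A) B" and p: "p > 0" and dv: "p dvd N"
  shows "equidist p 1 B"
  unfolding equidist_def
proof
  fix z
  have "card (cong_class B (p * 1) (z + int p * 0)) = card (cong_class (residue_part B p z) 1 0)"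
    by (rule card_cong_class_residue_part[OF p])
  then have "card (cong_class B p z) = card (residue_part B p z)" by (simp add: cong_class_def)
  moreover have "cong_class B 1 z = B" by (simp add: cong_class_def)
  ultimately show "card (cong_class B (p ^ (1 - 1)) z) = p * card (cong_class B (p ^ 1) z)"
    using card_residue_part_tile[OF t p dv] by simp
qed

lemma coset_ex_image:
  assumes "\<forall>a\<in>A. \<forall>a'\<in>A. int s dvd a - a'"
  shows "\<exists>c A'. A = (\<lambda>x. c + int s * x) ` A'"
proof (cases "A = {}")
  case False
  then obtain c where c: "c \<in> A" by blast
  have "A = (\<lambda>x. c + int s * x) ` {x. c + int s * x \<in> A}"
  proof (intro equalityI subsetI)
    fix a assume a: "a \<in> A"
    then have "int s dvd a - c" using assms c by blast
    then obtain t where "a = c + int s * t" by (metis dvd_def add_diff_cancel_left' diff_add_cancel add.commute)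
    then show "a \<in> (\<lambda>x. c + int s * x) ` {x. c + int s * x \<in> A}" using a by auto
  qed auto
  then show ?thesis by blast
qed simp

text \<open>Sands's theorem as an induction rule. The factor inside a coset is rescaled and the other one is split into its
  residue parts, which divides the period by a prime. The two swapping premises are there so
  that only a first factor in a coset of the first prime has to be treated.\<close>

lemma two_prime_tiling_induct [consumes 4, case_names trivial swap_factors swap_primes coset]:
  fixes P :: "nat \<Rightarrow> nat \<Rightarrow> nat \<Rightarrow> nat \<Rightarrow> int set \<Rightarrow> int set \<Rightarrow> bool"
  assumes pq: "prime p" "prime q" "p \<noteq> q"
    and t: "tiles (p ^ u * q ^ v) A B"
    and triv: "\<And>p q A B. P p q 0 0 A B"
    and swap: "\<And>p q u v A B. P p q u v A B \<Longrightarrow> P p q u v B A"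
    and swap': "\<And>p q u v A B. P p q u v A B \<Longrightarrow> P q p v u A B"
    and coset: "\<And>p q u v c A B. \<lbrakk>prime p; prime q; p \<noteq> q; 0 < u; tiles (p ^ u * q ^ v) ((\<lambda>x. c + int p * x) ` A) B;
        \<And>i. tiles (p ^ (u - 1) * q ^ v) A (residue_part B p i); \<And>i. P p q (u - 1) v A (residue_part B p i)\<rbrakk> 
        \<Longrightarrow> P p q u v ((\<lambda>x. c + int p * x) ` A) B"
  shows "P p q u v A B"
  using pq t
proof (induction "u + v" arbitrary: p q u v A B rule: less_induct)
  case less
  have step: "P p q u v A B" if pq: "prime p" "prime q" "p \<noteq> q" and t: "tiles (p ^ u * q ^ v) A B"
      and dv: "p dvd p ^ u * q ^ v" and cs: "\<forall>a\<in>A. \<forall>a'\<in>A. int p dvd a - a'"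
      and IH: "\<And>u' v' A B. u' + v' < u + v \<Longrightarrow> tiles (p ^ u' * q ^ v') A B \<Longrightarrow> P p q u' v' A B"
    for p q u v A B
  proof -
    have u: "u > 0"
    proof (rule ccontr)
      assume "\<not> u > 0"
      then have "p dvd q" using dv pq prime_dvd_power by auto
      then show False using pq by (simp add: primes_dvd_imp_eq)
    qed
    obtain c A' where A: "A = (\<lambda>x. c + int p * x) ` A'" using coset_ex_image[OF cs] by blast
    have p0: "p > 0" using pq prime_gt_0_nat by blast
    have N: "p ^ u * q ^ v div p = p ^ (u - 1) * q ^ v" using u p0 by (cases u) auto
    have t': "tiles (p ^ (u - 1) * q ^ v) A' (residue_part B p i)" for i
      using tiles_residue_part[OF t[unfolded A] p0 dv] N by simp
    show ?thesis unfolding A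
      by (rule coset[OF pq u t[unfolded A] t' IH[OF _ t']]) (use u in auto)
  qed
  show ?case
  proof (cases "u + v = 0")
    case True then show ?thesis using triv by simp
  next
    case False
    then obtain s where s: "s \<in> {p, q}" "s dvd p ^ u * q ^ v"
      "(\<forall>a\<in>A. \<forall>a'\<in>A. int s dvd a - a') \<or> (\<forall>b\<in>B. \<forall>b'\<in>B. int s dvd b - b')"
      using tiles_two_primes_coset[OF less.prems(1,2) _ less.prems(4)] by blast
    have IH: "P p q u' v' A B" if "u' + v' < u + v" "tiles (p ^ u' * q ^ v') A B" for u' v' A B
      using less.hyps[OF that(1) less.prems(1-3) that(2)] .
    have IH': "P q p v' u' A B" if "v' + u' < v + u" "tiles (q ^ v' * p ^ u') A B" for u' v' A B
      by (rule swap'[OF IH]) (use that in \<open>auto simp: mult.commute\<close>)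
    have t': "tiles (q ^ v * p ^ u) A B" using less.prems(4) by (simp add: mult.commute)
    have t2: "tiles (p ^ u * q ^ v) B A" "tiles (q ^ v * p ^ u) B A" using t' less.prems(4) tiles_commute by auto
    have dv: "s dvd q ^ v * p ^ u" using s(2) by (simp add: mult.commute)
    have ne: "q \<noteq> p" using less.prems by simp
    show ?thesis
    proof (cases "s = p")
      case sp: True
      show ?thesis
      proof (cases "\<forall>a\<in>A. \<forall>a'\<in>A. int s dvd a - a'")
        case True
        then show ?thesis using step[OF less.prems(1-4) s(2)[unfolded sp] _ IH] sp by blast
      next
        case False
        then show ?thesis using swap[OF step[OF less.prems(1-3) t2(1) s(2)[unfolded sp] _ IH]] s(3) sp by blast
      qed
    next
      case False
      then have sq: "s = q" using s(1) by simp
      show ?thesis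
      proof (cases "\<forall>a\<in>A. \<forall>a'\<in>A. int s dvd a - a'")
        case True
        then show ?thesis using swap'[OF step[OF less.prems(2,1) ne t' dv[unfolded sq] _ IH']] sq by blast
      next
        case False
        then show ?thesis using swap[OF swap'[OF step[OF less.prems(2,1) ne t2(2) dv[unfolded sq] _ IH']]] s(3) sq by blast
      qed
    qed
  qed
qed

definition equidist_cover :: "nat \<Rightarrow> nat \<Rightarrow> nat \<Rightarrow> nat \<Rightarrow> int set \<Rightarrow> int set \<Rightarrow> bool" where
  "equidist_cover p q u v A B \<longleftrightarrow>
     (\<forall>a\<in>{1..u}. equidist p a A \<or> equidist p a B) \<and> (\<forall>b\<in>{1..v}. equidist q b A \<or> equidist q b B)"

text \<open>In the inductive step, \<open>B\<close> is equidistributed modulo \<open>p\<close>. At any other prime power either all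
  residue parts of \<open>B\<close> are equidistributed, and then so is \<open>B\<close>, or one of them is not,
  and then its complement \<open>A\<close> is.\<close>

lemma tiles_equidist_cover:
  assumes "prime p" "prime q" "p \<noteq> q" "tiles (p ^ u * q ^ v) A B"
  shows "equidist_cover p q u v A B"
  using assms
proof (induction rule: two_prime_tiling_induct)
  case (coset p q u v c A B)
  have p0: "p > 0" using coset prime_gt_0_nat by blast
  have cop: "coprime p q" using coset by (simp add: primes_coprime)
  have fA: "finite A" using coset(6) tiles_finite by blast
  have fB: "finite B" using coset(5) tiles_finite by blast
  have dv: "p dvd p ^ u * q ^ v" using coset(4) by (simp add: dvd_mult2)
  show ?case unfolding equidist_cover_def
  proof (intro conjI ballI)
    fix a assume a: "a \<in> {1..u}"
    show "equidist p a ((\<lambda>x. c + int p * x) ` A) \<or> equidist p a B"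
    proof (cases "a = 1")
      case True then show ?thesis using equidist_one_of_coset[OF coset(5) p0 dv] by simp
    next
      case False
      then have a2: "a \<ge> 2" "a - 1 \<in> {1..u - 1}" using a by auto
      then show ?thesis using coset(7)
        unfolding equidist_coset_own[OF p0 a2(1)] equidist_residue_parts_own[OF p0 a2(1), of B] equidist_cover_def by blast
    qed
  next
    fix b assume b: "b \<in> {1..v}"
    show "equidist q b ((\<lambda>x. c + int p * x) ` A) \<or> equidist q b B"
      using coset(7) b equidist_residue_parts_other[OF p0 cop fB, of b]
      unfolding equidist_coset_other[OF p0 cop fA] equidist_cover_def by blast
  qed
qed (auto simp: equidist_cover_def)

definition equidist_exponents :: "nat \<Rightarrow> nat \<Rightarrow> int set \<Rightarrow> nat set" where
  "equidist_exponents p u A = {j \<in> {1..u}. equidist p j A}"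

text \<open>Going down from \<open>u\<close> to \<open>a\<close>, each exponent of equidistribution multiplies the common divisor of
  the class sizes by \<open>p\<close>.\<close>

lemma power_dvd_card_cong_class:
  assumes A: "finite A" and p: "p > 0" and a: "a \<le> u"
  shows "p ^ card {j \<in> {a + 1..u}. equidist p j A} dvd card (cong_class A (p ^ a) c)"
  using a
proof (induction a arbitrary: c rule: inc_induct)
  case base then show ?case by simp
next
  case (step a)
  show ?case
  proof (cases "equidist p (Suc a) A")
    case True
    have "{j \<in> {a + 1..u}. equidist p j A} = insert (Suc a) {j \<in> {Suc a + 1..u}. equidist p j A}"
      using True step(2) by (auto simp: le_less Suc_le_eq not_less)
    then have "card {j \<in> {a + 1..u}. equidist p j A} = Suc (card {j \<in> {Suc a + 1..u}. equidist p j A})"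
      by (simp only:) (rule card_insert_disjoint, auto)
    moreover have "card (cong_class A (p ^ a) c) = p * card (cong_class A (p ^ Suc a) c)"
      using True by (simp add: equidist_def)
    ultimately show ?thesis using step.IH[of c] by (simp add: mult_dvd_mono)
  next
    case False
    have "{j \<in> {a + 1..u}. equidist p j A} = {j \<in> {Suc a + 1..u}. equidist p j A}"
      using False by (auto simp: Suc_le_eq) (metis le_neq_implies_less Suc_leI)
    moreover have "card (cong_class A (p ^ a) c) = (\<Sum>i<p. card (cong_class A (p ^ Suc a) (c + int (p ^ a) * int i)))"
      using card_cong_class_split[OF p _ A, of "p ^ a" c] p by simp
    moreover have "p ^ card {j \<in> {Suc a + 1..u}. equidist p j A} dvd (\<Sum>i<p. card (cong_class A (p ^ Suc a) (c + int (p ^ a) * int i)))"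
      by (rule dvd_sum) (rule step.IH)
    ultimately show ?thesis by simp
  qed
qed

lemma power_equidist_dvd_card:
  assumes "finite A" "p > 0"
  shows "p ^ card (equidist_exponents p u A) dvd card A"
  using power_dvd_card_cong_class[OF assms, of 0 u 0] by (simp add: equidist_exponents_def cong_class_def)

text \<open>Together the two factors are equidistributed along all prime powers that divide the period. Every such
  exponent contributes a prime factor to the cardinality of its factor of the tiling, and these
  cardinalities multiply to the period. So nothing is counted twice, and nothing else divides
  the cardinalities.\<close>

lemma tiles_equidist_exponents:
  assumes pq: "prime p" "prime q" "p \<noteq> q" and t: "tiles (p ^ u * q ^ v) A B"
  shows "equidist_exponents p u A = {1..u} - equidist_exponents p u B"
    and "equidist_exponents q v A = {1..v} - equidist_exponents q v B"
    and "card A = p ^ card (equidist_exponents p u A) * q ^ card (equidist_exponents q v A)"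
proof -
  have p0: "p > 0" "q > 0" using pq prime_gt_0_nat by auto
  have p1: "p > 1" "q > 1" using pq prime_gt_1_nat by auto
  have cop: "coprime p q" using pq by (simp add: primes_coprime)
  note fin = tiles_finite[OF t]
  note cov = tiles_equidist_cover[OF pq t]
  let ?a = "equidist_exponents p u A" and ?b = "equidist_exponents p u B"
  let ?a' = "equidist_exponents q v A" and ?b' = "equidist_exponents q v B"
  have fs: "finite ?a" "finite ?b" "finite ?a'" "finite ?b'" by (auto simp: equidist_exponents_def)
  have un: "?a \<union> ?b = {1..u}" "?a' \<union> ?b' = {1..v}"
    using cov by (auto simp: equidist_exponents_def equidist_cover_def)
  have "p ^ card ?a * p ^ card ?b dvd card A * card B"
    by (intro mult_dvd_mono power_equidist_dvd_card fin p0)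
  then have "p ^ (card ?a + card ?b) dvd p ^ u * q ^ v" by (simp add: power_add tiles_card[OF t])
  then have "p ^ (card ?a + card ?b) dvd p ^ u" using cop by (simp add: coprime_dvd_mult_left_iff)
  then have le: "card ?a + card ?b \<le> u" using p1 power_dvd_imp_le by blast
  have "q ^ card ?a' * q ^ card ?b' dvd card A * card B"
    by (intro mult_dvd_mono power_equidist_dvd_card fin p0)
  then have "q ^ (card ?a' + card ?b') dvd p ^ u * q ^ v" by (simp add: power_add tiles_card[OF t])
  then have "q ^ (card ?a' + card ?b') dvd q ^ v" using cop by (simp add: coprime_dvd_mult_right_iff coprime_commute)
  then have le': "card ?a' + card ?b' \<le> v" using p1 power_dvd_imp_le by blast
  have *: "card ?a + card ?b = u + card (?a \<inter> ?b)" "card ?a' + card ?b' = v + card (?a' \<inter> ?b')"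
    using card_Un_Int[OF fs(1,2)] card_Un_Int[OF fs(3,4)] un by auto
  then have c0: "?a \<inter> ?b = {}" "?a' \<inter> ?b' = {}" using le le' fs by (auto simp: card_eq_0_iff)
  show "?a = {1..u} - ?b" "?a' = {1..v} - ?b'" using un c0 by blast+
  have s: "card ?a + card ?b = u" "card ?a' + card ?b' = v" using * c0 by auto
  have d: "p ^ card (equidist_exponents p u X) * q ^ card (equidist_exponents q v X) dvd card X" if "finite X" for X
    using cop by (intro divides_mult power_equidist_dvd_card that p0) auto
  define x y where "x = p ^ card ?a * q ^ card ?a'" and "y = p ^ card ?b * q ^ card ?b'"
  have "x * y = p ^ (card ?a + card ?b) * q ^ (card ?a' + card ?b')" by (simp add: x_def y_def power_add)
  then have xy: "card A * card B = x * y" using s tiles_card[OF t] by simp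
  obtain m n where mn: "card A = x * m" "card B = y * n" using d[OF fin(1)] d[OF fin(2)] unfolding x_def y_def by blast
  have "x * y > 0" using p0 by (simp add: x_def y_def)
  then have "m * n = 1" using xy mn by (simp add: mult.assoc mult.left_commute)
  then show "card A = p ^ card ?a * q ^ card ?a'" using mn by (simp add: x_def)
qed

section \<open>Zeros of character sums\<close>

lemma exponential_add: "exponential l (x + y) = exponential l x * exponential l y"
  by (simp add: exponential_def algebra_simps exp_add)

lemma exponential_scale: "exponential l (c * x) = exponential (c * l) x"
  by (simp add: exponential_def mult_ac)

lemma exponential_add_left: "exponential (l + m) x = exponential l x * exponential m x"
  by (simp add: exponential_def algebra_simps exp_add)

lemma norm_exponential[simp]: "cmod (exponential l x) = 1"
  by (simp add: exponential_def norm_exp_eq_Re)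

lemma exponential_int: "exponential (of_int m) (of_int n) = 1"
proof -
  have "exponential (of_int m) (of_int n) = exp (2 * of_int (m * n) * of_real pi * \<i>)"
    by (simp add: exponential_def mult_ac)
  also have "\<dots> = 1" by (subst exp_eq_1) (auto intro!: exI[of _ "m * n"])
  finally show ?thesis .
qed

lemma exponential_of_nat: "exponential l (of_nat i) = exponential l 1 ^ i"
  by (simp add: exponential_def mult_ac flip: exp_of_nat_mult)

lemma exponential_eq_1_iff: "exponential l 1 = 1 \<longleftrightarrow> l \<in> \<int>"
proof -
  have "exponential l 1 = 1 \<longleftrightarrow> (\<exists>n::int. 2 * pi * l = of_int (2 * n) * pi)"
    unfolding exponential_def by (subst exp_eq_1) simp
  also have "\<dots> \<longleftrightarrow> (\<exists>n::int. l = of_int n)" by auto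
  finally show ?thesis by (auto simp: Ints_def)
qed

lemma sum_exponential_geometric:
  assumes p: "p > 0" and nd: "\<not> int p dvd k"
  shows "(\<Sum>i<p. exponential (of_int k / of_nat p) (of_nat i)) = 0"
proof -
  define w where "w = exponential (of_int k / of_nat p) 1"
  have "w \<noteq> 1"
  proof
    assume "w = 1"
    then obtain n where "of_int k / of_nat p = (of_int n :: real)" unfolding w_def exponential_eq_1_iff by (auto elim: Ints_cases)
    then have "(of_int k::real) = of_int (n * int p)" using p by (simp add: field_simps)
    then have "k = n * int p" by (simp only: of_int_eq_iff)
    then show False using nd by simp
  qed
  moreover have "w ^ p = 1"
    unfolding w_def using p exponential_scale[of "of_int k / of_nat p" "of_nat p" 1] exponential_int[of k 1]
    by (simp add: flip: exponential_of_nat)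
  ultimately have "(\<Sum>i<p. w ^ i) = 0" using geometric_sum[of w p] by simp
  then show ?thesis by (simp add: exponential_of_nat w_def)
qed

text \<open>The second condition of Coven and Meyerowitz. It concerns the characters of order \<open>p\<^sup>a q\<^sup>b\<close> for which
  \<open>A\<close> is equidistributed along \<open>p\<^sup>a\<close> and along \<open>q\<^sup>b\<close>; an exponent 0 stands for the absence of that prime.\<close>

definition char_sums_vanish :: "nat \<Rightarrow> nat \<Rightarrow> nat \<Rightarrow> nat \<Rightarrow> int set \<Rightarrow> bool" where
  "char_sums_vanish p q u v A \<longleftrightarrow> (\<forall>a\<le>u. \<forall>b\<le>v. \<forall>k::int. (a > 0 \<or> b > 0) \<longrightarrow>
     (a > 0 \<longrightarrow> equidist p a A \<and> \<not> int p dvd k) \<longrightarrow> (b > 0 \<longrightarrow> equidist q b A \<and> \<not> int q dvd k) \<longrightarrow>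
     (\<Sum>x\<in>A. exponential (of_int k / of_nat (p ^ a * q ^ b)) (of_int x)) = 0)"

lemma char_sums_vanishD:
  assumes "char_sums_vanish p q u v A" "a \<le> u" "b \<le> v" "a > 0 \<or> b > 0"
    "a > 0 \<Longrightarrow> equidist p a A \<and> \<not> int p dvd k" "b > 0 \<Longrightarrow> equidist q b A \<and> \<not> int q dvd k"
  shows "(\<Sum>x\<in>A. exponential (of_int k / of_nat (p ^ a * q ^ b)) (of_int x)) = 0"
  using assms unfolding char_sums_vanish_def by blast

lemma not_equidist_one_coset:
  assumes p: "p > 1" and A: "finite A" "A \<noteq> {}"
  shows "\<not> equidist p 1 ((\<lambda>x. c + int p * x) ` A)"
proof
  assume E: "equidist p 1 ((\<lambda>x. c + int p * x) ` A)"
  define C where "C = (\<lambda>x. c + int p * x) ` A"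
  have "cong_class C 1 c = C" by (auto simp: cong_class_def)
  moreover have "cong_class C p c = C" by (auto simp: cong_class_def C_def)
  ultimately have "card C = p * card C" using E unfolding equidist_def C_def by (metis One_nat_def diff_Suc_1 power_0 power_one_right)
  moreover have "card C > 0" using A by (simp add: C_def card_gt_0_iff)
  ultimately show False using p by simp
qed

text \<open>In the inductive step the sum over \<open>c + p A\<close> at \<open>\<xi>\<close> is a multiple of the sum over \<open>A\<close> at \<open>p \<xi>\<close>, and the
  sum over \<open>B\<close> is a combination of the sums over its residue parts at \<open>p \<xi>\<close>. All of these vanish by
  induction unless \<open>p \<xi>\<close> is an integer; then the parts are equally large, and a full sum of \<open>p\<close>-th roots of unity
  is left. That equidistribution of \<open>B\<close> along powers of \<open>q\<close> passes to each residue part is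
  seen through the complement, since \<open>A\<close> is shared by all parts.\<close>

lemma tiles_char_sums_vanish:
  assumes "prime p" "prime q" "p \<noteq> q" "tiles (p ^ u * q ^ v) A B"
  shows "char_sums_vanish p q u v A \<and> char_sums_vanish p q u v B"
  using assms
proof (induction rule: two_prime_tiling_induct)
  case (swap_primes p q u v A B)
  then show ?case unfolding char_sums_vanish_def by (simp add: mult.commute)
next
  case (coset p q u v c A B)
  have p1: "p > 1" using coset prime_gt_1_nat by blast
  then have p0: "p > 0" by simp
  have cop: "coprime p q" using coset by (simp add: primes_coprime)
  have nqp: "\<not> int q dvd int p * k" if "\<not> int q dvd k" for k
    using that cop by (simp add: coprime_dvd_mult_right_iff coprime_commute)
  have tA: "tiles (p ^ (u - 1) * q ^ v) A (residue_part B p i)" for i by (rule coset)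
  have fA: "finite A" "A \<noteq> {}" using tiles_finite[OF tA[of 0]] tiles_nonempty[OF tA[of 0]] by auto
  have fB: "finite B" using coset(5) tiles_finite by blast
  have dv: "p dvd p ^ u * q ^ v" using coset(4) by (simp add: dvd_mult2)
  have VA: "char_sums_vanish p q (u - 1) v A" and VB: "\<And>i. char_sums_vanish p q (u - 1) v (residue_part B p i)" using coset(7) by auto
  let ?A = "(\<lambda>x. c + int p * x) ` A"
  let ?f = "\<lambda>k a b::nat. (of_int k / of_nat (p ^ a * q ^ b) :: real)"
  have f1: "of_nat p * ?f k a b = ?f k (a - 1) b" if "a > 0" for k a b
    using that p0 by (cases a) auto
  have f0: "of_nat p * ?f k 0 b = ?f (int p * k) 0 b" for k b by simp
  have "char_sums_vanish p q u v ?A"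
    unfolding char_sums_vanish_def
  proof (intro allI impI)
    fix a b :: nat and k :: int
    assume *: "a \<le> u" "b \<le> v" "a > 0 \<or> b > 0" "a > 0 \<longrightarrow> equidist p a ?A \<and> \<not> int p dvd k" "b > 0 \<longrightarrow> equidist q b ?A \<and> \<not> int q dvd k"
    have "(\<Sum>x\<in>?A. exponential (?f k a b) (of_int x)) = (\<Sum>x\<in>A. exponential (?f k a b) (of_int (c + int p * x)))"
      using p0 by (subst sum.reindex) (auto intro: inj_onI)
    also have "\<dots> = exponential (?f k a b) (of_int c) * (\<Sum>x\<in>A. exponential (of_nat p * ?f k a b) (of_int x))"
      by (simp only: of_int_add of_int_mult of_int_of_nat_eq exponential_add exponential_scale sum_distrib_left)
    also have "(\<Sum>x\<in>A. exponential (of_nat p * ?f k a b) (of_int x)) = 0"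
    proof (cases "a = 0")
      case True
      then show ?thesis unfolding True f0 using True * nqp equidist_coset_other[OF p0 cop fA(1)] by (intro char_sums_vanishD[OF VA]) auto
    next
      case False
      have "a \<noteq> 1" using not_equidist_one_coset[OF p1 fA] * by auto
      then have a2: "a \<ge> 2" using False by simp
      show ?thesis unfolding f1[OF False[unfolded neq0_conv]]
        using * a2 equidist_coset_other[OF p0 cop fA(1)] equidist_coset_own[OF p0 a2] by (intro char_sums_vanishD[OF VA]) auto
    qed
    finally show "(\<Sum>x\<in>?A. exponential (?f k a b) (of_int x)) = 0" by simp
  qed
  moreover have "char_sums_vanish p q u v B"
    unfolding char_sums_vanish_def
  proof (intro allI impI)
    fix a b :: nat and k :: int
    assume *: "a \<le> u" "b \<le> v" "a > 0 \<or> b > 0" "a > 0 \<longrightarrow> equidist p a B \<and> \<not> int p dvd k" "b > 0 \<longrightarrow> equidist q b B \<and> \<not> int q dvd k"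
    \<comment> \<open>Twice through a complement: from \<open>B\<close> to \<open>A\<close>, then from \<open>A\<close> to the residue part.\<close>
    have Eq: "equidist q b (residue_part B p i)" if b: "b > 0" for i
    proof -
      have "b \<in> {1..v}" using * b by auto
      moreover have "equidist q b B" using * b by blast
      ultimately have "\<not> equidist q b ?A"
        using tiles_equidist_exponents(2)[OF coset(1-3,5)] unfolding equidist_exponents_def by blast
      then have "\<not> equidist q b A" using equidist_coset_other[OF p0 cop fA(1)] by simp
      then show ?thesis using tiles_equidist_cover[OF coset(1-3) tA[of i]] \<open>b \<in> {1..v}\<close> unfolding equidist_cover_def by blast
    qed
    have "(\<Sum>x\<in>B. exponential (?f k a b) (of_int x)) =
       (\<Sum>i<p. \<Sum>x\<in>residue_part B p (int i). exponential (?f k a b) (of_int (int i + int p * x)))"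
      by (rule sum_residue_parts[OF p0 fB])
    also have "\<dots> = (\<Sum>i<p. exponential (?f k a b) (of_nat i) * (\<Sum>x\<in>residue_part B p (int i). exponential (of_nat p * ?f k a b) (of_int x)))"
      by (simp only: of_int_add of_int_mult of_int_of_nat_eq exponential_add exponential_scale sum_distrib_left)
    also have "\<dots> = 0"
    proof (cases "a = 1 \<and> b = 0")
      case True
      have e1: "exponential (of_nat p * ?f k a b) (of_int x) = 1" for x
        using True p0 by (simp add: exponential_int)
      have "card (residue_part B p (int i)) = card B div p" for i
        using card_residue_part_tile[OF coset(5) p0 dv, of "int i"] p0 by (metis nonzero_mult_div_cancel_left neq0_conv)
      then have "(\<Sum>i<p. exponential (?f k a b) (of_nat i) * (\<Sum>x\<in>residue_part B p (int i). exponential (of_nat p * ?f k a b) (of_int x)))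
         = (\<Sum>i<p. exponential (of_int k / of_nat p) (of_nat i)) * of_nat (card B div p)"
        unfolding e1 using True by (simp add: sum_distrib_right)
      then show ?thesis using sum_exponential_geometric[OF p0] * True by simp
    next
      case False
      have "(\<Sum>x\<in>residue_part B p (int i). exponential (of_nat p * ?f k a b) (of_int x)) = 0" for i
      proof (cases "a = 0")
        case a0: True
        show ?thesis unfolding a0 f0 by (intro char_sums_vanishD[OF VB]) (use a0 * nqp Eq in auto)
      next
        case a0: False
        have "equidist p (a - 1) (residue_part B p (int i))" if "a - 1 > 0"
          using * equidist_residue_parts_own[OF p0, of a B] that by auto
        then show ?thesis unfolding f1[OF a0[unfolded neq0_conv]] 
          using * a0 False Eq by (intro char_sums_vanishD[OF VB]) auto
      qed
      then show ?thesis by simp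
    qed
    finally show "(\<Sum>x\<in>B. exponential (?f k a b) (of_int x)) = 0" .
  qed
  ultimately show ?case by blast
qed (auto simp: char_sums_vanish_def)

section \<open>A spectrum common to all complements\<close>

text \<open>The last nonzero digit has a larger power of \<open>p\<close> below it than all others and so decides the
  denominator of the sum.\<close>

lemma digit_expansion_difference:
  fixes f :: "nat \<Rightarrow> int"
  assumes p: "p > 0" and "finite S" "0 \<notin> S" "\<And>j. j \<in> S \<Longrightarrow> \<bar>f j\<bar> < int p"
  shows "\<exists>a k. (\<Sum>j\<in>S. of_int (f j) / of_nat (p ^ j)) = (of_int k / of_nat (p ^ a) :: real) \<and>
     (a = 0 \<and> k = 0 \<and> (\<forall>j\<in>S. f j = 0) \<or> a \<in> S \<and> \<not> int p dvd k)"
  using assms(2-)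
proof (induction S rule: finite_linorder_max_induct)
  case empty
  show ?case by (intro exI[of _ 0]) simp
next
  case (insert b S)
  obtain a k where ak: "(\<Sum>j\<in>S. of_int (f j) / of_nat (p ^ j)) = (of_int k / of_nat (p ^ a) :: real)"
     "a = 0 \<and> k = 0 \<and> (\<forall>j\<in>S. f j = 0) \<or> a \<in> S \<and> \<not> int p dvd k"
    using insert.IH insert.prems by auto
  have bS: "b \<notin> S" "b > 0" using insert by auto
  show ?case
  proof (cases "f b = 0")
    case True
    then show ?thesis using ak bS insert.hyps(1) by (intro exI[of _ a] exI[of _ k]) auto
  next
    case False
    have ab: "a < b" using ak(2) insert.hyps(2) bS by auto
    have "\<not> int p dvd f b"
    proof
      assume "int p dvd f b"
      from dvd_imp_le_int[OF False this] insert.prems(2)[of b] show False by simp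
    qed
    moreover have "int p dvd k * int p ^ (b - a)" using ab by simp
    ultimately have nd: "\<not> int p dvd f b + k * int p ^ (b - a)" by (simp add: dvd_add_left_iff)
    have "(\<Sum>j\<in>insert b S. of_int (f j) / of_nat (p ^ j)) = (of_int (f b) / of_nat (p ^ b) + of_int k / of_nat (p ^ a) :: real)"
      using bS insert.hyps(1) ak(1) by simp
    also have "(of_int k / of_nat (p ^ a) :: real) = of_int (k * int p ^ (b - a)) / of_nat (p ^ b)"
    proof -
      have "(of_nat p :: real) ^ b = of_nat p ^ a * of_nat p ^ (b - a)" using ab by (simp flip: power_add)
      then show ?thesis using p by (simp add: field_simps)
    qed
    finally show ?thesis using nd
      by (intro exI[of _ b] exI[of _ "f b + k * int p ^ (b - a)"]) (simp add: add_divide_distrib)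
  qed
qed

definition finite_spectrum :: "real set \<Rightarrow> int set \<Rightarrow> bool" where
  "finite_spectrum L A \<longleftrightarrow> finite L \<and> finite A \<and> card L = card A \<and>
     (\<forall>l\<in>L. \<forall>l'\<in>L. l \<noteq> l' \<longrightarrow> (\<Sum>x\<in>A. exponential (l - l') (of_int x)) = 0)"

lemma finite_spectrumD:
  assumes "finite_spectrum L A"
  shows "finite L" "finite A" "card L = card A"
    "\<lbrakk>l \<in> L; l' \<in> L; l \<noteq> l'\<rbrakk> \<Longrightarrow> (\<Sum>x\<in>A. exponential (l - l') (of_int x)) = 0"
  using assms by (auto simp: finite_spectrum_def)

text \<open>The frequencies are all digit sums over the prime powers along which \<open>B\<close> fails to be equidistributed.
  A difference of two of them has order \<open>p\<^sup>a q\<^sup>b\<close> with \<open>a\<close> and \<open>b\<close> among these exponents, where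
  every complement of \<open>B\<close> has a vanishing character sum.\<close>

lemma common_spectrum_two_primes:
  assumes pq: "prime p" "prime q" "p \<noteq> q"
  shows "\<exists>L. \<forall>A. tiles (p ^ u * q ^ v) A B \<longrightarrow> finite_spectrum L A"
proof -
  define S where "S = {1..u} - equidist_exponents p u B"
  define S' where "S' = {1..v} - equidist_exponents q v B"
  have fS: "finite S" "0 \<notin> S" "finite S'" "0 \<notin> S'" by (auto simp: S_def S'_def)
  have p0: "p > 0" "q > 0" using pq prime_gt_0_nat by auto
  have cop: "coprime p q" using pq by (simp add: primes_coprime)
  define X where "X = (PiE S (\<lambda>_. {0..<int p})) \<times> (PiE S' (\<lambda>_. {0..<int q}))"
  define h where "h = (\<lambda>(f :: nat \<Rightarrow> int, g :: nat \<Rightarrow> int). (\<Sum>j\<in>S. of_int (f j) / of_nat (p ^ j)) + (\<Sum>j\<in>S'. of_int (g j) / of_nat (q ^ j)) :: real)"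
  have fX: "finite X" unfolding X_def using fS by (intro finite_cartesian_product finite_PiE) auto
  have cX: "card X = p ^ card S * q ^ card S'" unfolding X_def using fS by (simp add: card_cartesian_product card_PiE)
  have van: "(\<Sum>x\<in>A. exponential (h w - h w') (of_int x)) = 0"
    if t: "tiles (p ^ u * q ^ v) A B" and w: "w \<in> X" "w' \<in> X" "w \<noteq> w'" for A w w'
  proof -
    obtain f g f' g' where fg: "w = (f, g)" "w' = (f', g')" by (cases w, cases w')
    have fg_in: "f \<in> PiE S (\<lambda>_. {0..<int p})" "f' \<in> PiE S (\<lambda>_. {0..<int p})"
      "g \<in> PiE S' (\<lambda>_. {0..<int q})" "g' \<in> PiE S' (\<lambda>_. {0..<int q})" using w fg by (auto simp: X_def)
    have bd: "\<bar>f j - f' j\<bar> < int p" if "j \<in> S" for j using fg_in(1,2) that by (force simp: PiE_iff)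
    have bd': "\<bar>g j - g' j\<bar> < int q" if "j \<in> S'" for j using fg_in(3,4) that by (force simp: PiE_iff)
    obtain a k where ak: "(\<Sum>j\<in>S. of_int (f j - f' j) / of_nat (p ^ j)) = (of_int k / of_nat (p ^ a) :: real)"
      "a = 0 \<and> k = 0 \<and> (\<forall>j\<in>S. f j - f' j = 0) \<or> a \<in> S \<and> \<not> int p dvd k"
      using digit_expansion_difference[of p S "\<lambda>j. f j - f' j"] fS bd p0 by auto
    obtain b l where bl: "(\<Sum>j\<in>S'. of_int (g j - g' j) / of_nat (q ^ j)) = (of_int l / of_nat (q ^ b) :: real)"
      "b = 0 \<and> l = 0 \<and> (\<forall>j\<in>S'. g j - g' j = 0) \<or> b \<in> S' \<and> \<not> int q dvd l"
      using digit_expansion_difference[of q S' "\<lambda>j. g j - g' j"] fS bd' p0 by auto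
    have "h w - h w' = of_int k / of_nat (p ^ a) + of_int l / of_nat (q ^ b)"
      unfolding ak(1)[symmetric] bl(1)[symmetric] fg h_def
      by (simp add: diff_divide_distrib sum_subtractf)
    also have "\<dots> = of_int (k * int q ^ b + l * int p ^ a) / of_nat (p ^ a * q ^ b)"
      using p0 by (simp add: field_simps)
    finally have hw: "h w - h w' = of_int (k * int q ^ b + l * int p ^ a) / of_nat (p ^ a * q ^ b)" .
    have ne: "a > 0 \<or> b > 0"
    proof (rule ccontr)
      assume "\<not> ?thesis"
      then have "\<forall>j\<in>S. f j = f' j" "\<forall>j\<in>S'. g j = g' j" using ak(2) bl(2) fS by auto
      then have "f = f'" "g = g'" using fg_in by (auto intro: PiE_ext)
      then show False using w fg by simp
    qed
    have E: "equidist_exponents p u A = S" "equidist_exponents q v A = S'"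
      using tiles_equidist_exponents(1,2)[OF pq t] by (simp_all add: S_def S'_def)
    show ?thesis unfolding hw
    proof (rule char_sums_vanishD[OF conjunct1[OF tiles_char_sums_vanish[OF pq t]] _ _ ne])
      show "a \<le> u" using ak(2) by (auto simp: S_def)
      show "b \<le> v" using bl(2) by (auto simp: S'_def)
      show "equidist p a A \<and> \<not> int p dvd k * int q ^ b + l * int p ^ a" if "a > 0"
      proof
        show "equidist p a A" using that ak(2) E(1) unfolding equidist_exponents_def by blast
        have "\<not> int p dvd k" using ak(2) that by auto
        then have "\<not> int p dvd k * int q ^ b" using cop by (simp add: coprime_dvd_mult_left_iff)
        then show "\<not> int p dvd k * int q ^ b + l * int p ^ a" using that by (simp add: dvd_add_left_iff)
      qed
      show "equidist q b A \<and> \<not> int q dvd k * int q ^ b + l * int p ^ a" if "b > 0"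
      proof
        show "equidist q b A" using that bl(2) E(2) unfolding equidist_exponents_def by blast
        have "\<not> int q dvd l" using bl(2) that by auto
        then have "\<not> int q dvd l * int p ^ a" using cop by (simp add: coprime_dvd_mult_left_iff coprime_commute)
        then show "\<not> int q dvd k * int q ^ b + l * int p ^ a" using that by (simp add: dvd_add_right_iff)
      qed
    qed
  qed
  have "finite_spectrum (h ` X) A" if t: "tiles (p ^ u * q ^ v) A B" for A
    unfolding finite_spectrum_def
  proof (intro conjI)
    show "finite (h ` X)" using fX by simp
    show "finite A" by (rule tiles_finite[OF t])
    have "inj_on h X"
    proof (rule inj_onI, rule ccontr)
      fix w w' assume "w \<in> X" "w' \<in> X" "h w = h w'" "w \<noteq> w'"
      then have "(\<Sum>x\<in>A. exponential 0 (of_int x)) = 0" using van[OF t] by fastforce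
      then have "card A = 0" by (simp add: exponential_def)
      then show False using tiles_finite[OF t] tiles_nonempty[OF t] by simp
    qed
    moreover have "card A = card X"
      using tiles_equidist_exponents[OF pq t] cX by (simp add: S_def S'_def)
    ultimately show "card (h ` X) = card A" by (simp add: card_image)
    show "\<forall>l\<in>h ` X. \<forall>l'\<in>h ` X. l \<noteq> l' \<longrightarrow> (\<Sum>x\<in>A. exponential (l - l') (of_int x)) = 0"
      using van[OF t] by blast
  qed
  then show ?thesis by blast
qed

lemma common_spectrum:
  assumes pq: "prime p" "prime q" "p \<noteq> q" and N: "N > 0" and m: "\<And>r. prime r \<Longrightarrow> r dvd m \<Longrightarrow> r = p \<or> r = q"
  shows "\<exists>L. \<forall>A. card A = m \<longrightarrow> tiles N A B \<longrightarrow> finite_spectrum L A"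
proof (cases "\<exists>A. card A = m \<and> tiles N A B")
  case True
  obtain N' B' where N': "\<And>r. prime r \<Longrightarrow> r dvd N' \<Longrightarrow> r dvd m" "\<And>A. card A = m \<Longrightarrow> tiles N A B \<Longrightarrow> tiles N' A B'"
    using common_reduced_period[OF N, of m B] by blast
  have "N' > 0" using True N'(2) tiles_pos by blast
  then have "N' = (\<Prod>r\<in>prime_factors N'. r ^ multiplicity r N')" using prime_factorization_nat by blast
  also have "\<dots> = (\<Prod>r\<in>{p, q}. r ^ multiplicity r N')"
  proof (rule prod.mono_neutral_left)
    show "prime_factors N' \<subseteq> {p, q}" using N'(1) m by (auto simp: in_prime_factors_iff)
    show "\<forall>i\<in>{p, q} - prime_factors N'. i ^ multiplicity i N' = 1"
      using pq by (auto simp: prime_factors_multiplicity)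
  qed simp
  also have "\<dots> = p ^ multiplicity p N' * q ^ multiplicity q N'" using pq by simp
  finally obtain u v where "N' = p ^ u * q ^ v" by blast
  then show ?thesis using common_spectrum_two_primes[OF pq, of u v B'] N'(2) by blast
next
  case False
  then show ?thesis by blast
qed

section \<open>Periods of complements and primes of the cardinality\<close>

text \<open>There are only \<open>2\<^sup>W\<close> patterns of length \<open>W\<close>. The windows are placed at multiples of \<open>W\<close> and therefore
  do not overlap.\<close>

lemma repeated_window:
  fixes S :: "int set" and W :: nat
  assumes "W > 0"
  shows "\<exists>i j. i < j \<and> j \<le> 2 ^ W \<and> (\<forall>o'\<in>{0..<int W}. z + int (i * W) + o' \<in> S \<longleftrightarrow> z + int (j * W) + o' \<in> S)"
proof -
  define f where "f i = {o' \<in> {0..<int W}. z + int (i * W) + o' \<in> S}" for i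
  have "f ` {..(2::nat) ^ W} \<subseteq> Pow {0..<int W}" by (auto simp: f_def)
  then have "card (f ` {..(2::nat) ^ W}) \<le> 2 ^ W"
    by (metis card_Pow card_atLeastLessThan_int card_mono diff_zero finite_Pow_iff finite_atLeastLessThan_int nat_int)
  then have "card (f ` {..(2::nat) ^ W}) < card {..(2::nat) ^ W}" by simp
  then have "\<not> inj_on f {..(2::nat) ^ W}" by (rule pigeonhole)
  then obtain x y where xy: "x \<le> 2 ^ W" "y \<le> 2 ^ W" "x \<noteq> y" "f x = f y" by (auto simp: inj_on_def)
  have *: "z + int (i * W) + o' \<in> S \<longleftrightarrow> z + int (j * W) + o' \<in> S" if "f i = f j" "o' \<in> {0..<int W}" for i j o'
    using that unfolding f_def by blast
  show ?thesis
  proof (cases "x < y")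
    case True then show ?thesis using xy * by blast
  next
    case False
    then have "y < x" "f y = f x" using xy by auto
    then show ?thesis using xy(1) * by blast
  qed
qed

definition periodize :: "nat \<Rightarrow> int set \<Rightarrow> int set" where
  "periodize N B = {z. \<exists>b\<in>B. int N dvd z - b}"

lemma periodize_shift: "z + int N * t \<in> periodize N B \<longleftrightarrow> z \<in> periodize N B"
proof -
  have "int N dvd z + int N * t - b \<longleftrightarrow> int N dvd z - b" for b
    using dvd_add_left_iff[OF dvd_triv_left[of "int N" t], of "z - b"] by (simp add: algebra_simps)
  then show ?thesis by (simp add: periodize_def)
qed

lemma tiles_periodize_unique:
  assumes t: "tiles N A B" and a: "a \<in> A" "a' \<in> A" "j \<in> periodize N B" "j' \<in> periodize N B" "a + j = a' + j'"
  shows "a = a'"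
proof -
  obtain b b' where b: "b \<in> B" "int N dvd j - b" "b' \<in> B" "int N dvd j' - b'" using a by (auto simp: periodize_def)
  have "int N dvd (j' - b') - (j - b)" by (rule dvd_diff[OF b(4) b(2)])
  also have "(j' - b') - (j - b) = (a + b) - (a' + b')" using a(5) by simp
  finally show ?thesis using tiles_inj[OF t a(1) b(1) a(2) b(3)] by (simp add: mod_eq_dvd_iff)
qed

lemma tiles_periodize_ex:
  assumes t: "tiles N A B"
  shows "\<exists>a\<in>A. z - a \<in> periodize N B"
proof -
  obtain a b where "a \<in> A" "b \<in> B" "(a + b) mod int N = z mod int N" using tiles_ex[OF t] by blast
  moreover then have "int N dvd z - a - b" by (metis mod_eq_dvd_iff diff_diff_eq)
  ultimately show ?thesis by (auto simp: periodize_def)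
qed

text \<open>The point \<open>z + Min A\<close> is covered exactly once. It is covered by the translate at \<open>z\<close> if and only
  if no translate further to the left covers it, so the translates in a window determine the next one.\<close>

lemma tiles_periodize_determined:
  assumes t: "tiles N A B"
  shows "z \<in> periodize N B \<longleftrightarrow> (\<forall>a\<in>A - {Min A}. z + Min A - a \<notin> periodize N B)"
proof
  note A = tiles_finite(1)[OF t] tiles_nonempty(1)[OF t]
  show "\<forall>a\<in>A - {Min A}. z + Min A - a \<notin> periodize N B" if "z \<in> periodize N B"
  proof (intro ballI notI)
    fix a assume a: "a \<in> A - {Min A}" "z + Min A - a \<in> periodize N B"
    have "Min A = a" using a A that by (intro tiles_periodize_unique[OF t, of "Min A" a z "z + Min A - a"]) auto
    then show False using a by simp
  qed
  assume *: "\<forall>a\<in>A - {Min A}. z + Min A - a \<notin> periodize N B"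
  obtain a where "a \<in> A" "z + Min A - a \<in> periodize N B" using tiles_periodize_ex[OF t] by blast
  then show "z \<in> periodize N B" using * by (cases "a = Min A") auto
qed

text \<open>By pigeonhole some window pattern recurs within a bounded distance, and from there on the pattern
  repeats since each window determines what follows. Periodicity carries this back to
  the left. The factorial is a multiple of every possible distance, and it depends on \<open>A\<close> only through
  the bound \<open>K\<close>.\<close>

lemma tiles_bounded_period:
  assumes t: "tiles N A B" and A: "A \<subseteq> {-K..K}" and W: "int W = 2 * K + 1"
  shows "z + int (W * fact (2 ^ W)) \<in> periodize N B \<longleftrightarrow> z \<in> periodize N B"
proof -
  define J where "J = periodize N B"
  have N: "N > 0" using tiles_pos[OF t] .
  have finA: "finite A" "A \<noteq> {}" using tiles_finite(1)[OF t] tiles_nonempty(1)[OF t] .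
  have "\<exists>x. x \<in> A" using finA by blast
  then have "K \<ge> 0" using A by auto
  then have W0: "W > 0" using W by linarith
  obtain i j where ij: "i < j" "j \<le> 2 ^ W" and win: "\<And>e. e \<in> {0..<int W} \<Longrightarrow> 0 + int (i * W) + e \<in> J \<longleftrightarrow> 0 + int (j * W) + e \<in> J"
    using repeated_window[OF W0, of 0 J] by blast
  define x where "x = int (i * W)"
  define y where "y = int (j * W)"
  have win: "x + e \<in> J \<longleftrightarrow> y + e \<in> J" if "0 \<le> e" "e < int W" for e using win[of e] that by (simp add: x_def y_def)
  have fwd: "x + int e \<in> J \<longleftrightarrow> y + int e \<in> J" for e
  proof (induction e rule: less_induct)
    case (less e)
    show ?case
    proof (cases "int e < int W")
      case True then show ?thesis using win by simp
    next
      case False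
      have "x + int e + Min A - a \<in> J \<longleftrightarrow> y + int e + Min A - a \<in> J" if a: "a \<in> A - {Min A}" for a
      proof -
        have "Min A < a" using a finA by (simp add: order_less_le)
        moreover have "a \<le> K" "- K \<le> Min A" using a A Min_in[OF finA] by auto
        ultimately have *: "0 < a - Min A" "a - Min A < int W" using W by linarith+
        define e' where "e' = nat (int e - (a - Min A))"
        have e': "int e' = int e - (a - Min A)" using * False by (simp add: e'_def)
        then have "e' < e" using * by linarith
        then show ?thesis using less.IH[of e'] e' by (simp add: algebra_simps)
      qed
      then show ?thesis unfolding J_def
        by (subst (1 2) tiles_periodize_determined[OF t]) simp
    qed
  qed
  have per: "z + (y - x) \<in> J \<longleftrightarrow> z \<in> J" for z
  proof -
    define k where "k = \<bar>z\<bar> + \<bar>x\<bar>"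
    have "int N * k \<ge> 1 * k" using N by (intro mult_right_mono) (auto simp: k_def)
    then have "z + int N * k - x \<ge> 0" by (simp add: k_def)
    then obtain e where e: "z + int N * k = x + int e" by (metis add_diff_cancel_left' diff_add_cancel nonneg_int_cases add.commute)
    have "z \<in> J \<longleftrightarrow> x + int e \<in> J" unfolding J_def e[symmetric] periodize_shift ..
    also have "\<dots> \<longleftrightarrow> y + int e \<in> J" by (rule fwd)
    also have "y + int e = z + (y - x) + int N * k" using e by simp
    finally show ?thesis by (simp add: J_def periodize_shift)
  qed
  have perm: "z + int n * (y - x) \<in> J \<longleftrightarrow> z \<in> J" for z n
  proof (induction n)
    case (Suc n)
    have "z + int (Suc n) * (y - x) = (z + int n * (y - x)) + (y - x)" by (simp add: algebra_simps)
    then show ?case using Suc per[of "z + int n * (y - x)"] by (simp only:)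
  qed simp
  have "(j - i) dvd fact (2 ^ W)" using ij by (intro dvd_fact) auto
  then obtain n where n: "fact (2 ^ W) = (j - i) * n" by blast
  have "int (W * fact (2 ^ W)) = int n * (y - x)"
    unfolding n x_def y_def using ij by (simp add: algebra_simps of_nat_diff)
  then show ?thesis using perm by (simp add: J_def)
qed

lemma sum_periodic_window:
  fixes f :: "int \<Rightarrow> complex"
  assumes P: "P > 0" and per: "\<And>z. z + int P \<in> J \<longleftrightarrow> z \<in> J" "\<And>z. f (z + int P) = f z"
  shows "(\<Sum>x\<in>J \<inter> {0..<int (n * P)}. f x) = of_nat n * (\<Sum>x\<in>J \<inter> {0..<int P}. f x)"
proof (induction n)
  case 0 then show ?case by simp
next
  case (Suc n)
  have per': "(z + int n * int P \<in> J \<longleftrightarrow> z \<in> J) \<and> f (z + int n * int P) = f z" for z n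
  proof (induction n)
    case (Suc n)
    have e: "z + int (Suc n) * int P = (z + int n * int P) + int P" by (simp add: algebra_simps)
    show ?case unfolding e per using Suc by simp
  qed simp
  have s: "J \<inter> {0..<int (Suc n * P)} = (J \<inter> {0..<int (n * P)}) \<union> (J \<inter> {int (n * P)..<int (Suc n * P)})"
  proof -
    have "{0..<int (Suc n * P)} = {0..<int (n * P)} \<union> {int (n * P)..<int (Suc n * P)}"
      by (rule ivl_disj_un_two(3)[symmetric]) auto
    then show ?thesis by blast
  qed
  have i: "J \<inter> {int (n * P)..<int (Suc n * P)} = (\<lambda>z. z + int n * int P) ` (J \<inter> {0..<int P})"
  proof (intro equalityI subsetI)
    fix z assume z: "z \<in> J \<inter> {int (n * P)..<int (Suc n * P)}"
    then have "z - int n * int P \<in> J \<inter> {0..<int P}" using per'[of "z - int n * int P" n] by (auto simp: algebra_simps)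
    then show "z \<in> (\<lambda>z. z + int n * int P) ` (J \<inter> {0..<int P})" by (metis (no_types, lifting) diff_add_cancel image_iff)
  next
    fix z assume "z \<in> (\<lambda>z. z + int n * int P) ` (J \<inter> {0..<int P})"
    then obtain w where w: "w \<in> J" "0 \<le> w" "w < int P" "z = w + int n * int P" by auto
    then have "z \<in> J" using per' by blast
    then show "z \<in> J \<inter> {int (n * P)..<int (Suc n * P)}" using w by (simp add: algebra_simps)
  qed
  have "(\<Sum>x\<in>J \<inter> {int (n * P)..<int (Suc n * P)}. f x) = (\<Sum>x\<in>J \<inter> {0..<int P}. f x)"
    unfolding i by (subst sum.reindex) (use per' in \<open>auto intro: inj_onI\<close>)
  moreover have "(\<Sum>x\<in>J \<inter> {0..<int (Suc n * P)}. f x) = (\<Sum>x\<in>J \<inter> {0..<int (n * P)}. f x) + (\<Sum>x\<in>J \<inter> {int (n * P)..<int (Suc n * P)}. f x)"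
    unfolding s by (rule sum.union_disjoint) auto
  ultimately show ?case using Suc by (simp add: algebra_simps)
qed

lemma sum_periodize_window:
  fixes f :: "int \<Rightarrow> complex"
  assumes t: "tiles N A B" and per: "\<And>z t. f (z + int N * t) = f z"
  shows "(\<Sum>x\<in>periodize N B \<inter> {0..<int N}. f x) = sum f B"
proof -
  have N: "N > 0" using tiles_pos[OF t] .
  obtain a where a: "a \<in> A" using tiles_nonempty[OF t] by blast
  have b: "bij_betw (\<lambda>x. x mod int N) B (periodize N B \<inter> {0..<int N})"
    unfolding bij_betw_def
  proof
    show "inj_on (\<lambda>x. x mod int N) B"
    proof (rule inj_onI)
      fix x y assume "x \<in> B" "y \<in> B" "x mod int N = y mod int N"
      then show "x = y" using tiles_inj[OF t a, of x a y] a by (metis mod_add_right_eq)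
    qed
    show "(\<lambda>x. x mod int N) ` B = periodize N B \<inter> {0..<int N}"
    proof (intro equalityI subsetI)
      fix z assume "z \<in> periodize N B \<inter> {0..<int N}"
      then obtain x where x: "x \<in> B" "int N dvd z - x" "0 \<le> z" "z < int N" by (auto simp: periodize_def)
      then have "x mod int N = z" by (metis mod_eq_dvd_iff mod_pos_pos_trivial)
      then show "z \<in> (\<lambda>x. x mod int N) ` B" using x by blast
    next
      fix z assume "z \<in> (\<lambda>x. x mod int N) ` B"
      then obtain x where "x \<in> B" "z = x mod int N" by blast
      then show "z \<in> periodize N B \<inter> {0..<int N}" using N
        by (auto simp: periodize_def intro!: bexI[of _ x]) (metis dvd_minus_mod dvd_diff_commute)
    qed
  qed
  have "f (x mod int N) = f x" for x using per[of "x mod int N" "x div int N"] by (simp add: mult.commute)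
  then show ?thesis using sum.reindex_bij_betw[OF b, of f] by simp
qed

lemma norm_one_plus_unit_less:
  assumes "cmod z = 1" "z \<noteq> 1"
  shows "cmod (1 + z) < 2"
proof -
  have r: "Re z < 1"
  proof (rule ccontr)
    assume "\<not> Re z < 1"
    then have "Re z = 1" using complex_Re_le_cmod[of z] assms by simp
    then have "Im z = 0" using assms(1) cmod_power2[of z] by simp
    then show False using assms(2) \<open>Re z = 1\<close> by (simp add: complex_eq_iff)
  qed
  have "(cmod (1 + z))\<^sup>2 = 1 + 2 * Re z + (cmod z)\<^sup>2" 
    unfolding cmod_power2 by (simp add: power2_eq_square algebra_simps)
  also have "\<dots> < 2\<^sup>2" using r assms(1) by simp
  finally show ?thesis by (rule power_less_imp_less_base) simp
qed

text \<open>The terms are unit vectors, and those of \<open>0\<close> and \<open>d\<close> do not point in the same direction.\<close>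

lemma digit_sum_strict:
  assumes D: "finite D" "0 \<in> D" and d: "d \<in> D" "l * of_int d \<notin> \<int>"
  shows "cmod (\<Sum>d\<in>D. exponential l (of_int d)) < card D"
proof -
  have d0: "d \<noteq> 0" using d by auto
  have ex1: "exponential l (of_int d) \<noteq> 1"
    using d(2) exponential_eq_1_iff[of "of_int d * l"] exponential_scale[of l "of_int d" 1] by (simp add: mult.commute)
  have "(\<Sum>d\<in>D. exponential l (of_int d)) = (\<Sum>d\<in>{0, d}. exponential l (of_int d)) + (\<Sum>d\<in>D - {0, d}. exponential l (of_int d))"
    using D d by (subst sum.subset_diff[of "{0, d}"]) auto
  also have "(\<Sum>d\<in>{0, d}. exponential l (of_int d)) = 1 + exponential l (of_int d)"
    using d0 by (simp add: exponential_def)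
  finally have "cmod (\<Sum>d\<in>D. exponential l (of_int d)) \<le> cmod (1 + exponential l (of_int d)) + cmod (\<Sum>d\<in>D - {0, d}. exponential l (of_int d))"
    by (simp add: norm_triangle_ineq)
  also have "cmod (\<Sum>d\<in>D - {0, d}. exponential l (of_int d)) \<le> (\<Sum>d\<in>D - {0, d}. 1)"
    by (rule sum_norm_le) simp
  also have "(\<Sum>d\<in>D - {0, d}. 1::real) = real (card D) - 2"
  proof -
    have "card (D - {0, d}) = card D - card {0, d}" using D d by (intro card_Diff_subset) auto
    moreover have "card {0, d} \<le> card D" using D d by (intro card_mono) auto
    ultimately show ?thesis using d0 by simp
  qed
  finally show ?thesis using norm_one_plus_unit_less[OF _ ex1] by simp
qed

definition primitive_digits :: "int set \<Rightarrow> bool" where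
  "primitive_digits D \<longleftrightarrow> 0 \<in> D \<and> (\<forall>M::nat>1. \<exists>d\<in>D. \<not> int M dvd d)"

text \<open>Since the digits contain 0 and have no common divisor, no character of order dividing \<open>M\<close> other than the trivial one
  is constant on them; only finitely many characters are in question.\<close>

lemma digit_sum_contraction:
  assumes D: "finite D" "primitive_digits D" and M: "M > 0"
  shows "\<exists>c::real. c < 1 \<and> c \<ge> 0 \<and> (\<forall>k. \<not> int M dvd k \<longrightarrow> cmod (\<Sum>d\<in>D. exponential (of_int k / of_nat M) (of_int d)) \<le> c * card D)"
proof -
  have D0: "card D > 0" using D by (auto simp: primitive_digits_def card_gt_0_iff)
  define F where "F k = cmod (\<Sum>d\<in>D. exponential (of_int k / of_nat M) (of_int d)) / card D" for k :: int
  have lt: "F k < 1" if "\<not> int M dvd k" for k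
  proof -
    define g where "g = gcd k (int M)"
    have g: "g > 0" using M by (simp add: g_def)
    obtain k' M' where kM: "k = g * k'" "int M = g * M'" by (metis dvd_def g_def gcd_dvd1 gcd_dvd2)
    have cop: "coprime k' M'" using g kM by (metis g_def gcd_coprime_exists gcd_eq_0_iff less_irrefl mult.commute mult_cancel_left div_gcd_coprime nonzero_mult_div_cancel_left)
    have M'0: "M' > 0" using kM(2) g M by (metis of_nat_0_less_iff zero_less_mult_pos)
    have "M' \<noteq> 1" using kM that by auto
    then have "nat M' > 1" using M'0 by simp
    then obtain d where d: "d \<in> D" "\<not> int (nat M') dvd d" using D(2) unfolding primitive_digits_def by blast
    then have nd: "\<not> M' dvd d" using M'0 by simp
    have "of_int k / real M * of_int d \<notin> \<int>"
    proof
      assume "of_int k / real M * of_int d \<in> \<int>"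
      then obtain n where "of_int k / real M * of_int d = real_of_int n" by (auto elim: Ints_cases)
      then have "real_of_int (k * d) = real_of_int (n * int M)" using M by (simp add: field_simps)
      then have "k * d = n * int M" by (simp only: of_int_eq_iff)
      then have "g * (k' * d) = g * (n * M')" using kM by (simp add: algebra_simps)
      then have "k' * d = n * M'" using g by simp
      then have "M' dvd k' * d" by simp
      then have "M' dvd d" using cop by (simp add: coprime_dvd_mult_right_iff coprime_commute)
      then show False using nd by simp
    qed
    then have "cmod (\<Sum>d\<in>D. exponential (of_int k / of_nat M) (of_int d)) < card D"
      using d D by (intro digit_sum_strict) (auto simp: primitive_digits_def)
    then show ?thesis using D0 by (simp add: F_def)
  qed
  define c where "c = Max (insert 0 (F ` {1..<int M}))"
  have c: "c < 1" "c \<ge> 0" unfolding c_def using lt zdvd_not_zless by (auto simp: Max_less_iff)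
  have Fc: "F k \<le> c" if "k \<in> {1..<int M}" for k unfolding c_def using that by (intro Max_ge) auto
  have "cmod (\<Sum>d\<in>D. exponential (of_int k / of_nat M) (of_int d)) \<le> c * card D" if k: "\<not> int M dvd k" for k
  proof -
    have "exponential (of_int k / of_nat M) (of_int d) = exponential (of_int (k mod int M) / of_nat M) (of_int d)" for d
    proof -
      have "real_of_int (k mod int M + int M * (k div int M)) = of_int k" by (simp only: mod_mult_div_eq)
      then have "of_int k = of_int (k mod int M) + real M * of_int (k div int M)"
        by (simp only: of_int_add of_int_mult of_int_of_nat_eq)
      then have "of_int k / real M = of_int (k mod int M) / real M + real_of_int (k div int M)" using M by (simp add: field_simps)
      then show ?thesis by (simp add: exponential_add_left exponential_int)
    qed
    then have "F k = F (k mod int M)" by (simp add: F_def)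
    moreover have "k mod int M \<in> {1..<int M}"
    proof -
      have "k mod int M \<noteq> 0" using k by (simp add: dvd_eq_mod_eq_0)
      moreover have "0 \<le> k mod int M" "k mod int M < int M" using M by simp_all
      ultimately show ?thesis by simp
    qed
    ultimately have "F k \<le> c" using Fc by simp
    then show ?thesis using D0 by (simp add: F_def field_simps)
  qed
  then show ?thesis by (intro exI[of _ c] conjI c allI impI)
qed

text \<open>Let \<open>M\<close> be a power of \<open>r\<close>. Divided by the cardinality, the character sum of \<open>D + b B\<close> at \<open>k / M\<close> is
  that of \<open>B\<close> at \<open>b k / M\<close> times a factor whose modulus is at most a constant less than 1, so these
  sums tend to 0 under iteration. The periodic sets
  generated by the \<open>B n\<close> have a common period \<open>Q\<close>, so the sums take only finitely many values up to
  normalization, and at some stage all of them are 0. At that stage \<open>M\<close> divides the cardinality of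
  the complement. With \<open>M\<close> the full power of \<open>r\<close> in the period, no factor \<open>r\<close> is left for \<open>A\<close>.\<close>

lemma tiles_card_coprime:
  assumes D: "finite D" "primitive_digits D" "card D = b" "b > 0"
    and A: "A \<subseteq> {-K..K}"
    and t: "\<And>n. tiles (b ^ n * N) A (B n)"
    and BS: "\<And>n. B (Suc n) = (\<lambda>(d, x). d + int b * x) ` (D \<times> B n)"
    and r: "prime r" "\<not> r dvd b"
  shows "\<not> r dvd card A"
proof -
  have N: "N > 0" using tiles_pos[OF t[of 0]] by simp
  \<comment> \<open>As \<open>r\<close> does not divide \<open>b\<close>, this is the full power of \<open>r\<close> in every period \<open>b\<^sup>n N\<close>.\<close>
  define M where "M = r ^ multiplicity r N"
  have M: "M > 0" using prime_gt_0_nat[OF r(1)] by (simp add: M_def)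
  have MN: "M dvd N" unfolding M_def by (rule multiplicity_dvd)
  have cop: "coprime M b" unfolding M_def using r by (simp add: prime_imp_coprime coprime_power_left_iff)
  have cA: "card A > 0" using tiles_nonempty[OF t] tiles_finite[OF t] by (simp add: card_gt_0_iff)
  have cB: "card (B (Suc n)) = b * card (B n)" for n
  proof -
    have "card A * card (B (Suc n)) = card A * (b * card (B n))"
      using tiles_card[OF t[of "Suc n"]] tiles_card[OF t[of n]] by (simp add: algebra_simps)
    then show ?thesis using cA by simp
  qed
  have inj: "inj_on (\<lambda>(d, x). d + int b * x) (D \<times> B n)" for n
    by (rule eq_card_imp_inj_on) (use D tiles_finite[OF t] cB[of n] BS[of n] in \<open>auto simp: card_cartesian_product\<close>)
  define G where "G n k = (\<Sum>x\<in>B n. exponential (of_int k / of_nat M) (of_int x))" for n and k :: int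
  have GS: "G (Suc n) k = (\<Sum>d\<in>D. exponential (of_int k / of_nat M) (of_int d)) * G n (int b * k)" for n k
  proof -
    have "G (Suc n) k = (\<Sum>(d, x)\<in>D \<times> B n. exponential (of_int k / of_nat M) (of_int (d + int b * x)))"
      unfolding G_def BS by (subst sum.reindex[OF inj]) (simp add: case_prod_unfold)
    also have "\<dots> = (\<Sum>d\<in>D. \<Sum>x\<in>B n. exponential (of_int k / of_nat M) (of_int d) * exponential (of_int (int b * k) / of_nat M) (of_int x))"
      by (simp add: sum.cartesian_product[symmetric] exponential_add exponential_scale)
    also have "\<dots> = (\<Sum>d\<in>D. exponential (of_int k / of_nat M) (of_int d)) * G n (int b * k)"
      by (simp add: G_def sum_product)
    finally show ?thesis .
  qed
  obtain c :: real where cc: "c < 1 \<and> c \<ge> 0 \<and> (\<forall>k. \<not> int M dvd k \<longrightarrow> cmod (\<Sum>d\<in>D. exponential (of_int k / of_nat M) (of_int d)) \<le> c * b)"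
    using digit_sum_contraction[OF D(1,2) M] unfolding D(3) ..
  then have c: "c < 1" "c \<ge> 0" by simp_all
  have cb: "cmod (\<Sum>d\<in>D. exponential (of_int k / of_nat M) (of_int d)) \<le> c * b" if "\<not> int M dvd k" for k
    using cc that by blast
  have Gb: "cmod (G n k) \<le> c ^ n * real b ^ n * card (B 0)" if "\<not> int M dvd k" for n k
    using that
  proof (induction n arbitrary: k)
    case 0
    have "cmod (G 0 k) \<le> (\<Sum>x\<in>B 0. 1)" unfolding G_def by (rule sum_norm_le) simp
    then show ?case by simp
  next
    case (Suc n)
    have "\<not> int M dvd int b * k" using Suc.prems cop by (simp add: coprime_dvd_mult_right_iff)
    from mult_mono[OF cb[OF Suc.prems] Suc.IH[OF this]] c D(4)
    show ?case by (simp add: GS norm_mult algebra_simps)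
  qed
  define W where "W = nat (2 * K + 1)"
  have "K \<ge> 0" using A tiles_nonempty[OF t[of 0]] by fastforce
  then have W: "int W = 2 * K + 1" by (simp add: W_def)
  \<comment> \<open>The factor \<open>N\<close> makes \<open>M\<close> divide the common period, so that the characters are periodic, too.\<close>
  define Q where "Q = N * (W * fact (2 ^ W))"
  have "W > 0" using W \<open>K \<ge> 0\<close> by linarith
  then have Q0: "Q > 0" using N by (simp add: Q_def)
  define H where "H S k = (\<Sum>x\<in>S. exponential (of_int k / of_nat M) (of_int x))" for S and k :: int
  define J where "J n = periodize (b ^ n * N) (B n) \<inter> {0..<int Q}" for n
  have MQ: "M dvd Q" using MN by (simp add: Q_def)
  have perM: "exponential (of_int k / of_nat M) (of_int (x + y)) = exponential (of_int k / of_nat M) (of_int x)" if "int M dvd y" for k x y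
  proof -
    obtain e where "y = int M * e" using \<open>int M dvd y\<close> by blast
    then have "exponential (of_int k / of_nat M) (of_int y) = 1" using M by (simp add: exponential_scale exponential_int)
    then show ?thesis by (simp add: exponential_add)
  qed
  have HJ: "of_nat (b ^ n * N) * H (J n) k = of_nat Q * G n k" for n k
  proof -
    have p1: "x + int (W * fact (2 ^ W)) \<in> periodize (b ^ n * N) (B n) \<longleftrightarrow> x \<in> periodize (b ^ n * N) (B n)" for x
      by (rule tiles_bounded_period[OF t A W])
    have p1': "x + int (e * (W * fact (2 ^ W))) \<in> periodize (b ^ n * N) (B n) \<longleftrightarrow> x \<in> periodize (b ^ n * N) (B n)" for x e
    proof (induction e)
      case (Suc e)
      have "x + int (Suc e * (W * fact (2 ^ W))) = (x + int (e * (W * fact (2 ^ W)))) + int (W * fact (2 ^ W))"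
        by (simp only: mult_Suc of_nat_add add_ac)
      then show ?case using Suc p1 by (simp only:)
    qed simp
    have pQ: "x + int Q \<in> periodize (b ^ n * N) (B n) \<longleftrightarrow> x \<in> periodize (b ^ n * N) (B n)" for x
      unfolding Q_def by (rule p1')
    have pP: "x + int (b ^ n * N) \<in> periodize (b ^ n * N) (B n) \<longleftrightarrow> x \<in> periodize (b ^ n * N) (B n)" for x
      using periodize_shift[of x "b ^ n * N" 1 "B n"] by simp
    let ?f = "\<lambda>x. exponential (of_int k / of_nat M) (of_int x)"
    have dP: "int M dvd int (b ^ n * N)" using MN by (simp only: of_nat_dvd_iff dvd_mult)
    have "(\<Sum>x\<in>periodize (b ^ n * N) (B n) \<inter> {0..<int (b ^ n * N * Q)}. ?f x) = of_nat (b ^ n * N) * H (J n) k"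
      unfolding H_def J_def using MQ by (intro sum_periodic_window[OF Q0 pQ] perM) simp
    moreover have "(\<Sum>x\<in>periodize (b ^ n * N) (B n) \<inter> {0..<int (Q * (b ^ n * N))}. ?f x) = of_nat Q * (\<Sum>x\<in>periodize (b ^ n * N) (B n) \<inter> {0..<int (b ^ n * N)}. ?f x)"
      using dP by (intro sum_periodic_window[OF tiles_pos[OF t] pP] perM)
    moreover have "(\<Sum>x\<in>periodize (b ^ n * N) (B n) \<inter> {0..<int (b ^ n * N)}. ?f x) = G n k"
      unfolding G_def using dP by (intro sum_periodize_window[OF t] perM dvd_mult2)
    ultimately show ?thesis by (simp add: mult.commute)
  qed
  have Hle: "cmod (H (J n) k) \<le> Q * card (B 0) * c ^ n" if "\<not> int M dvd k" for n k
  proof -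
    have "real (b ^ n) * cmod (H (J n) k) \<le> real (b ^ n * N) * cmod (H (J n) k)"
    proof (rule mult_right_mono)
      have "b ^ n \<le> b ^ n * N" using N by simp
      then show "real (b ^ n) \<le> real (b ^ n * N)" by (simp only: of_nat_le_iff)
    qed simp
    also have "\<dots> = cmod (of_nat (b ^ n * N) * H (J n) k)" by (simp add: norm_mult norm_power)
    also have "\<dots> = Q * cmod (G n k)" unfolding HJ by (simp add: norm_mult)
    also have "\<dots> \<le> Q * (c ^ n * real b ^ n * card (B 0))" using Gb[OF that] by (intro mult_left_mono) auto
    also have "\<dots> = real (b ^ n) * (Q * card (B 0) * c ^ n)" by simp
    finally show ?thesis using D(4) by (simp only: mult_le_cancel_left_pos of_nat_0_less_iff zero_less_power)
  qed
  \<comment> \<open>The nonzero moduli of all character sums that can occur; they have a positive minimum.\<close>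
  define V where "V = {v. v > 0 \<and> v \<in> (\<lambda>(S, k). cmod (H S k)) ` (Pow {0..<int Q} \<times> {0..<int M})}"
  have "finite V" unfolding V_def by (rule finite_subset[of _ "(\<lambda>(S, k). cmod (H S k)) ` (Pow {0..<int Q} \<times> {0..<int M})"]) auto
  define \<epsilon> where "\<epsilon> = Min (insert 1 V)"
  have eps: "\<epsilon> > 0" "\<And>v. v \<in> V \<Longrightarrow> \<epsilon> \<le> v" using \<open>finite V\<close> by (auto simp: \<epsilon>_def V_def)
  have "(\<lambda>n. real (Q * card (B 0)) * c ^ n) \<longlonglongrightarrow> real (Q * card (B 0)) * 0"
    using c by (intro tendsto_intros LIMSEQ_realpow_zero) auto
  then have "\<forall>\<^sub>F n in sequentially. Q * card (B 0) * c ^ n < \<epsilon>"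
    by (rule order_tendstoD(2)) (use eps in simp)
  then obtain n where n: "Q * card (B 0) * c ^ n < \<epsilon>" by (auto simp: eventually_sequentially)
  have G0: "G n k = 0" if "k \<in> {1..<int M}" for k
  proof -
    have "\<not> int M dvd k" using that zdvd_not_zless by auto
    then have "cmod (H (J n) k) < \<epsilon>" using Hle[of k n] n by linarith
    moreover have "cmod (H (J n) k) \<in> V" if "H (J n) k \<noteq> 0"
      unfolding V_def using that \<open>k \<in> {1..<int M}\<close> by (auto simp: J_def intro!: image_eqI[of _ _ "(J n, k)"])
    ultimately have "H (J n) k = 0" using eps(2) by fastforce
    then show ?thesis using HJ[of n k] Q0 by simp
  qed
  \<comment> \<open>Summing over all characters counts \<open>M\<close> times the multiples of \<open>M\<close> in \<open>B n\<close>, while only the trivial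
    character contributes.\<close>
  have "(\<Sum>k<M. G n (int k)) = of_nat (card (B n))"
  proof -
    have "(\<Sum>k<M. G n (int k)) = (\<Sum>k\<in>{0}. G n (int k))"
      by (rule sum.mono_neutral_right) (use M G0 in auto)
    then show ?thesis by (simp add: G_def exponential_def)
  qed
  moreover have "(\<Sum>k<M. G n (int k)) = (\<Sum>x\<in>B n. if int M dvd x then of_nat M else 0)"
  proof -
    have "(\<Sum>k<M. G n (int k)) = (\<Sum>x\<in>B n. \<Sum>k<M. exponential (of_int (int k) / of_nat M) (of_int x))"
      unfolding G_def by (rule sum.swap)
    also have "\<dots> = (\<Sum>x\<in>B n. \<Sum>k<M. exponential (of_int x / of_nat M) (of_nat k))"
      by (simp add: exponential_def mult_ac)
    also have "\<dots> = (\<Sum>x\<in>B n. if int M dvd x then of_nat M else 0)"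
    proof (rule sum.cong[OF refl])
      fix x
      show "(\<Sum>k<M. exponential (of_int x / of_nat M) (of_nat k)) = (if int M dvd x then of_nat M else 0)"
      proof (cases "int M dvd x")
        case True
        then obtain y where "x = int M * y" by blast
        then have "exponential (of_int x / of_nat M) (of_nat k) = 1" for k
          using M exponential_int[of y "int k"] by simp
        then show ?thesis using True by simp
      next
        case False then show ?thesis using sum_exponential_geometric[OF M False] by simp
      qed
    qed
    finally show ?thesis .
  qed
  moreover have "(\<Sum>x\<in>B n. if int M dvd x then of_nat M else 0) = (of_nat (card {x\<in>B n. int M dvd x} * M) :: complex)"
    using tiles_finite[OF t[of n]] by (simp add: sum.If_cases Int_def)
  ultimately have "(of_nat (card (B n)) :: complex) = of_nat (card {x\<in>B n. int M dvd x} * M)" by simp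
  then have "card (B n) = card {x\<in>B n. int M dvd x} * M" by (simp only: of_nat_eq_iff)
  then have MB: "M dvd card (B n)" by simp
  show ?thesis
  proof
    assume "r dvd card A"
    then have "r * M dvd card A * card (B n)" using MB by (intro mult_dvd_mono)
    then have "r ^ Suc (multiplicity r N) dvd b ^ n * N" using tiles_card[OF t[of n]] by (simp add: M_def)
    moreover have "coprime (r ^ Suc (multiplicity r N)) (b ^ n)" using r by (simp add: prime_imp_coprime)
    ultimately have "r ^ Suc (multiplicity r N) dvd N" by (simp only: coprime_dvd_mult_right_iff)
    then have "Suc (multiplicity r N) \<le> multiplicity r N" 
      using N r(1) by (intro multiplicity_geI) (auto dest: prime_gt_1_nat)
    then show False by simp
  qed
qed

section \<open>Fibres of the attractor\<close>

text \<open>A pattern of translates that recurs at \<open>z1\<close> and \<open>z2\<close> can be cut at these places and closed up to a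
  tiling with period \<open>z2 - z1\<close>. An integer in \<open>[z1 + K, z2 + K)\<close> is covered by a translate in
  \<open>[z1, z2 + 2 K)\<close>; those beyond \<open>z2\<close> are moved back by one period, which the repetition allows.\<close>

lemma tiles_from_window:
  assumes A: "A \<subseteq> {-K..K}" and K: "K \<ge> 0" and W: "int W = 2 * K + 1" and S: "finite S" and z12: "z1 + int W \<le> z2"
    and win: "\<forall>e\<in>{0..<int W}. z1 + e \<in> S \<longleftrightarrow> z2 + e \<in> S"
    and ex1: "\<And>z. z1 + K \<le> z \<Longrightarrow> z < z2 + K \<Longrightarrow> \<exists>!e. e \<in> S \<and> z - e \<in> A"
  shows "tiles (nat (z2 - z1)) A (S \<inter> {z1..<z2})"
proof -
  define N where "N = z2 - z1"
  have "N > 0" unfolding N_def using z12 W K by linarith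
  then have N: "N > 0" "int (nat N) = N" by simp_all
  \<comment> \<open>The representative in \<open>[z1 + K, z2 + K)\<close>.\<close>
  define \<rho> where "\<rho> z = z1 + K + (z - (z1 + K)) mod N" for z
  have rho: "z1 + K \<le> \<rho> z" "\<rho> z < z2 + K" "N dvd z - \<rho> z" for z
  proof -
    have "0 \<le> (z - (z1 + K)) mod N" "(z - (z1 + K)) mod N < N" using N by simp_all
    then show "z1 + K \<le> \<rho> z" "\<rho> z < z2 + K" by (auto simp: \<rho>_def N_def)
    have "z - \<rho> z = (z - (z1 + K)) - (z - (z1 + K)) mod N" by (simp add: \<rho>_def)
    also have "N dvd \<dots>" by (rule dvd_minus_mod)
    finally show "N dvd z - \<rho> z" .
  qed
  have lift: "\<rho> (a + b) - a \<in> S" if "a \<in> A" "b \<in> S \<inter> {z1..<z2}" for a b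
  proof -
    have "- K \<le> a" "a \<le> K" using A that by auto
    then have r: "z1 \<le> \<rho> (a + b) - a" "\<rho> (a + b) - a < z2 + 2 * K" using rho[of "a + b"] by linarith+
    have "N dvd b - (\<rho> (a + b) - a)" using rho(3)[of "a + b"] by (simp add: algebra_simps)
    then obtain t where t: "b - (\<rho> (a + b) - a) = N * t" by blast
    have bz: "z1 \<le> b" "b < z2" and Nz: "N = z2 - z1" using that by (auto simp: N_def)
    have "N * t < N * 1" unfolding mult_1_right using t r bz Nz by linarith
    then have "t \<le> 0" using N(1) by (simp only: mult_less_cancel_left_pos)
    have "N * (-2) < N * t" using t r bz z12 W Nz by linarith
    then have "t \<ge> -1" using N(1) by (simp only: mult_less_cancel_left_pos)
    then consider "t = 0" | "t = -1" using \<open>t \<le> 0\<close> by linarith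
    then show ?thesis
    proof cases
      case 1 then have "\<rho> (a + b) - a = b" using t by simp
      then show ?thesis using that by simp
    next
      case 2
      then have e: "\<rho> (a + b) - a = z2 + (b - z1)" using t by (simp add: N_def)
      then have "b - z1 \<in> {0..<int W}" using r that W by auto
      then have "z1 + (b - z1) \<in> S \<longleftrightarrow> z2 + (b - z1) \<in> S" using win by blast
      then show ?thesis using e that by simp
    qed
  qed
  show ?thesis unfolding N_def[symmetric]
  proof (rule tilesI_inj_ex)
    show "0 < nat N" using N by simp
    show "finite A" using A finite_subset by blast
    show "finite (S \<inter> {z1..<z2})" using S by simp
    fix z
    obtain e where e: "e \<in> S" "\<rho> z - e \<in> A" using ex1[OF rho(1,2)] by blast
    then have "- K \<le> \<rho> z - e" "\<rho> z - e \<le> K" using A by auto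
    then have r: "z1 \<le> e" "e < z2 + 2 * K" using rho[of z] by linarith+
    define e' where "e' = (if e < z2 then e else e - N)"
    have e': "e' \<in> S \<inter> {z1..<z2}"
    proof (cases "e < z2")
      case False
      then have "e - z2 \<in> {0..<int W}" using r W by auto
      then have "z1 + (e - z2) \<in> S \<longleftrightarrow> z2 + (e - z2) \<in> S" using win by blast
      then show ?thesis using False e r z12 W by (simp add: e'_def N_def algebra_simps)
    qed (use e r in \<open>auto simp: e'_def\<close>)
    have "N dvd e - e'" by (simp add: e'_def)
    then have "N dvd (\<rho> z - e + e') - z" using rho(3)[of z] 
      by (metis (no_types, opaque_lifting) add_diff_eq diff_add_eq diff_diff_eq2 dvd_diff_commute dvd_diff add.commute)
    then have "(\<rho> z - e + e') mod int (nat N) = z mod int (nat N)" by (simp only: N(2) mod_eq_dvd_iff)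
    then show "\<exists>a\<in>A. \<exists>b\<in>S \<inter> {z1..<z2}. (a + b) mod int (nat N) = z mod int (nat N)"
      using e e' by blast
  next
    fix a b a' b' assume *: "a \<in> A" "b \<in> S \<inter> {z1..<z2}" "a' \<in> A" "b' \<in> S \<inter> {z1..<z2}" "(a + b) mod int (nat N) = (a' + b') mod int (nat N)"
    then have "(a + b) mod N = (a' + b') mod N" by (simp only: N(2))
    then have req: "\<rho> (a + b) = \<rho> (a' + b')" unfolding \<rho>_def by (metis mod_diff_left_eq)
    let ?z = "\<rho> (a + b)"
    have "?z - a \<in> S \<and> ?z - (?z - a) \<in> A" "?z - a' \<in> S \<and> ?z - (?z - a') \<in> A"
      using lift[OF *(1,2)] lift[OF *(3,4)] req * by auto
    then have aa: "a = a'" using ex1[OF rho(1,2), of "a + b"] by (metis diff_diff_eq2 add_diff_cancel_left')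
    have "N dvd b - b'" using \<open>(a + b) mod N = (a' + b') mod N\<close> aa by (simp add: mod_eq_dvd_iff)
    moreover have "\<bar>b - b'\<bar> < N" using * by (auto simp: N_def)
    ultimately have "b - b' = 0" using dvd_imp_le_int[of "b - b'" N] N(1) by linarith
    then show "a = a' \<and> b = b'" using aa by simp
  qed
qed

text \<open>The set in the hypothesis is the fibre over \<open>(y + k) / b\<close> when \<open>A\<close> is the fibre over \<open>y\<close>. It collects the
  points of \<open>A + D\<close> in the class \<open>k\<close> modulo \<open>b\<close>, rescaled. Tiling these classes one by one by
  \<open>b B\<close> tiles everything.\<close>

lemma tiles_substitution:
  assumes b: "b > 0" and fin: "finite A" "finite D"
    and t: "\<And>k. k < b \<Longrightarrow> tiles N {n. \<exists>d\<in>D. int k + int b * n - d \<in> A} B"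
    and uniq: "\<And>z d d'. \<lbrakk>d \<in> D; d' \<in> D; z - d \<in> A; z - d' \<in> A\<rbrakk> \<Longrightarrow> d = d'"
  shows "tiles (b * N) A ((\<lambda>(d, x). d + int b * x) ` (D \<times> B))"
proof -
  have N: "N > 0" using tiles_pos[OF t[OF b]] .
  show ?thesis
  proof (rule tilesI_inj_ex)
    show "0 < b * N" using b N by simp
    show "finite ((\<lambda>(d, x). d + int b * x) ` (D \<times> B))" using fin tiles_finite[OF t[OF b]] by simp
    fix z
    define k where "k = nat (z mod int b)"
    have k: "int k = z mod int b" "k < b" using b by (auto simp: k_def nat_less_iff)
    define w where "w = z div int b"
    have z: "z = int k + int b * w" using k by (simp add: w_def)
    obtain n x where nx: "n \<in> {n. \<exists>d\<in>D. int k + int b * n - d \<in> A}" "x \<in> B" "(n + x) mod int N = w mod int N"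
      using tiles_ex[OF t[OF k(2)], of w] by blast
    then obtain d where d: "d \<in> D" "int k + int b * n - d \<in> A" by blast
    have "int N dvd n + x - w" using nx by (simp add: mod_eq_dvd_iff)
    then have "int b * int N dvd int b * (n + x - w)" by (rule mult_dvd_mono[OF dvd_refl])
    then have "(int k + int b * n - d + (d + int b * x)) mod int (b * N) = z mod int (b * N)"
      unfolding z by (simp add: mod_eq_dvd_iff algebra_simps)
    then show "\<exists>a\<in>A. \<exists>y\<in>(\<lambda>(d, x). d + int b * x) ` (D \<times> B). (a + y) mod int (b * N) = z mod int (b * N)"
      using d nx by (intro bexI[of _ "int k + int b * n - d"] bexI[of _ "d + int b * x"]) auto
  next
    fix a y a' y' assume *: "a \<in> A" "y \<in> (\<lambda>(d, x). d + int b * x) ` (D \<times> B)" "a' \<in> A" "y' \<in> (\<lambda>(d, x). d + int b * x) ` (D \<times> B)"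
      "(a + y) mod int (b * N) = (a' + y') mod int (b * N)"
    obtain d x where y: "d \<in> D" "x \<in> B" "y = d + int b * x" using * by auto
    obtain d' x' where y': "d' \<in> D" "x' \<in> B" "y' = d' + int b * x'" using * by auto
    have dv: "int b * int N dvd (a + y) - (a' + y')" using *(5) by (simp add: mod_eq_dvd_iff)
    define k where "k = nat ((a + d) mod int b)"
    have k: "int k = (a + d) mod int b" "k < b" using b by (auto simp: k_def nat_less_iff)
    define n where "n = (a + d) div int b"
    define n' where "n' = (a' + d') div int b"
    have n: "a + d = int k + int b * n" using k by (simp add: n_def)
    have "int b dvd (a + y) - (a' + y')" using dv by (rule dvd_mult_left)
    moreover have "(a + y) - (a' + y') = (a + d) - (a' + d') + int b * (x - x')" using y y' by (simp add: algebra_simps)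
    ultimately have "int b dvd (a + d) - (a' + d')" by (simp add: dvd_add_left_iff)
    then have "(a + d) mod int b = (a' + d') mod int b" by (simp add: mod_eq_dvd_iff)
    then have n': "a' + d' = int k + int b * n'" using k by (simp add: n'_def)
    have "int b * int N dvd int b * ((n + x) - (n' + x'))"
    proof -
      have "(a + y) - (a' + y') = (a + d) - (a' + d') + int b * (x - x')" using y y' by (simp add: algebra_simps)
      also have "\<dots> = int b * ((n + x) - (n' + x'))" unfolding n n' by (simp add: algebra_simps)
      finally show ?thesis using dv by simp
    qed
    then have m: "(n + x) mod int N = (n' + x') mod int N" using b by (simp add: mod_eq_dvd_iff)
    have e: "int k + int b * n - d = a" "int k + int b * n' - d' = a'" using n n' by auto
    have "n \<in> {n. \<exists>d\<in>D. int k + int b * n - d \<in> A}" "n' \<in> {n. \<exists>d\<in>D. int k + int b * n - d \<in> A}"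
      using e y y' *(1,3) by auto
    from tiles_inj[OF t[OF k(2)] this(1) y(2) this(2) y'(2) m] have nx: "n = n'" "x = x'" by auto
    then have dd: "d = d'" using uniq[OF y(1) y'(1), of "int k + int b * n"] e * by auto
    then show "a = a' \<and> y = y'" using nx e y y' by auto
  qed (use fin in auto)
qed

definition fibre :: "real set \<Rightarrow> real \<Rightarrow> int set" where
  "fibre T y = {n. y + of_int n \<in> T}"

lemma AE_lborel_affine:
  fixes P :: "real \<Rightarrow> bool"
  assumes "AE x in lborel. P x" and c: "c \<noteq> 0"
  shows "AE x in lborel. P (t + c * x)"
proof -
  obtain N where N: "N \<in> null_sets lborel" "{x \<in> space lborel. \<not> P x} \<subseteq> N"
    using assms(1) by (auto simp: eventually_ae_filter)
  have "AE x in lborel. x \<notin> N" using N(1) by (rule AE_not_in)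
  moreover have "Measurable.pred borel (\<lambda>x. x \<notin> N)" using N(1) by (auto simp: null_sets_def)
  ultimately have "AE x in lborel. t + c * x \<notin> N" using c AE_borel_affine[of c "\<lambda>x. x \<notin> N" t] by simp
  then show ?thesis by (rule AE_mp) (use N(2) in \<open>auto intro!: AE_I2\<close>)
qed

lemma AE_lborel_all_translates:
  fixes P :: "real \<Rightarrow> bool"
  assumes "AE x in lborel. P x"
  shows "AE y in lborel. \<forall>z::int. P (y + of_int z)"
proof -
  have "AE y in lborel. P (y + of_int z)" for z :: int
    using AE_lborel_affine[OF assms, of 1 "of_int z"] by (simp add: add.commute)
  then show ?thesis by (subst AE_all_countable) blast
qed

lemma attractor_mem_iff:
  assumes b: "b > 0" and "is_attractor b D T"
  shows "x / real b \<in> T \<longleftrightarrow> (\<exists>d\<in>D. x - of_int d \<in> T)"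
proof -
  have T: "T = (\<Union>d\<in>D. (\<lambda>x. inverse (real b) * (x + of_int d)) ` T)"
    using assms(2) unfolding is_attractor_def by blast
  show ?thesis
  proof
    assume "x / real b \<in> T"
    then obtain d t where "d \<in> D" "t \<in> T" "x / real b = inverse (real b) * (t + of_int d)" using T by blast
    then show "\<exists>d\<in>D. x - of_int d \<in> T" using b by (intro bexI[of _ d]) (auto simp: field_simps)
  next
    assume "\<exists>d\<in>D. x - of_int d \<in> T"
    then obtain d where d: "d \<in> D" "x - of_int d \<in> T" by blast
    have "inverse (real b) * ((x - of_int d) + of_int d) \<in> T"
      by (subst T) (use d in blast)
    then show "x / real b \<in> T" by (simp add: field_simps)
  qed
qed

text \<open>The \<open>b\<close> translates of \<open>T\<close> cover \<open>b T\<close>, and their measures add up to the measure of \<open>b T\<close>. So the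
  number of translates over a point exceeds the indicator of \<open>b T\<close> only on a null set.\<close>

lemma pieces_ae_disjoint:
  assumes b: "b > 0" and D: "finite D" "card D = b" and T: "is_attractor b D T"
  shows "AE x in lborel. \<forall>d\<in>D. \<forall>d'\<in>D. x - of_int d \<in> T \<longrightarrow> x - of_int d' \<in> T \<longrightarrow> d = d'"
proof -
  note mem = attractor_mem_iff[OF b T]
  have cT: "compact T" using T by (simp add: is_attractor_def)
  have Tb[measurable]: "T \<in> sets borel" using cT by (simp add: borel_compact)
  have fin: "emeasure lborel T < \<infinity>" using emeasure_compact_finite[OF cT] .
  have hT: "has_bochner_integral lborel (indicator T) (measure lborel T)"
    using fin by (intro has_bochner_integral_real_indicator) auto
  define \<mu> where "\<mu> = measure lborel T"
  define f :: "real \<Rightarrow> real" where "f x = (\<Sum>d\<in>D. indicator T (x - of_int d))" for x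
  define g where "g = (\<lambda>x. indicator T (x / real b) :: real)"
  have tr: "has_bochner_integral lborel (\<lambda>x. indicator T (x - of_int d) :: real) \<mu>" for d :: int
    using lborel_has_bochner_integral_real_affine_iff[of 1 "indicator T :: real \<Rightarrow> real" \<mu> "- of_int d"] hT by (simp add: \<mu>_def)
  have hf: "has_bochner_integral lborel f (\<Sum>d\<in>D. \<mu>)"
    unfolding f_def by (rule has_bochner_integral_sum) (rule tr)
  have hg: "has_bochner_integral lborel g (real b * \<mu>)"
    using lborel_has_bochner_integral_real_affine_iff[of "1 / real b" "indicator T :: real \<Rightarrow> real" \<mu> 0] hT b by (simp add: \<mu>_def g_def)
  have hfg: "has_bochner_integral lborel (\<lambda>x. f x - g x) 0"
    using has_bochner_integral_diff[OF hf hg] D by simp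
  have le: "g x \<le> f x" for x
  proof (cases "x / real b \<in> T")
    case True
    then obtain d where d: "d \<in> D" "x - of_int d \<in> T" using mem by blast
    have "(indicator T (x - of_int d) :: real) \<le> f x" unfolding f_def using D d by (intro member_le_sum) auto
    then show ?thesis using d True by (simp add: g_def)
  qed (auto simp: g_def f_def intro: sum_nonneg)
  have "AE x in lborel. f x - g x = 0"
    using integral_nonneg_eq_0_iff_AE[of lborel "\<lambda>x. f x - g x"] hfg le by (auto simp: has_bochner_integral_iff)
  then show ?thesis
  proof (rule AE_mp, intro AE_I2 impI ballI)
    fix x d d' assume x: "f x - g x = 0" and d: "d \<in> D" "d' \<in> D" "x - of_int d \<in> T" "x - of_int d' \<in> T"
    show "d = d'"
    proof (rule ccontr)
      assume "d \<noteq> d'"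
      then have "(\<Sum>d\<in>{d, d'}. indicator T (x - of_int d)) = (2::real)" using d by simp
      moreover have "(\<Sum>d\<in>{d, d'}. indicator T (x - of_int d) :: real) \<le> f x" unfolding f_def using D d by (intro sum_mono2) auto
      moreover have "g x \<le> 1" by (simp add: g_def indicator_def)
      ultimately show False using x by linarith
    qed
  qed
qed

fun digit_sums :: "nat \<Rightarrow> int set \<Rightarrow> nat \<Rightarrow> int set" where
  "digit_sums b D 0 = {0}"
| "digit_sums b D (Suc n) = (\<lambda>(d, e). d + int b * e) ` (D \<times> digit_sums b D n)"

lemma finite_digit_sums: "finite D \<Longrightarrow> finite (digit_sums b D n)"
  by (induction n) auto

lemma digit_sums_unique:
  assumes b: "b > 0" and T: "is_attractor b D T"
    and disj: "AE x in lborel. \<forall>d\<in>D. \<forall>d'\<in>D. x - of_int d \<in> T \<longrightarrow> x - of_int d' \<in> T \<longrightarrow> d = d'"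
  shows "AE x in lborel. x / real b ^ n \<in> T \<longrightarrow> (\<exists>!e. e \<in> digit_sums b D n \<and> x - of_int e \<in> T)"
proof (induction n)
  case 0 then show ?case by (auto intro!: AE_I2)
next
  case (Suc n)
  note mem = attractor_mem_iff[OF b T]
  have "AE x in lborel. (0 + 1 / real b * x) / real b ^ n \<in> T \<longrightarrow> (\<exists>!e. e \<in> digit_sums b D n \<and> (0 + 1 / real b * x) - of_int e \<in> T)"
    using b by (intro AE_lborel_affine[OF Suc.IH]) simp
  with AE_lborel_all_translates[OF disj] show ?case
  proof (eventually_elim, intro impI)
    fix x assume dj: "\<forall>z::int. \<forall>d\<in>D. \<forall>d'\<in>D. x + of_int z - of_int d \<in> T \<longrightarrow> x + of_int z - of_int d' \<in> T \<longrightarrow> d = d'"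
      and IH: "(0 + 1 / real b * x) / real b ^ n \<in> T \<longrightarrow> (\<exists>!e. e \<in> digit_sums b D n \<and> (0 + 1 / real b * x) - of_int e \<in> T)"
      and x: "x / real b ^ Suc n \<in> T"
    have "(0 + 1 / real b * x) / real b ^ n \<in> T" using x by (simp add: mult.commute)
    then obtain e where e: "e \<in> digit_sums b D n" "x / real b - of_int e \<in> T"
       and eu: "\<And>e'. e' \<in> digit_sums b D n \<Longrightarrow> x / real b - of_int e' \<in> T \<Longrightarrow> e' = e"
      using IH by auto
    have eq: "x / real b - of_int e' = (x - of_int (int b * e')) / real b" for e' using b by (simp add: field_simps)
    obtain d where d: "d \<in> D" "x - of_int (int b * e) - of_int d \<in> T" using e(2) unfolding eq mem by blast
    show "\<exists>!e. e \<in> digit_sums b D (Suc n) \<and> x - of_int e \<in> T"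
    proof (intro ex1I[of _ "d + int b * e"] conjI)
      show "d + int b * e \<in> digit_sums b D (Suc n)" using d e by auto
      show "x - of_int (d + int b * e) \<in> T" using d by (simp add: algebra_simps)
      fix w assume w: "w \<in> digit_sums b D (Suc n) \<and> x - of_int w \<in> T"
      then obtain d' e' where w': "d' \<in> D" "e' \<in> digit_sums b D n" "w = d' + int b * e'" by auto
      have "x - of_int (int b * e') - of_int d' \<in> T" using w w' by (simp add: algebra_simps)
      moreover then have "x / real b - of_int e' \<in> T" unfolding eq mem using w' by blast
      then have "e' = e" using eu w' by blast
      ultimately have "d' = d" using dj[rule_format, of d' d "- int b * e"] d w' by simp
      then show "w = d + int b * e" using \<open>e' = e\<close> w' by simp
    qed
  qed
qed

text \<open>Let \<open>T\<close> contain the ball of radius \<open>r\<close> around \<open>x\<close>. Then \<open>b\<^sup>n T\<close> contains an interval of length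
  \<open>2 b\<^sup>n r\<close>, which is tiled by the translates of \<open>T\<close> along the \<open>n\<close>-fold digit sums. In each fibre this is a
  tiled window of integers. The digit sums, and hence the repeated pattern found in them, do not depend on
  the fibre.\<close>

lemma fibres_tile:
  assumes b: "b \<ge> 2" and D: "finite D" "card D = b" 
    and T: "is_attractor b D T" "interior T \<noteq> {}"
    and K: "K \<ge> 0" "\<And>y. 0 \<le> y \<Longrightarrow> y < 1 \<Longrightarrow> fibre T y \<subseteq> {-K..K}"
  shows "\<exists>N B. AE y in lborel. 0 \<le> y \<longrightarrow> y < 1 \<longrightarrow> tiles N (fibre T y) B"
proof -
  have b0: "b > 0" using b by simp
  obtain x r where xr: "r > 0" "ball x r \<subseteq> T" using T(2) by (meson ex_in_conv mem_interior)
  define W where "W = nat (2 * K + 1)"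
  have W: "int W = 2 * K + 1" using K by (simp add: W_def)
  have W0: "W > 0" using W K by linarith
  \<comment> \<open>Room for all windows to be compared, for the reach \<open>K\<close> of a fibre, and for rounding.\<close>
  define L where "L = real (2 ^ W * W) + real_of_int K + 3"
  obtain n where n: "L / r < real b ^ n" using real_arch_pow[of "real b" "L / r"] b by auto
  then have n: "L < real b ^ n * r" using xr by (simp add: field_simps)
  have bn: "real b ^ n > 0" using b by simp
  define S where "S = digit_sums b D n"
  define z0 where "z0 = \<lceil>real b ^ n * x\<rceil>"
  have inT: "(y + of_int z) / real b ^ n \<in> T" if "0 \<le> y" "y < 1" "z0 \<le> z" "real_of_int z \<le> of_int z0 + L - 2" for y z
  proof -
    have 1: "real b ^ n * x \<le> of_int z0" "of_int z0 < real b ^ n * x + 1" unfolding z0_def by linarith+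
    have "real_of_int z0 \<le> of_int z" using that by simp
    then have "0 \<le> (y + of_int z) - real b ^ n * x" "(y + of_int z) - real b ^ n * x < real b ^ n * r"
      using 1 that n by linarith+
    moreover have "(y + of_int z) / real b ^ n - x = ((y + of_int z) - real b ^ n * x) / real b ^ n" using bn by (simp add: field_simps)
    ultimately have "\<bar>(y + of_int z) / real b ^ n - x\<bar> < r" using bn by (simp add: field_simps)
    then have "(y + of_int z) / real b ^ n \<in> ball x r" by (simp add: dist_real_def abs_minus_commute)
    then show ?thesis using xr by blast
  qed
  obtain i j where ij: "i < j" "j \<le> 2 ^ W" and win: "\<forall>e\<in>{0..<int W}. z0 + int (i * W) + e \<in> S \<longleftrightarrow> z0 + int (j * W) + e \<in> S"
    using repeated_window[OF W0, of z0 S] by blast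
  define z1 z2 where "z1 = z0 + int (i * W)" and "z2 = z0 + int (j * W)"
  have z12: "z1 + int W \<le> z2"
  proof -
    have "(i + 1) * W \<le> j * W" using ij by (intro mult_right_mono) auto
    then show ?thesis unfolding z1_def z2_def by (simp add: algebra_simps flip: of_nat_mult of_nat_add)
  qed
  have z2: "real_of_int z2 \<le> of_int z0 + real (2 ^ W * W)"
  proof -
    have "j * W \<le> 2 ^ W * W" using ij by (intro mult_right_mono) auto
    then show ?thesis unfolding z2_def by (simp only: of_int_add of_int_of_nat_eq add_le_cancel_left of_nat_le_iff)
  qed
  have "AE y in lborel. \<forall>z::int. (y + of_int z) / real b ^ n \<in> T \<longrightarrow> (\<exists>!e. e \<in> S \<and> y + of_int z - of_int e \<in> T)"
    unfolding S_def by (intro AE_lborel_all_translates digit_sums_unique[OF b0 T(1)] pieces_ae_disjoint[OF b0 D T(1)])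
  then have "AE y in lborel. 0 \<le> y \<longrightarrow> y < 1 \<longrightarrow> tiles (nat (z2 - z1)) (fibre T y) (S \<inter> {z1..<z2})"
  proof (eventually_elim, intro impI)
    fix y :: real
    assume y: "\<forall>z::int. (y + of_int z) / real b ^ n \<in> T \<longrightarrow> (\<exists>!e. e \<in> S \<and> y + of_int z - of_int e \<in> T)" and y01: "0 \<le> y" "y < 1"
    show "tiles (nat (z2 - z1)) (fibre T y) (S \<inter> {z1..<z2})"
    proof (rule tiles_from_window[OF K(2)[OF y01] K(1) W _ z12])
      show "finite S" unfolding S_def by (rule finite_digit_sums[OF D(1)])
      show "\<forall>e\<in>{0..<int W}. (z1 + e \<in> S) = (z2 + e \<in> S)" using win unfolding z1_def z2_def .
      fix z assume z: "z1 + K \<le> z" "z < z2 + K"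
      have "z0 \<le> z" using z K(1) z1_def by linarith
      moreover have "real_of_int z \<le> of_int z0 + L - 2"
      proof -
        have "real_of_int z < of_int z2 + of_int K" using z(2) by linarith
        then show ?thesis using z2 by (simp add: L_def)
      qed
      ultimately have "\<exists>!e. e \<in> S \<and> y + of_int z - of_int e \<in> T" using y inT[OF y01] by blast
      moreover have "y + of_int z - of_int e \<in> T \<longleftrightarrow> z - e \<in> fibre T y" for e
        by (simp add: fibre_def algebra_simps)
      ultimately show "\<exists>!e. e \<in> S \<and> z - e \<in> fibre T y" by simp
    qed
  qed
  then show ?thesis by blast
qed

lemma fibres_tile_substitution:
  assumes b: "b \<ge> 2" and D: "finite D" "card D = b" 
    and T: "is_attractor b D T"
    and K: "\<And>y. 0 \<le> y \<Longrightarrow> y < 1 \<Longrightarrow> fibre T y \<subseteq> {-K..K}"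
    and good: "AE y in lborel. 0 \<le> y \<longrightarrow> y < 1 \<longrightarrow> tiles N (fibre T y) B"
  shows "AE y in lborel. 0 \<le> y \<longrightarrow> y < 1 \<longrightarrow> tiles (b * N) (fibre T y) ((\<lambda>(d, x). d + int b * x) ` (D \<times> B))"
proof -
  have b0: "b > 0" using b by simp
  note mem = attractor_mem_iff[OF b0 T]
  have "AE y in lborel. 0 \<le> real k / real b + 1 / real b * y \<longrightarrow> real k / real b + 1 / real b * y < 1 \<longrightarrow> tiles N (fibre T (real k / real b + 1 / real b * y)) B" for k
    using b0 by (intro AE_lborel_affine[OF good]) simp
  then have "AE y in lborel. \<forall>k::nat. 0 \<le> real k / real b + 1 / real b * y \<longrightarrow> real k / real b + 1 / real b * y < 1 \<longrightarrow> tiles N (fibre T (real k / real b + 1 / real b * y)) B"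
    by (subst AE_all_countable) blast
  with AE_lborel_all_translates[OF pieces_ae_disjoint[OF b0 D T]] show ?thesis
  proof (eventually_elim, intro impI)
    fix y assume dj: "\<forall>z::int. \<forall>d\<in>D. \<forall>d'\<in>D. y + of_int z - of_int d \<in> T \<longrightarrow> y + of_int z - of_int d' \<in> T \<longrightarrow> d = d'"
      and t: "\<forall>k::nat. 0 \<le> real k / real b + 1 / real b * y \<longrightarrow> real k / real b + 1 / real b * y < 1 \<longrightarrow> tiles N (fibre T (real k / real b + 1 / real b * y)) B"
      and y: "0 \<le> y" "y < 1"
    show "tiles (b * N) (fibre T y) ((\<lambda>(d, x). d + int b * x) ` (D \<times> B))"
    proof (rule tiles_substitution[OF b0 _ D(1)])
      show "finite (fibre T y)" using K[OF y] finite_subset by blast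
      fix k assume k: "k < b"
      have "real k + y < real b" using k y by linarith
      then have "0 \<le> real k / real b + 1 / real b * y" "real k / real b + 1 / real b * y < 1"
        using y b0 by (auto simp: field_simps)
      then have "tiles N (fibre T (real k / real b + 1 / real b * y)) B" using t by blast
      moreover have "fibre T (real k / real b + 1 / real b * y) = {n. \<exists>d\<in>D. int k + int b * n - d \<in> fibre T y}"
      proof -
        have "real k / real b + 1 / real b * y + of_int n = (y + of_int (int k + int b * n)) / real b" for n
          using b0 by (simp add: field_simps)
        then show ?thesis unfolding fibre_def by (simp only: mem) (simp add: algebra_simps)
      qed
      ultimately show "tiles N {n. \<exists>d\<in>D. int k + int b * n - d \<in> fibre T y} B" by simp
    next
      fix z d d' assume "d \<in> D" "d' \<in> D" "z - d \<in> fibre T y" "z - d' \<in> fibre T y"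
      then show "d = d'" using dj[rule_format, of d d' z] by (simp add: fibre_def algebra_simps)
    qed
  qed
qed

section \<open>Trigonometric polynomials\<close>

inductive_set lin_comb :: "('a \<Rightarrow> complex) set \<Rightarrow> ('a \<Rightarrow> complex) set" for E where
  zero: "(\<lambda>x. 0) \<in> lin_comb E"
| add: "\<lbrakk>f \<in> lin_comb E; g \<in> E\<rbrakk> \<Longrightarrow> (\<lambda>x. f x + a * g x) \<in> lin_comb E"

lemma lin_comb_finite_sum:
  assumes "f \<in> lin_comb E"
  shows "\<exists>F c. finite F \<and> F \<subseteq> E \<and> f = (\<lambda>x. \<Sum>g\<in>F. c g * g x)"
  using assms
proof induction
  case zero
  show ?case by (intro exI[of _ "{}"]) auto
next
  case (add f g a)
  then obtain F c where F: "finite F" "F \<subseteq> E" "f = (\<lambda>x. \<Sum>g\<in>F. c g * g x)" by blast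
  define c' where "c' = (\<lambda>h. (if h \<in> F then c h else 0) + (if h = g then a else 0))"
  have "(\<Sum>h\<in>insert g F. c' h * h x) = f x + a * g x" for x
  proof -
    have "(\<Sum>h\<in>insert g F. c' h * h x) = (\<Sum>h\<in>insert g F. (if h \<in> F then c h else 0) * h x) + (\<Sum>h\<in>insert g F. (if h = g then a else 0) * h x)"
      by (simp add: c'_def distrib_right sum.distrib)
    also have "(\<Sum>h\<in>insert g F. (if h \<in> F then c h else 0) * h x) = (\<Sum>h\<in>F. c h * h x)"
      using F(1) by (intro sum.mono_neutral_cong_right) auto
    also have "(\<Sum>h\<in>insert g F. (if h = g then a else 0) * h x) = (\<Sum>h\<in>{g}. a * h x)"
      using F(1) by (intro sum.mono_neutral_cong_right) auto
    finally show ?thesis using F(3) by simp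
  qed
  then show ?case using F add.hyps by (intro exI[of _ "insert g F"] exI[of _ c']) auto
qed

lemma lin_comb_base: "g \<in> E \<Longrightarrow> g \<in> lin_comb E"
  using lin_comb.add[OF lin_comb.zero, of g E 1] by simp

lemma lin_comb_plus:
  assumes "f \<in> lin_comb E" "g \<in> lin_comb E"
  shows "(\<lambda>x. f x + g x) \<in> lin_comb E"
  using assms(2)
proof (induction g rule: lin_comb.induct)
  case zero
  show ?case using assms(1) by simp
next
  case (add g h a)
  then show ?case using lin_comb.add[of "\<lambda>x. f x + g x" E h a] by (simp add: add.assoc)
qed

lemma lin_comb_scale: "f \<in> lin_comb E \<Longrightarrow> (\<lambda>x. c * f x) \<in> lin_comb E"
proof (induction f rule: lin_comb.induct)
  case zero
  show ?case using lin_comb.zero by simp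
next
  case (add f g a)
  then show ?case using lin_comb.add[of "\<lambda>x. c * f x" E g "c * a"] by (simp add: algebra_simps)
qed

lemma lin_comb_mult:
  assumes "f \<in> lin_comb E" "g \<in> lin_comb E'" and cl: "\<And>u v. u \<in> E \<Longrightarrow> v \<in> E' \<Longrightarrow> (\<lambda>x. u x * v x) \<in> E''"
  shows "(\<lambda>x. f x * g x) \<in> lin_comb E''"
  using assms(1)
proof (induction f rule: lin_comb.induct)
  case zero
  show ?case using lin_comb.zero by simp
next
  case (add f u a)
  have "(\<lambda>x. u x * g x) \<in> lin_comb E''"
    using assms(2)
  proof (induction g rule: lin_comb.induct)
    case zero
    show ?case using lin_comb.zero by simp
  next
    case (add g v b)
    have "(\<lambda>x. u x * g x + b * (u x * v x)) \<in> lin_comb E''"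
      by (rule lin_comb.add[OF add.IH cl]) (use \<open>u \<in> E\<close> add in auto)
    then show ?case by (simp add: algebra_simps)
  qed
  from lin_comb_plus[OF add.IH lin_comb_scale[OF this, of a]] show ?case by (simp add: algebra_simps)
qed

lemma lin_comb_sum:
  assumes "\<And>i. i \<in> I \<Longrightarrow> f i \<in> lin_comb E"
  shows "(\<lambda>x. \<Sum>i\<in>I. f i x) \<in> lin_comb E"
  using assms
proof (induction I rule: infinite_finite_induct)
  case (insert i I)
  then have "(\<lambda>x. f i x + (\<Sum>i\<in>I. f i x)) \<in> lin_comb E" by (intro lin_comb_plus) auto
  then show ?case using insert.hyps by simp
qed (auto intro: lin_comb.zero)

lemma exponential_mult: "(\<lambda>x. exponential l x * exponential m x) = exponential (l + m)"
  by (rule ext) (simp add: exponential_add_left)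

lemma exponential_zero: "exponential 0 x = 1" by (simp add: exponential_def)

lemma exponential_cis: "exponential l x = cis (2 * pi * l * x)"
  by (simp add: exponential_def cis_conv_exp mult_ac)

abbreviation trig_polys :: "(real \<Rightarrow> complex) set" where
  "trig_polys \<equiv> lin_comb (exponential ` \<int>)"

lemma trig_polys_mult: "\<lbrakk>f \<in> trig_polys; g \<in> trig_polys\<rbrakk> \<Longrightarrow> (\<lambda>x. f x * g x) \<in> trig_polys"
  by (erule (1) lin_comb_mult) (auto simp: exponential_mult)

lemma trig_polys_const: "(\<lambda>x. c) \<in> trig_polys"
proof -
  have "(\<lambda>x. c * exponential 0 x) \<in> trig_polys" by (intro lin_comb_scale lin_comb_base) auto
  then show ?thesis by (simp add: exponential_zero)
qed

text \<open>The real and imaginary parts of a point of the unit circle are combinations of that point and its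
  conjugate.\<close>

lemma real_polynomial_circle_trig:
  assumes "real_polynomial_function (f :: complex \<Rightarrow> real)"
  shows "(\<lambda>t. complex_of_real (f (exponential 1 t))) \<in> trig_polys"
  using assms
proof induction
  case (linear f)
  interpret bounded_linear f by fact
  have f: "f z = Re z * f 1 + Im z * f \<i>" for z
  proof -
    have "f (Re z *\<^sub>R 1 + Im z *\<^sub>R \<i>) = Re z * f 1 + Im z * f \<i>" by (simp add: add scaleR)
    moreover have "Re z *\<^sub>R 1 + Im z *\<^sub>R \<i> = z" by (simp add: complex_eq_iff)
    ultimately show ?thesis by simp
  qed
  have e: "exponential (-1) t = cnj (exponential 1 t)" for t by (simp add: exponential_cis cis_cnj)
  have re: "complex_of_real (Re z) = z / 2 + cnj z / 2" "complex_of_real (Im z) = (z - cnj z) / (2 * \<i>)" for z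
    by (simp_all add: complex_eq_iff)
  have "complex_of_real (f (exponential 1 t)) = 
      (f 1 / 2 + f \<i> / (2 * \<i>)) * exponential 1 t + (f 1 / 2 - f \<i> / (2 * \<i>)) * exponential (-1) t" for t
    unfolding e by (subst f) (simp only: of_real_add of_real_mult re, simp add: field_simps)
  moreover have "(\<lambda>t. (f 1 / 2 + f \<i> / (2 * \<i>)) * exponential 1 t + (f 1 / 2 - f \<i> / (2 * \<i>)) * exponential (-1) t) \<in> trig_polys"
    by (intro lin_comb_plus lin_comb_scale lin_comb_base imageI) auto
  ultimately show ?case by simp
next
  case (const c) then show ?case by (rule trig_polys_const)
next
  case (add f g) then show ?case using lin_comb_plus by fastforce
next
  case (mult f g) then show ?case using trig_polys_mult by fastforce
qed

text \<open>The function is transported to the unit circle by the argument. There it is continuous, as it vanishes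
  near the point 1 where the argument jumps, and the Stone-Weierstrass theorem applies.\<close>

lemma trig_polys_uniformly_dense:
  assumes h: "continuous_on UNIV h" and eta: "\<eta> > 0" "\<And>t. t \<le> \<eta> \<Longrightarrow> h t = 0" "\<And>t. t \<ge> 1 - \<eta> \<Longrightarrow> h t = 0" and e: "e > 0"
  shows "\<exists>P\<in>trig_polys. \<forall>t\<in>{0..<1}. cmod (h t - P t) < e"
proof -
  define H where "H z = h (Arg2pi z / (2 * pi))" for z
  define \<eta>' where "\<eta>' = min \<eta> (1/4)"
  have eta': "\<eta>' > 0" "\<eta>' \<le> \<eta>" "\<eta>' \<le> 1/4" using eta by (auto simp: \<eta>'_def)
  have "continuous_on (sphere 0 1) H"
    unfolding continuous_on_eq_continuous_within
  proof
    fix z :: complex assume z: "z \<in> sphere 0 1"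
    show "continuous (at z within sphere 0 1) H"
    proof (cases "z \<in> \<real>\<^sub>\<ge>\<^sub>0")
      case False
      have "isCont (\<lambda>z. Arg2pi z / (2 * pi)) z" using continuous_at_Arg2pi[OF False] by (intro continuous_intros) auto
      moreover have "isCont h (Arg2pi z / (2 * pi))" using h by (simp add: continuous_on_eq_continuous_at)
      ultimately have "isCont (h \<circ> (\<lambda>z. Arg2pi z / (2 * pi))) z" by (rule continuous_at_compose)
      moreover have "h \<circ> (\<lambda>z. Arg2pi z / (2 * pi)) = H" by (simp add: H_def fun_eq_iff)
      ultimately have "isCont H z" by simp
      then show ?thesis by (rule continuous_at_imp_continuous_within)
    next
      case True
      then have z1: "z = 1" using z by (auto elim!: nonneg_Reals_cases)
      define V where "V = {w. Re w > cos (2 * pi * \<eta>')}"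
      have "open V" unfolding V_def by (rule open_halfspace_Re_gt)
      have "cos (2 * pi * \<eta>') < cos 0" using eta' by (intro cos_monotone_0_pi) auto
      then have "1 \<in> V" by (simp add: V_def)
      have HV: "H w = 0" if "w \<in> V" "cmod w = 1" for w
      proof -
        define t where "t = Arg2pi w"
        have t: "0 \<le> t" "t < 2 * pi" using Arg2pi[of w] by (auto simp: t_def)
        have ct: "cos t > cos (2 * pi * \<eta>')" using that cos_Arg2pi[of w] by (simp add: V_def t_def)
        have "t / (2 * pi) \<le> \<eta> \<or> t / (2 * pi) \<ge> 1 - \<eta>"
        proof (rule ccontr)
          assume "\<not> ?thesis"
          then have t1: "2 * pi * \<eta> < t" "t < 2 * pi - 2 * pi * \<eta>" by (auto simp: field_simps)
          have "2 * pi * \<eta>' \<le> 2 * pi * \<eta>" using eta' by (intro mult_left_mono) auto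
          then have tt: "2 * pi * \<eta>' < t" "2 * pi * \<eta>' < 2 * pi - t" using t1 by linarith+
          have p: "0 \<le> 2 * pi * \<eta>'" using eta' by simp
          show False
          proof (cases "t \<le> pi")
            case True
            have "cos t < cos (2 * pi * \<eta>')" using tt p True by (intro cos_monotone_0_pi) auto
            then show False using ct by simp
          next
            case F: False
            have "cos (2 * pi - t) < cos (2 * pi * \<eta>')" using tt p F by (intro cos_monotone_0_pi) auto
            moreover have "cos (2 * pi - t) = cos t" by (simp add: cos_diff)
            ultimately show False using ct by simp
          qed
        qed
        then show ?thesis using eta(2,3) unfolding H_def t_def by blast
      qed
      have "(H \<longlongrightarrow> 0) (at z within sphere 0 1)"
      proof (rule tendsto_eventually)
        have "eventually (\<lambda>w. w \<in> V) (nhds z)" using \<open>open V\<close> \<open>1 \<in> V\<close> z1 eventually_nhds by blast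
        then show "\<forall>\<^sub>F w in at z within sphere 0 1. H w = 0"
          unfolding eventually_at_filter by eventually_elim (auto intro: HV)
      qed
      moreover have "H z = 0" using HV[of 1] \<open>1 \<in> V\<close> z1 by simp
      ultimately show ?thesis by (simp add: continuous_within)
    qed
  qed
  then obtain g where g: "polynomial_function g" "\<And>z. z \<in> sphere 0 1 \<Longrightarrow> norm (H z - g z) < e"
    using Stone_Weierstrass_polynomial_function[of "sphere (0::complex) 1" H e] e by auto
  have "real_polynomial_function (Re \<circ> g)" "real_polynomial_function (Im \<circ> g)"
    using g(1) bounded_linear_Re bounded_linear_Im unfolding polynomial_function_def by auto
  then have "(\<lambda>t. complex_of_real ((Re \<circ> g) (exponential 1 t)) + \<i> * complex_of_real ((Im \<circ> g) (exponential 1 t))) \<in> trig_polys"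
    by (intro lin_comb_plus lin_comb_scale real_polynomial_circle_trig)
  moreover have "complex_of_real ((Re \<circ> g) w) + \<i> * complex_of_real ((Im \<circ> g) w) = g w" for w
    by (simp add: complex_eq_iff)
  ultimately have "(\<lambda>t. g (exponential 1 t)) \<in> trig_polys" by simp
  moreover have "cmod (h t - g (exponential 1 t)) < e" if "t \<in> {0..<1}" for t
  proof -
    have "Arg2pi (exponential 1 t) = 2 * pi * t"
      by (rule Arg2pi_unique[of 1]) (use that in \<open>auto simp: exponential_def mult_ac\<close>)
    then have "H (exponential 1 t) = h t" by (simp add: H_def)
    then show ?thesis using g(2)[of "exponential 1 t"] norm_exponential by (simp add: exponential_cis)
  qed
  ultimately show ?thesis by (intro bexI[of _ "\<lambda>t. g (exponential 1 t)"] ballI)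
qed

section \<open>Mean square approximation on the unit interval\<close>

abbreviation unit_lebesgue :: "real measure" where
  "unit_lebesgue \<equiv> lebesgue_on {0..<1}"

lemma finite_measure_unit: "finite_measure unit_lebesgue"
  by (rule finite_measure_lebesgue_on) (auto intro!: bounded_set_imp_lmeasurable)

lemma continuous_measurable_lebesgue:
  fixes f :: "real \<Rightarrow> 'b::{metric_space, second_countable_topology}"
  assumes "continuous_on UNIV f"
  shows "f \<in> borel_measurable lebesgue"
  by (rule measurable_completion) (simp add: borel_measurable_continuous_onI[OF assms])

text \<open>The radial retraction onto the disc of radius \<open>M\<close>.\<close>

definition clamp_norm :: "real \<Rightarrow> complex \<Rightarrow> complex" where
  "clamp_norm M z = z /\<^sub>R max 1 (cmod z / M)"

lemma clamp_norm_le: "M > 0 \<Longrightarrow> cmod (clamp_norm M z) \<le> M"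
  by (auto simp: clamp_norm_def max_def field_simps split: if_splits)

lemma clamp_norm_id: "M > 0 \<Longrightarrow> cmod z \<le> M \<Longrightarrow> clamp_norm M z = z"
  by (auto simp: clamp_norm_def max_def field_simps)

lemma clamp_norm_diff_le: "M > 0 \<Longrightarrow> cmod (z - clamp_norm M z) \<le> cmod z"
proof -
  assume M: "M > 0"
  define s where "s = inverse (max 1 (cmod z / M))"
  have s: "0 \<le> s" "s \<le> 1" unfolding s_def by (auto simp: inverse_le_1_iff max_def)
  have "z - clamp_norm M z = (1 - s) *\<^sub>R z" by (simp add: clamp_norm_def s_def algebra_simps)
  then have "cmod (z - clamp_norm M z) = (1 - s) * cmod z" using s by simp
  also have "\<dots> \<le> 1 * cmod z" using s by (intro mult_right_mono) auto
  finally show ?thesis by simp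
qed

lemma continuous_on_clamp_norm: "M > 0 \<Longrightarrow> continuous_on UNIV (clamp_norm M)"
  unfolding clamp_norm_def by (intro continuous_intros) (auto simp: max_def)

lemma measurable_clamp_norm[measurable]: "M > 0 \<Longrightarrow> clamp_norm M \<in> borel_measurable borel"
  by (rule borel_measurable_continuous_onI[OF continuous_on_clamp_norm])

lemma cmod_add_squared_le: "(cmod (x + y))\<^sup>2 \<le> 2 * (cmod x)\<^sup>2 + 2 * (cmod y)\<^sup>2"
proof -
  have "(cmod (x + y))\<^sup>2 \<le> (cmod x + cmod y)\<^sup>2" by (rule power_mono[OF norm_triangle_ineq]) simp
  also have "\<dots> = 2 * (cmod x)\<^sup>2 + 2 * (cmod y)\<^sup>2 - (cmod x - cmod y)\<^sup>2" by (simp add: power2_eq_square algebra_simps)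
  also have "\<dots> \<le> 2 * (cmod x)\<^sup>2 + 2 * (cmod y)\<^sup>2" by simp
  finally show ?thesis .
qed

lemma integrable_bounded_unit:
  fixes f :: "real \<Rightarrow> real"
  assumes "f \<in> borel_measurable unit_lebesgue" "\<And>x. x \<in> {0..<1} \<Longrightarrow> \<bar>f x\<bar> \<le> C"
  shows "integrable unit_lebesgue f"
proof -
  interpret finite_measure unit_lebesgue by (rule finite_measure_unit)
  show ?thesis by (rule integrable_const_bound[of _ C]) (use assms in \<open>auto intro!: AE_I2\<close>)
qed

lemma L2_limit_zero:
  fixes s :: "nat \<Rightarrow> real \<Rightarrow> complex"
  assumes "\<And>n. s n \<in> borel_measurable unit_lebesgue" "integrable unit_lebesgue w"
    and "AE x in unit_lebesgue. (\<lambda>n. s n x) \<longlonglongrightarrow> 0" "\<And>n x. x \<in> {0..<1} \<Longrightarrow> (cmod (s n x))\<^sup>2 \<le> w x" and "e > 0"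
  shows "\<exists>n. (\<integral>x. (cmod (s n x))\<^sup>2 \<partial>unit_lebesgue) < e"
proof -
  have "(\<lambda>n. \<integral>x. (cmod (s n x))\<^sup>2 \<partial>unit_lebesgue) \<longlonglongrightarrow> (\<integral>x. 0 \<partial>unit_lebesgue)"
  proof (rule integral_dominated_convergence[where w = w])
    show "AE x in unit_lebesgue. (\<lambda>n. (cmod (s n x))\<^sup>2) \<longlonglongrightarrow> 0"
      using assms(3)
    proof (eventually_elim)
      case (elim x)
      then have "(\<lambda>n. (cmod (s n x))\<^sup>2) \<longlonglongrightarrow> (cmod 0)\<^sup>2" by (intro tendsto_intros)
      then show ?case by simp
    qed
    show "AE x in unit_lebesgue. norm ((cmod (s i x))\<^sup>2) \<le> w x" for i using assms(4) by (auto intro!: AE_I2)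
  qed (use assms(1,2) in auto)
  then have "\<forall>\<^sub>F n in sequentially. (\<integral>x. (cmod (s n x))\<^sup>2 \<partial>unit_lebesgue) < e"
    using \<open>e > 0\<close> by (intro order_tendstoD(2)) auto
  then show ?thesis by (auto simp: eventually_sequentially)
qed

lemma trig_polys_continuous: "P \<in> trig_polys \<Longrightarrow> continuous_on UNIV P"
proof (induction P rule: lin_comb.induct)
  case (add f g a)
  have "continuous_on UNIV g" using add(2) unfolding exponential_def by (auto intro!: continuous_intros)
  then show ?case using add by (intro continuous_intros) auto
qed simp

text \<open>Three approximations: by a bounded function and then by a continuous one, both by dominated
  convergence, and finally by a trigonometric polynomial, uniformly. The continuous function carries a
  plateau factor that vanishes near 0 and 1, so that it extends periodically.\<close>

lemma trig_polys_L2_dense: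
  assumes c: "c \<in> borel_measurable lebesgue" and c2: "integrable unit_lebesgue (\<lambda>x. (cmod (c x))\<^sup>2)" and e: "e > 0"
  shows "\<exists>P\<in>trig_polys. integrable unit_lebesgue (\<lambda>x. (cmod (c x - P x))\<^sup>2) \<and> (\<integral>x. (cmod (c x - P x))\<^sup>2 \<partial>unit_lebesgue) < e"
proof -
  have cm: "f \<in> borel_measurable unit_lebesgue" if "f \<in> borel_measurable lebesgue" for f :: "real \<Rightarrow> complex"
    by (rule measurable_restrict_space1[OF that])
  note c[THEN cm, measurable]
  obtain n where n: "(\<integral>x. (cmod (c x - clamp_norm (real (Suc n)) (c x)))\<^sup>2 \<partial>unit_lebesgue) < e / 16"
  proof -
    have "\<exists>n. (\<integral>x. (cmod (c x - clamp_norm (real (Suc n)) (c x)))\<^sup>2 \<partial>unit_lebesgue) < e / 16"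
    proof (rule L2_limit_zero[OF _ c2])
      show "AE x in unit_lebesgue. (\<lambda>n. c x - clamp_norm (real (Suc n)) (c x)) \<longlonglongrightarrow> 0"
      proof (rule AE_I2, rule tendsto_eventually)
        fix x
        obtain N where N: "cmod (c x) \<le> real N" using real_arch_simple by blast
        show "\<forall>\<^sub>F n in sequentially. c x - clamp_norm (real (Suc n)) (c x) = 0"
          by (rule eventually_sequentiallyI[of N]) (use N in \<open>auto simp: clamp_norm_id\<close>)
      qed
      show "(cmod (c x - clamp_norm (real (Suc n)) (c x)))\<^sup>2 \<le> (cmod (c x))\<^sup>2" for n x
        by (intro power_mono clamp_norm_diff_le) auto
    qed (use e in auto)
    then show ?thesis using that by blast
  qed
  define M where "M = real (Suc n)"
  have M: "M > 0" by (simp add: M_def)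
  define c1 where "c1 = (\<lambda>x. clamp_norm M (c x))"
  have c1m[measurable]: "c1 \<in> borel_measurable unit_lebesgue" unfolding c1_def using M by measurable
  have n1: "(\<integral>x. (cmod (c x - c1 x))\<^sup>2 \<partial>unit_lebesgue) < e / 16" using n by (simp add: c1_def M_def)
  have i1: "integrable unit_lebesgue (\<lambda>x. (cmod (c x - c1 x))\<^sup>2)"
  proof (rule Bochner_Integration.integrable_bound[OF c2])
    show "AE x in unit_lebesgue. norm ((cmod (c x - c1 x))\<^sup>2) \<le> norm ((cmod (c x))\<^sup>2)"
      unfolding c1_def using M by (auto intro!: AE_I2 power_mono clamp_norm_diff_le)
  qed auto
  have "c measurable_on UNIV" using c by (simp add: lebesgue_measurable_imp_measurable_on)
  then obtain N g where N: "negligible N" "\<And>k. continuous_on UNIV (g k)" "\<And>x. x \<notin> N \<Longrightarrow> (\<lambda>k. g k x) \<longlonglongrightarrow> c x"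
    unfolding measurable_on_def by auto
  \<comment> \<open>Zero within \<open>1 / (k + 1)\<close> of the end points, and eventually 1 at every interior point.\<close>
  define \<tau> where "\<tau> k x = max 0 (min 1 (real (Suc k) * min x (1 - x) - 1))" for k and x :: real
  define \<phi> where "\<phi> k x = complex_of_real (\<tau> k x) * clamp_norm M (g k x)" for k x
  have chi: "0 \<le> \<tau> k x" "\<tau> k x \<le> 1" for k x by (auto simp: \<tau>_def)
  have phic: "continuous_on UNIV (\<phi> k)" for k
  proof -
    have "continuous_on UNIV (\<lambda>x. clamp_norm M (g k x))"
      using continuous_on_compose2[OF continuous_on_clamp_norm[OF M] N(2)] by auto
    then show ?thesis unfolding \<phi>_def \<tau>_def by (intro continuous_intros)
  qed
  have phim[measurable]: "\<phi> k \<in> borel_measurable unit_lebesgue" for k by (rule cm[OF continuous_measurable_lebesgue[OF phic]])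
  have phib: "cmod (\<phi> k x) \<le> M" for k x
  proof -
    have "cmod (\<phi> k x) = \<tau> k x * cmod (clamp_norm M (g k x))" using chi by (simp add: \<phi>_def norm_mult)
    also have "\<dots> \<le> 1 * M" using chi clamp_norm_le[OF M] by (intro mult_mono) auto
    finally show ?thesis by simp
  qed
  have c1b: "cmod (c1 x) \<le> M" for x unfolding c1_def by (rule clamp_norm_le[OF M])
  have "\<exists>k. (\<integral>x. (cmod (c1 x - \<phi> k x))\<^sup>2 \<partial>unit_lebesgue) < e / 16"
  proof (rule L2_limit_zero[where w = "\<lambda>_. (2 * M)\<^sup>2"])
    show "integrable unit_lebesgue (\<lambda>_. (2 * M)\<^sup>2)" by (rule integrable_bounded_unit[where C = "(2 * M)\<^sup>2"]) auto
    show "(cmod (c1 x - \<phi> k x))\<^sup>2 \<le> (2 * M)\<^sup>2" for k x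
    proof (rule power_mono)
      have "cmod (c1 x - \<phi> k x) \<le> cmod (c1 x) + cmod (\<phi> k x)" by (rule norm_triangle_ineq4)
      then show "cmod (c1 x - \<phi> k x) \<le> 2 * M" using phib[of k x] c1b[of x] by linarith
    qed simp
    have "N \<union> {0} \<in> null_sets lebesgue" using N(1) by (simp add: negligible_iff_null_sets[symmetric] negligible_Un)
    then have "AE x in lebesgue. x \<notin> N \<union> {0}" by (rule AE_not_in)
    then show "AE x in unit_lebesgue. (\<lambda>k. c1 x - \<phi> k x) \<longlonglongrightarrow> 0"
      unfolding AE_restrict_space_iff[of "{0..<1::real}" lebesgue, simplified]
    proof (eventually_elim, intro impI)
      fix x :: real assume x: "x \<notin> N \<union> {0}" "0 \<le> x \<and> x < 1"
      have "(\<lambda>k. clamp_norm M (g k x)) \<longlonglongrightarrow> clamp_norm M (c x)"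
        using continuous_on_tendsto_compose[OF continuous_on_clamp_norm[OF M] N(3)] x by auto
      moreover have "(\<lambda>k. complex_of_real (\<tau> k x)) \<longlonglongrightarrow> 1"
      proof (rule tendsto_eventually)
        define m where "m = min x (1 - x)"
        have m: "m > 0" using x by (auto simp: m_def)
        obtain K where K: "2 / m \<le> real K" using real_arch_simple by blast
        show "\<forall>\<^sub>F k in sequentially. complex_of_real (\<tau> k x) = 1"
        proof (rule eventually_sequentiallyI[of K])
          fix k assume "K \<le> k"
          then have "2 / m \<le> real (Suc k)" using K by linarith
          then have "2 \<le> real (Suc k) * m" using m by (simp add: field_simps)
          then show "complex_of_real (\<tau> k x) = 1" by (simp add: \<tau>_def m_def[symmetric])
        qed
      qed
      ultimately have "(\<lambda>k. \<phi> k x) \<longlonglongrightarrow> 1 * clamp_norm M (c x)" unfolding \<phi>_def by (intro tendsto_mult)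
      then have "(\<lambda>k. c1 x - \<phi> k x) \<longlonglongrightarrow> c1 x - c1 x" unfolding c1_def by (intro tendsto_intros) simp
      then show "(\<lambda>k. c1 x - \<phi> k x) \<longlonglongrightarrow> 0" by simp
    qed
  qed (use e in auto)
  then obtain k where k: "(\<integral>x. (cmod (c1 x - \<phi> k x))\<^sup>2 \<partial>unit_lebesgue) < e / 16" by blast
  have i2: "integrable unit_lebesgue (\<lambda>x. (cmod (c1 x - \<phi> k x))\<^sup>2)"
  proof (rule integrable_bounded_unit[where C = "(2 * M)\<^sup>2"])
    fix x
    have "cmod (c1 x - \<phi> k x) \<le> cmod (c1 x) + cmod (\<phi> k x)" by (rule norm_triangle_ineq4)
    then have "cmod (c1 x - \<phi> k x) \<le> 2 * M" using phib[of k x] c1b[of x] by linarith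
    then have "(cmod (c1 x - \<phi> k x))\<^sup>2 \<le> (2 * M)\<^sup>2" by (rule power_mono) simp
    then show "\<bar>(cmod (c1 x - \<phi> k x))\<^sup>2\<bar> \<le> (2 * M)\<^sup>2" by (simp only: abs_of_nonneg zero_le_power2)
  qed auto
  define \<eta> where "\<eta> = 1 / real (Suc k)"
  have eta0: "\<eta> > 0" by (simp add: \<eta>_def)
  have chi0: "\<phi> k t = 0" if "min t (1 - t) \<le> \<eta>" for t
  proof -
    have "real (Suc k) * min t (1 - t) \<le> real (Suc k) * \<eta>" using that by (intro mult_left_mono) auto
    then have "\<tau> k t = 0" by (simp add: \<tau>_def \<eta>_def)
    then show ?thesis by (simp add: \<phi>_def)
  qed
  define d where "d = sqrt (e / 16)"
  have d: "d > 0" "d\<^sup>2 = e / 16" using e by (auto simp: d_def)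
  obtain P where P: "P \<in> trig_polys" "\<And>t. t \<in> {0..<1} \<Longrightarrow> cmod (\<phi> k t - P t) < d"
    using trig_polys_uniformly_dense[OF phic[of k] eta0 _ _ d(1)] chi0 by (auto simp: min_le_iff_disj)
  have Pm[measurable]: "P \<in> borel_measurable unit_lebesgue"
    by (rule cm[OF continuous_measurable_lebesgue[OF trig_polys_continuous[OF P(1)]]])
  have Pd: "(cmod (\<phi> k t - P t))\<^sup>2 \<le> e / 16" if "t \<in> {0..<1}" for t
    unfolding d(2)[symmetric] using P(2)[OF that] by (intro power_mono) auto
  have i3: "integrable unit_lebesgue (\<lambda>x. (cmod (\<phi> k x - P x))\<^sup>2)"
    by (rule integrable_bounded_unit[where C = "e / 16"]) (use Pd in auto)
  have m1: "measure unit_lebesgue (space unit_lebesgue) = 1"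
    by (simp add: measure_restrict_space)
  have "(\<integral>x. (cmod (\<phi> k x - P x))\<^sup>2 \<partial>unit_lebesgue) \<le> (\<integral>x. e / 16 \<partial>unit_lebesgue)"
    using Pd by (intro integral_mono[OF i3]) (auto intro!: integrable_bounded_unit[where C = "e / 16"] simp: e less_imp_le)
  then have k3: "(\<integral>x. (cmod (\<phi> k x - P x))\<^sup>2 \<partial>unit_lebesgue) \<le> e / 16" using m1 by simp
  let ?b = "\<lambda>x. 2 * (cmod (c x - c1 x))\<^sup>2 + (4 * (cmod (c1 x - \<phi> k x))\<^sup>2 + 4 * (cmod (\<phi> k x - P x))\<^sup>2)"
  have bd: "(cmod (c x - P x))\<^sup>2 \<le> ?b x" for x
    using cmod_add_squared_le[of "c x - c1 x" "c1 x - P x"] cmod_add_squared_le[of "c1 x - \<phi> k x" "\<phi> k x - P x"] by simp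
  have ib: "integrable unit_lebesgue ?b" using i1 i2 i3 by auto
  have ic: "integrable unit_lebesgue (\<lambda>x. (cmod (c x - P x))\<^sup>2)"
    by (rule Bochner_Integration.integrable_bound[OF ib]) (use bd in \<open>auto intro!: AE_I2\<close>)
  have "(\<integral>x. (cmod (c x - P x))\<^sup>2 \<partial>unit_lebesgue) \<le> (\<integral>x. ?b x \<partial>unit_lebesgue)"
    using bd by (intro integral_mono[OF ic ib])
  also have "\<dots> = 2 * (\<integral>x. (cmod (c x - c1 x))\<^sup>2 \<partial>unit_lebesgue) + (4 * (\<integral>x. (cmod (c1 x - \<phi> k x))\<^sup>2 \<partial>unit_lebesgue) + 4 * (\<integral>x. (cmod (\<phi> k x - P x))\<^sup>2 \<partial>unit_lebesgue))"
    using i1 i2 i3 by simp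
  also have "\<dots> < e" using n1 k k3 e by linarith
  finally show ?thesis using P(1) ic by blast
qed

section \<open>From spectra of fibres to a spectrum of the set\<close>

lemma integral_unfold:
  fixes F :: "real \<Rightarrow> 'b::euclidean_space"
  assumes F: "integrable lebesgue F" and supp: "\<And>x. \<lfloor>x\<rfloor> \<notin> {-K..K} \<Longrightarrow> F x = 0"
  shows "integrable unit_lebesgue (\<lambda>y. \<Sum>n\<in>{-K..K}. F (y + of_int n))"
    and "(\<integral>x. F x \<partial>lebesgue) = (\<integral>y. (\<Sum>n\<in>{-K..K}. F (y + of_int n)) \<partial>unit_lebesgue)"
proof -
  have U: "{0..<1::real} \<inter> space lebesgue \<in> sets lebesgue" by auto
  let ?G = "\<lambda>n x. indicator {0..<1} (x - of_int n) *\<^sub>R F x"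
  have sh: "indicator {0..<1} y *\<^sub>R F (y + of_int n) = ?G n (of_int n + 1 * y)" for n :: int and y :: real
    by (simp add: add.commute)
  have iG: "integrable lebesgue (?G n)" for n :: int
  proof -
    have "?G n = (\<lambda>x. indicator {of_int n..<of_int n + 1} x *\<^sub>R F x)"
      by (auto simp: fun_eq_iff indicator_def)
    moreover have "{of_int n..<of_int n + 1} \<in> sets (lebesgue :: real measure)" by auto
    ultimately show ?thesis using F integrable_mult_indicator by metis
  qed
  have *: "has_bochner_integral lebesgue (\<lambda>y. indicator {0..<1} y *\<^sub>R F (y + of_int n)) (\<integral>x. ?G n x \<partial>lebesgue)" for n :: int
    unfolding sh using has_bochner_integral_lebesgue_real_affine_iff[of 1 "?G n" "\<integral>x. ?G n x \<partial>lebesgue" "of_int n"]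
      has_bochner_integral_integrable[OF iG] by simp
  have i: "integrable unit_lebesgue (\<lambda>y. F (y + of_int n))" for n :: int
    unfolding integrable_restrict_space[OF U] using * by (simp add: has_bochner_integral_iff)
  have v: "(\<integral>y. F (y + of_int n) \<partial>unit_lebesgue) = (\<integral>x. ?G n x \<partial>lebesgue)" for n :: int
    unfolding integral_restrict_space[OF U] using * by (simp add: has_bochner_integral_iff)
  show "integrable unit_lebesgue (\<lambda>y. \<Sum>n\<in>{-K..K}. F (y + of_int n))" using i by (intro Bochner_Integration.integrable_sum)
  have "F x = (\<Sum>n\<in>{-K..K}. ?G n x)" for x
  proof (cases "\<lfloor>x\<rfloor> \<in> {-K..K}")
    case True
    have ind: "indicator {0..<1} (x - of_int n) = (if n = \<lfloor>x\<rfloor> then 1 else 0 :: real)" for n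
      by (auto simp: indicator_def) linarith+
    have "(\<Sum>n\<in>{-K..K}. ?G n x) = (\<Sum>n\<in>{-K..K}. if n = \<lfloor>x\<rfloor> then F x else 0)"
      unfolding ind by (intro sum.cong) auto
    then show ?thesis using True by simp
  qed (use supp in simp)
  then have "(\<integral>x. F x \<partial>lebesgue) = (\<integral>x. (\<Sum>n\<in>{-K..K}. ?G n x) \<partial>lebesgue)" by simp
  also have "\<dots> = (\<Sum>n\<in>{-K..K}. \<integral>x. ?G n x \<partial>lebesgue)" using iG by (intro Bochner_Integration.integral_sum)
  also have "\<dots> = (\<integral>y. (\<Sum>n\<in>{-K..K}. F (y + of_int n)) \<partial>unit_lebesgue)"
    using i by (subst Bochner_Integration.integral_sum) (auto simp: v)
  finally show "(\<integral>x. F x \<partial>lebesgue) = (\<integral>y. (\<Sum>n\<in>{-K..K}. F (y + of_int n)) \<partial>unit_lebesgue)" .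
qed

text \<open>A square matrix with orthogonal rows of equal length has orthogonal columns. Here the sum of the squared moduli of the
  sums for all \<open>n \<in> A\<close> is \<open>|L|\<^sup>2\<close>, and \<open>n = a\<close> alone contributes that much.\<close>

lemma dual_orthogonality:
  assumes sp: "finite_spectrum L A" and a: "a \<in> A" "n \<in> A"
  shows "(\<Sum>l\<in>L. exponential l (of_int (a - n))) = (if a = n then of_nat (card L) else 0)"
proof (cases "a = n")
  case True
  then show ?thesis by (simp add: exponential_def)
next
  case False
  note L = finite_spectrumD(1-3)[OF sp] and orth = finite_spectrumD(4)[OF sp]
  define m where "m = card L"
  define s where "s n = (\<Sum>l\<in>L. exponential l (of_int (a - n)))" for n :: int
  have cnj_e: "cnj (exponential l x) = exponential (-l) x" for l x by (simp add: exponential_def exp_cnj)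
  have e2: "exponential l (of_int (a - n)) * cnj (exponential l' (of_int (a - n))) = exponential (l - l') (of_int a) * exponential (l' - l) (of_int n)" for l l' n
    unfolding cnj_e by (simp add: exponential_def algebra_simps flip: exp_add)
  have "(\<Sum>n\<in>A. s n * cnj (s n)) = (\<Sum>n\<in>A. \<Sum>l\<in>L. \<Sum>l'\<in>L. exponential (l - l') (of_int a) * exponential (l' - l) (of_int n))"
    unfolding s_def cnj_sum sum_product e2 ..
  also have "\<dots> = (\<Sum>l\<in>L. \<Sum>n\<in>A. \<Sum>l'\<in>L. exponential (l - l') (of_int a) * exponential (l' - l) (of_int n))"
    by (rule sum.swap)
  also have "\<dots> = (\<Sum>l\<in>L. \<Sum>l'\<in>L. \<Sum>n\<in>A. exponential (l - l') (of_int a) * exponential (l' - l) (of_int n))"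
    by (intro sum.cong refl sum.swap)
  also have "\<dots> = (\<Sum>l\<in>L. \<Sum>l'\<in>L. exponential (l - l') (of_int a) * (if l' = l then of_nat m else 0))"
  proof (intro sum.cong refl)
    fix l l' assume l: "l \<in> L" "l' \<in> L"
    have "(\<Sum>n\<in>A. exponential (l' - l) (of_int n)) = (if l' = l then of_nat m else 0)"
      using orth[OF l(2,1)] L(3) by (auto simp: exponential_zero m_def)
    then show "(\<Sum>n\<in>A. exponential (l - l') (of_int a) * exponential (l' - l) (of_int n)) = exponential (l - l') (of_int a) * (if l' = l then of_nat m else 0)"
      by (simp add: sum_distrib_left[symmetric])
  qed
  also have "\<dots> = (\<Sum>l\<in>L. of_nat m)"
    using L(1) by (intro sum.cong refl) (simp add: if_distrib exponential_zero sum.delta cong: if_cong)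
  also have "\<dots> = of_nat (m * m)" by (simp add: m_def)
  finally have tot: "(\<Sum>n\<in>A. s n * cnj (s n)) = of_nat (m * m)" .
  have e0: "(\<Sum>n\<in>A. s n * cnj (s n)) = complex_of_real (\<Sum>n\<in>A. (cmod (s n))\<^sup>2)"
    by (simp only: of_real_sum complex_norm_square)
  have "complex_of_real (\<Sum>n\<in>A. (cmod (s n))\<^sup>2) = complex_of_real (real (m * m))"
    unfolding e0[symmetric] tot by simp
  then have tot': "(\<Sum>n\<in>A. (cmod (s n))\<^sup>2) = real (m * m)" by (simp only: of_real_eq_iff)
  have sa: "s a = of_nat m" by (simp add: s_def m_def exponential_def)
  have "(cmod (s a))\<^sup>2 = real (m * m)" by (simp add: sa power2_eq_square)
  moreover have "(\<Sum>n\<in>{a, n}. (cmod (s n))\<^sup>2) \<le> (\<Sum>n\<in>A. (cmod (s n))\<^sup>2)" using L a by (intro sum_mono2) auto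
  ultimately have "(cmod (s n))\<^sup>2 \<le> 0" using False tot' by simp
  then show ?thesis using False by (simp add: s_def)
qed

lemma compact_interior_measure:
  fixes T :: "real set"
  assumes "compact T" "interior T \<noteq> {}"
  shows "T \<in> sets lebesgue" "0 < emeasure lebesgue T" "emeasure lebesgue T < \<infinity>"
proof -
  have lm: "T \<in> lmeasurable" using assms(1) by (rule lmeasurable_compact)
  then show "T \<in> sets lebesgue" by auto
  show "emeasure lebesgue T < \<infinity>" using fmeasurableD2[OF lm] unfolding infinity_ennreal_def less_top[symmetric] .
  show "0 < emeasure lebesgue T"
  proof (rule ccontr)
    assume "\<not> ?thesis"
    then have "T \<in> null_sets lebesgue" using lm by (intro null_setsI) (auto simp: not_less)
    then have "negligible T" by (simp add: negligible_iff_null_sets)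
    then have "negligible (interior T)" using interior_subset negligible_subset by blast
    then show False using open_not_negligible[of "interior T"] assms(2) by auto
  qed
qed

lemma continuous_on_exponential: "continuous_on S (exponential l)"
  unfolding exponential_def by (intro continuous_intros)

lemma exponential_measurable[measurable]: "exponential l \<in> borel_measurable (lebesgue_on T)"
  by (intro measurable_restrict_space1 continuous_measurable_lebesgue continuous_on_exponential)

lemma cnj_exponential: "cnj (exponential l x) = exponential (-l) x"
  by (simp add: exponential_def exp_cnj)

lemma exponential_L2:
  assumes "T \<in> sets lebesgue" "0 < emeasure lebesgue T" "emeasure lebesgue T < \<infinity>"
  shows "exponential l \<in> L2_space (lebesgue_on T)" "L2_norm (lebesgue_on T) (exponential l) \<noteq> 0"
proof -
  have "T \<in> lmeasurable" using assms by (simp add: fmeasurable_def)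
  then interpret finite_measure "lebesgue_on T" by (rule finite_measure_lebesgue_on)
  show "exponential l \<in> L2_space (lebesgue_on T)" by (simp add: L2_space_def)
  have "measure (lebesgue_on T) (space (lebesgue_on T)) = measure lebesgue T"
    using assms by (simp add: measure_restrict_space)
  also have "\<dots> \<noteq> 0" using assms by (auto simp: measure_def enn2real_eq_0_iff simp del: emeasure_completion)
  finally show "L2_norm (lebesgue_on T) (exponential l) \<noteq> 0" by (simp add: L2_norm_def)
qed

text \<open>Approximation by linear combinations, without reference to a finite set of basis functions and their
  coefficients.\<close>

lemma L2_orthogonal_basisI:
  assumes T: "T \<in> sets lebesgue" "0 < emeasure lebesgue T" "emeasure lebesgue T < \<infinity>"
    and orth: "\<And>l l'. \<lbrakk>l \<in> \<Lambda>; l' \<in> \<Lambda>; exponential l \<noteq> exponential l'\<rbrakk> \<Longrightarrow> (\<integral>x. exponential (l - l') x \<partial>lebesgue_on T) = 0"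
    and dense: "\<And>g \<epsilon>. \<lbrakk>g \<in> L2_space (lebesgue_on T); \<epsilon> > 0\<rbrakk> \<Longrightarrow>
       \<exists>h\<in>lin_comb (exponential ` \<Lambda>). (\<integral>x. (cmod (g x - h x))\<^sup>2 \<partial>lebesgue_on T) < \<epsilon>"
  shows "L2_orthogonal_basis (lebesgue_on T) (exponential ` \<Lambda>)"
  unfolding L2_orthogonal_basis_def
proof (intro conjI ballI allI impI)
  show "exponential ` \<Lambda> \<subseteq> L2_space (lebesgue_on T)" using exponential_L2[OF T] by blast
  show "L2_norm (lebesgue_on T) f \<noteq> 0" if "f \<in> exponential ` \<Lambda>" for f using that exponential_L2[OF T] by blast
  show "pairwise (\<lambda>f g. L2_inner (lebesgue_on T) f g = 0) (exponential ` \<Lambda>)"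
  proof (rule pairwiseI)
    fix f g assume "f \<in> exponential ` \<Lambda>" "g \<in> exponential ` \<Lambda>" "f \<noteq> g"
    then obtain l l' where l: "l \<in> \<Lambda>" "l' \<in> \<Lambda>" "f = exponential l" "g = exponential l'" "exponential l \<noteq> exponential l'" by blast
    show "L2_inner (lebesgue_on T) f g = 0"
      using orth[OF l(1,2,5)] unfolding L2_inner_def l(3,4) cnj_exponential
      by (simp add: exponential_add_left[symmetric])
  qed
  fix g and \<epsilon> :: real assume g: "g \<in> L2_space (lebesgue_on T)" and e: "\<epsilon> > 0"
  obtain h where h: "h \<in> lin_comb (exponential ` \<Lambda>)" "(\<integral>x. (cmod (g x - h x))\<^sup>2 \<partial>lebesgue_on T) < \<epsilon>\<^sup>2"
    using dense[OF g, of "\<epsilon>\<^sup>2"] e by auto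
  obtain F c where F: "finite F" "F \<subseteq> exponential ` \<Lambda>" "h = (\<lambda>x. \<Sum>f\<in>F. c f * f x)"
    using lin_comb_finite_sum[OF h(1)] by blast
  have "L2_norm (lebesgue_on T) (\<lambda>x. g x - (\<Sum>f\<in>F. c f * f x)) < sqrt (\<epsilon>\<^sup>2)"
    unfolding L2_norm_def using h(2) F(3) by (intro real_sqrt_less_mono) simp
  then have "L2_norm (lebesgue_on T) (\<lambda>x. g x - (\<Sum>f\<in>F. c f * f x)) < \<epsilon>" using e by simp
  then show "\<exists>F c. finite F \<and> F \<subseteq> exponential ` \<Lambda> \<and> L2_norm (lebesgue_on T) (\<lambda>x. g x - (\<Sum>f\<in>F. c f * f x)) < \<epsilon>"
    using F by blast
qed

lemma integral_exponential_unit: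
  assumes "j \<noteq> 0"
  shows "(\<integral>y. exponential (of_int j) y \<partial>unit_lebesgue) = 0"
proof -
  interpret finite_measure unit_lebesgue by (rule finite_measure_unit)
  define w where "w = 2 * of_real pi * \<i> * complex_of_real (of_int j)"
  have w: "w \<noteq> 0" using assms by (simp add: w_def)
  have e: "exponential (of_int j) y = exp (w * of_real y)" for y by (simp add: exponential_def w_def)
  have int: "integrable unit_lebesgue (exponential (of_int j))"
    by (rule integrable_const_bound[of _ 1]) auto
  have "((\<lambda>y. exponential (of_int j) y) has_integral (exp (w * of_real 1) / w - exp (w * of_real 0) / w)) {0..1}"
    unfolding e
  proof (rule fundamental_theorem_of_calculus)
    fix x :: real
    have "((\<lambda>z. exp (w * z) / w) has_field_derivative exp (w * of_real x)) (at (of_real x))"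
      using w by (auto intro!: derivative_eq_intros)
    then show "((\<lambda>y. exp (w * of_real y) / w) has_vector_derivative exp (w * of_real x)) (at x within {0..1})"
      using has_vector_derivative_real_field has_vector_derivative_at_within by blast
  qed simp
  moreover have "exp (w * of_real 1) = 1" using exponential_int[of j 1] e[of 1] by simp
  ultimately have "((\<lambda>y. exponential (of_int j) y) has_integral 0) {0..1}" by simp
  then have "integral {0..1} (exponential (of_int j)) = 0" by (rule integral_unique)
  moreover have "integral {0..<1} (exponential (of_int j)) = integral {0..1} (exponential (of_int j))"
    by (rule integral_spike_set) (auto intro: negligible_subset[of "{1}"])
  ultimately show ?thesis using lebesgue_integral_eq_integral[OF int] by simp
qed

lemma trig_polys_periodic: "P \<in> trig_polys \<Longrightarrow> P (y + of_int n) = P y"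
proof (induction P rule: lin_comb.induct)
  case (add f g a)
  then obtain k where "g = exponential (of_int k)" by (auto elim: Ints_cases)
  then show ?case using add by (simp add: exponential_add exponential_int)
qed simp

text \<open>The inner sums are the Fourier coefficients of \<open>G\<close> on the fibre, and the outer sum is the Fourier
  inversion formula there.\<close>

lemma fibre_reconstruction:
  assumes sp: "finite_spectrum L A" and A: "A \<subseteq> {-K..K}"
    and G: "\<And>n. n \<notin> A \<Longrightarrow> G (y + of_int n) = 0" and n: "n \<in> A"
  shows "(\<Sum>l\<in>L. exponential l (y + of_int n) * ((\<Sum>k\<in>{-K..K}. G (y + of_int k) * exponential (-l) (y + of_int k)) / of_nat (card L)))
    = G (y + of_int n)"
proof -
  note L = finite_spectrumD(1-3)[OF sp]
  have m: "of_nat (card L) \<noteq> (0 :: complex)" using L n by auto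
  have e: "exponential l (y + of_int n) * exponential (-l) (y + of_int k) = exponential l (of_int (n - k))" for l k
    by (simp add: exponential_def algebra_simps flip: exp_add)
  have "(\<Sum>l\<in>L. exponential l (y + of_int n) * ((\<Sum>k\<in>{-K..K}. G (y + of_int k) * exponential (-l) (y + of_int k)) / of_nat (card L)))
    = (\<Sum>l\<in>L. exponential l (y + of_int n) * (\<Sum>k\<in>A. G (y + of_int k) * exponential (-l) (y + of_int k))) / of_nat (card L)"
  proof -
    have "(\<Sum>k\<in>{-K..K}. G (y + of_int k) * exponential (-l) (y + of_int k)) = (\<Sum>k\<in>A. G (y + of_int k) * exponential (-l) (y + of_int k))" for l
      using A G by (intro sum.mono_neutral_right) auto
    then show ?thesis by (simp only: times_divide_eq_right) (simp only: sum_divide_distrib)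
  qed
  also have "(\<Sum>l\<in>L. exponential l (y + of_int n) * (\<Sum>k\<in>A. G (y + of_int k) * exponential (-l) (y + of_int k)))
     = (\<Sum>l\<in>L. \<Sum>k\<in>A. G (y + of_int k) * exponential l (of_int (n - k)))"
    unfolding sum_distrib_left e[symmetric] by (intro sum.cong refl) simp
  also have "\<dots> = (\<Sum>k\<in>A. G (y + of_int k) * (\<Sum>l\<in>L. exponential l (of_int (n - k))))"
    unfolding sum_distrib_left by (rule sum.swap)
  also have "\<dots> = (\<Sum>k\<in>A. if k = n then G (y + of_int k) * of_nat (card L) else 0)"
    using dual_orthogonality[OF sp n] by (intro sum.cong refl) auto
  also have "\<dots> = G (y + of_int n) * of_nat (card L)" using L(2) n by simp
  finally show ?thesis using m by simp
qed

text \<open>A function on \<open>T\<close> is expanded on each fibre with respect to \<open>L\<close>. The coefficients are functions of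
  \<open>y\<close> on the unit interval, square integrable because the fibres are bounded, and they are approximated
  there by trigonometric polynomials. Orthogonality of \<open>l + k\<close> and \<open>l' + k'\<close> comes from the fibres when
  \<open>l \<noteq> l'\<close>, and from integration over \<open>y\<close> otherwise.\<close>

lemma spectral_basis_from_fibres:
  assumes T: "compact T" "interior T \<noteq> {}"
    and K: "\<And>y. 0 \<le> y \<Longrightarrow> y < 1 \<Longrightarrow> fibre T y \<subseteq> {-K..K}"
    and L: "finite L" "L \<noteq> {}"
    and fib: "AE y in lborel. 0 \<le> y \<longrightarrow> y < 1 \<longrightarrow> finite_spectrum L (fibre T y)"
  shows "L2_orthogonal_basis (lebesgue_on T) (exponential ` {l + of_int k | l k. l \<in> L})"
proof (rule L2_orthogonal_basisI[OF compact_interior_measure[OF T]])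
  note Tm = compact_interior_measure[OF T]
  have TL: "T \<inter> space lebesgue \<in> sets lebesgue" using Tm by simp
  define m where "m = card L"
  have m: "m > 0" using L by (simp add: m_def card_gt_0_iff)
  have supp: "x \<notin> T" if "\<lfloor>x\<rfloor> \<notin> {-K..K}" for x
  proof
    assume "x \<in> T"
    then have "\<lfloor>x\<rfloor> \<in> fibre T (frac x)" by (simp add: fibre_def frac_def)
    then show False using K[of "frac x"] that frac_lt_1[of x] frac_ge_0[of x] by blast
  qed
  have AEu: "AE y in unit_lebesgue. finite_spectrum L (fibre T y) \<and> fibre T y \<subseteq> {-K..K}"
  proof -
    have "AE y in lebesgue. 0 \<le> y \<longrightarrow> y < 1 \<longrightarrow> finite_spectrum L (fibre T y)"
      using fib by (rule AE_completion)
    then show ?thesis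
      unfolding AE_restrict_space_iff[of "{0..<1::real}" lebesgue, simplified]
    proof (eventually_elim, intro impI)
      fix y :: real assume *: "0 \<le> y \<longrightarrow> y < 1 \<longrightarrow> finite_spectrum L (fibre T y)" and y: "0 \<le> y \<and> y < 1"
      then show "finite_spectrum L (fibre T y) \<and> fibre T y \<subseteq> {-K..K}" using K by blast
    qed
  qed
  have fsum: "(\<Sum>n\<in>{-K..K}. indicator T (y + of_int n) *\<^sub>R f n) = (\<Sum>n\<in>fibre T y. f n)"
    if "fibre T y \<subseteq> {-K..K}" for y and f :: "int \<Rightarrow> 'x::real_normed_vector"
  proof -
    have "(\<Sum>n\<in>{-K..K}. indicator T (y + of_int n) *\<^sub>R f n) = (\<Sum>n\<in>fibre T y. indicator T (y + of_int n) *\<^sub>R f n)"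
      using that by (intro sum.mono_neutral_right) (auto simp: fibre_def)
    also have "\<dots> = (\<Sum>n\<in>fibre T y. f n)" by (intro sum.cong) (auto simp: fibre_def)
    finally show ?thesis .
  qed
  show "(\<integral>x. exponential (r - r') x \<partial>lebesgue_on T) = 0"
    if rr: "r \<in> {l + of_int k | l k. l \<in> L}" "r' \<in> {l + of_int k | l k. l \<in> L}" "exponential r \<noteq> exponential r'" for r r'
  proof -
    obtain l k l' k' where r: "l \<in> L" "r = l + of_int k" "l' \<in> L" "r' = l' + of_int k'" using rr by blast
    have iF: "integrable lebesgue (\<lambda>x. indicator T x *\<^sub>R exponential (r - r') x)"
    proof -
      have "T \<in> lmeasurable" using T(1) by (rule lmeasurable_compact)
      then interpret finite_measure "lebesgue_on T" by (rule finite_measure_lebesgue_on)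
      have "integrable (lebesgue_on T) (exponential (r - r'))" by (rule integrable_const_bound[of _ 1]) auto
      then show ?thesis by (simp only: integrable_restrict_space[OF TL])
    qed
    have "(\<integral>x. exponential (r - r') x \<partial>lebesgue_on T) = (\<integral>x. indicator T x *\<^sub>R exponential (r - r') x \<partial>lebesgue)"
      by (rule integral_restrict_space[OF TL])
    also have "\<dots> = (\<integral>y. (\<Sum>n\<in>{-K..K}. indicator T (y + of_int n) *\<^sub>R exponential (r - r') (y + of_int n)) \<partial>unit_lebesgue)"
      by (rule integral_unfold(2)[OF iF]) (use supp in auto)
    also have "\<dots> = (\<integral>y. exponential (r - r') y * (if l = l' then of_nat m else 0) \<partial>unit_lebesgue)"
    proof (rule integral_cong_AE)
      show "(\<lambda>y. \<Sum>n\<in>{-K..K}. indicator T (y + of_int n) *\<^sub>R exponential (r - r') (y + of_int n)) \<in> borel_measurable unit_lebesgue"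
        by (rule borel_measurable_integrable[OF integral_unfold(1)[OF iF]]) (use supp in auto)
      show "AE y in unit_lebesgue. (\<Sum>n\<in>{-K..K}. indicator T (y + of_int n) *\<^sub>R exponential (r - r') (y + of_int n)) = exponential (r - r') y * (if l = l' then of_nat m else 0)"
        using AEu
      proof eventually_elim
        case (elim y)
        have "exponential (r - r') (of_int n) = exponential (l - l') (of_int n)" for n :: int
        proof -
          have "r - r' = (l - l') + of_int (k - k')" using r by simp
          then show ?thesis by (simp only: exponential_add_left exponential_int mult_1_right)
        qed
        then have sm: "(\<Sum>n\<in>fibre T y. exponential (r - r') (of_int n)) = (if l = l' then of_nat m else 0)"
          using elim r by (auto simp: m_def exponential_zero finite_spectrum_def)
        have "(\<Sum>n\<in>{-K..K}. indicator T (y + of_int n) *\<^sub>R exponential (r - r') (y + of_int n))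
            = (\<Sum>n\<in>fibre T y. exponential (r - r') (y + of_int n))"
          using elim by (intro fsum) simp
        also have "\<dots> = exponential (r - r') y * (\<Sum>n\<in>fibre T y. exponential (r - r') (of_int n))"
          by (simp add: exponential_add sum_distrib_left)
        finally show ?case unfolding sm .
      qed
    qed simp
    also have "\<dots> = 0"
    proof (cases "l = l'")
      case True
      have "k \<noteq> k'" using rr(3) r True by auto
      then show ?thesis using integral_exponential_unit[of "k - k'"] True r by simp
    qed simp
    finally show ?thesis .
  qed
  fix g and \<epsilon> :: real assume g: "g \<in> L2_space (lebesgue_on T)" and e: "\<epsilon> > 0"
  define G where "G x = (if x \<in> T then g x else 0)" for x
  have Gm: "G \<in> borel_measurable lebesgue"
    using g Tm unfolding G_def L2_space_def by (intro borel_measurable_if_I) auto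
  have G2: "integrable lebesgue (\<lambda>x. (cmod (G x))\<^sup>2)"
  proof -
    have "integrable lebesgue (\<lambda>x. indicator T x *\<^sub>R (cmod (g x))\<^sup>2)"
      using g unfolding L2_space_def integrable_restrict_space[OF TL, symmetric] by simp
    moreover have "indicator T x *\<^sub>R (cmod (g x))\<^sup>2 = (cmod (G x))\<^sup>2" for x by (simp add: G_def)
    ultimately show ?thesis by simp
  qed
  have shm: "(\<lambda>y. G (y + of_int n)) \<in> borel_measurable lebesgue" for n :: int
  proof -
    have "(\<lambda>y. of_int n + y) \<in> lebesgue \<rightarrow>\<^sub>M (lebesgue :: real measure)"
      using lebesgue_affine_measurable[of "\<lambda>_::real. 1" "of_int n"] by simp
    from measurable_compose[OF this Gm] show ?thesis by (simp add: add.commute)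
  qed
  have em: "(\<lambda>y. exponential l (y + of_int n)) \<in> borel_measurable lebesgue" for l and n :: int
    unfolding exponential_def by (intro continuous_measurable_lebesgue continuous_intros)
  define c where "c l y = (\<Sum>k\<in>{-K..K}. G (y + of_int k) * exponential (-l) (y + of_int k)) / of_nat (card L)" for l y
  have cm: "c l \<in> borel_measurable lebesgue" for l
    unfolding c_def by (intro borel_measurable_divide borel_measurable_sum borel_measurable_times shm em) simp
  have c2: "integrable unit_lebesgue (\<lambda>y. (cmod (c l y))\<^sup>2)" for l
  proof (rule Bochner_Integration.integrable_bound)
    have "integrable unit_lebesgue (\<lambda>y. \<Sum>k\<in>{-K..K}. (cmod (G (y + of_int k)))\<^sup>2)"
      by (rule integral_unfold(1)[OF G2]) (use supp in \<open>auto simp: G_def\<close>)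
    then show "integrable unit_lebesgue (\<lambda>y. (\<Sum>k\<in>{-K..K}. (cmod (G (y + of_int k)))\<^sup>2) * card {-K..K})" by simp
    show "AE y in unit_lebesgue. norm ((cmod (c l y))\<^sup>2) \<le> norm ((\<Sum>k\<in>{-K..K}. (cmod (G (y + of_int k)))\<^sup>2) * card {-K..K})"
    proof (rule AE_I2)
      fix y
      have "cmod (c l y) = cmod (\<Sum>k\<in>{-K..K}. G (y + of_int k) * exponential (-l) (y + of_int k)) / real m"
        by (simp add: c_def norm_divide m_def)
      also have "\<dots> \<le> cmod (\<Sum>k\<in>{-K..K}. G (y + of_int k) * exponential (-l) (y + of_int k)) / 1"
        using m by (intro divide_left_mono) auto
      also have "\<dots> \<le> (\<Sum>k\<in>{-K..K}. cmod (G (y + of_int k)))"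
        by (auto intro!: sum_norm_le simp: norm_mult)
      finally have "(cmod (c l y))\<^sup>2 \<le> (\<Sum>k\<in>{-K..K}. cmod (G (y + of_int k)))\<^sup>2" by (intro power_mono) auto
      also have "\<dots> \<le> (\<Sum>k\<in>{-K..K}. (cmod (G (y + of_int k)))\<^sup>2) * card {-K..K}"
        by (rule sum_squared_le_sum_of_squares)
      finally show "norm ((cmod (c l y))\<^sup>2) \<le> norm ((\<Sum>k\<in>{-K..K}. (cmod (G (y + of_int k)))\<^sup>2) * card {-K..K})" 
        by (simp only: real_norm_def abs_of_nonneg zero_le_power2)
    qed
    show "(\<lambda>y. (cmod (c l y))\<^sup>2) \<in> borel_measurable unit_lebesgue"
      using measurable_restrict_space1[OF cm] by measurable
  qed
  \<comment> \<open>One factor \<open>m\<close> each for the Cauchy-Schwarz inequality, the points of the fibre, and the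
    frequencies.\<close>
  define \<delta> where "\<delta> = \<epsilon> / real m ^ 3"
  have d: "\<delta> > 0" using e m by (simp add: \<delta>_def)
  have "\<forall>l. \<exists>P. P \<in> trig_polys \<and> integrable unit_lebesgue (\<lambda>x. (cmod (c l x - P x))\<^sup>2) \<and> (\<integral>x. (cmod (c l x - P x))\<^sup>2 \<partial>unit_lebesgue) < \<delta>"
    using trig_polys_L2_dense[OF cm c2 d] by blast
  from choice[OF this] obtain P where P': "\<forall>l. P l \<in> trig_polys \<and> integrable unit_lebesgue (\<lambda>x. (cmod (c l x - P l x))\<^sup>2)
    \<and> (\<integral>x. (cmod (c l x - P l x))\<^sup>2 \<partial>unit_lebesgue) < \<delta>" ..
  have P: "P l \<in> trig_polys" "integrable unit_lebesgue (\<lambda>x. (cmod (c l x - P l x))\<^sup>2)"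
    "(\<integral>x. (cmod (c l x - P l x))\<^sup>2 \<partial>unit_lebesgue) < \<delta>" for l
    using P'[THEN spec, of l, THEN conjunct1] P'[THEN spec, of l, THEN conjunct2, THEN conjunct1]
      P'[THEN spec, of l, THEN conjunct2, THEN conjunct2] .
  define h where "h x = (\<Sum>l\<in>L. exponential l x * P l x)" for x
  have hE: "h \<in> lin_comb (exponential ` {l + of_int k | l k. l \<in> L})"
  proof -
    have "(\<lambda>x. exponential l x * P l x) \<in> lin_comb (exponential ` {l + of_int k | l k. l \<in> L})" if "l \<in> L" for l
    proof (rule lin_comb_mult[OF lin_comb_base P(1)])
      show "exponential l \<in> {exponential l}" by simp
      fix u v assume "u \<in> {exponential l}" "v \<in> exponential ` \<int>"
      then obtain k :: int where "u = exponential l" "v = exponential (of_int k)" by (auto elim: Ints_cases)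
      then show "(\<lambda>x. u x * v x) \<in> exponential ` {l + of_int k | l k. l \<in> L}"
        using that by (auto simp: exponential_mult)
    qed
    then have "(\<lambda>x. \<Sum>l\<in>L. exponential l x * P l x) \<in> lin_comb (exponential ` {l + of_int k | l k. l \<in> L})" by (rule lin_comb_sum)
    then show ?thesis unfolding h_def .
  qed
  define F where "F = (\<lambda>x. indicator T x *\<^sub>R (cmod (G x - h x))\<^sup>2)"
  have "(\<integral>x. (cmod (g x - h x))\<^sup>2 \<partial>lebesgue_on T) = (\<integral>x. indicator T x *\<^sub>R (cmod (g x - h x))\<^sup>2 \<partial>lebesgue)"
    by (rule integral_restrict_space[OF TL])
  also have "\<dots> = (\<integral>x. F x \<partial>lebesgue)"
    by (rule Bochner_Integration.integral_cong) (auto simp: F_def G_def indicator_def)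
  also have "\<dots> < \<epsilon>"
  \<comment> \<open>If \<open>F\<close> were not integrable, its integral would be 0 by convention.\<close>
  proof (cases "integrable lebesgue F")
    case False
    then show ?thesis using e by (simp add: not_integrable_integral_eq)
  next
    case True
    have s0: "F x = 0" if "\<lfloor>x\<rfloor> \<notin> {-K..K}" for x using supp[OF that] by (simp add: F_def)
    define R where "R y = (real m)\<^sup>2 * (\<Sum>l\<in>L. (cmod (c l y - P l y))\<^sup>2)" for y
    have iR: "integrable unit_lebesgue R" unfolding R_def using P(2) by simp
    have "(\<integral>x. F x \<partial>lebesgue) = (\<integral>y. (\<Sum>n\<in>{-K..K}. F (y + of_int n)) \<partial>unit_lebesgue)"
      by (rule integral_unfold(2)[OF True s0])
    also have "\<dots> \<le> (\<integral>y. R y \<partial>unit_lebesgue)"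
    proof (rule integral_mono_AE[OF integral_unfold(1)[OF True s0] iR])
      show "AE y in unit_lebesgue. (\<Sum>n\<in>{-K..K}. F (y + of_int n)) \<le> R y"
        using AEu
      proof eventually_elim
        case (elim y)
        have bd: "(cmod (G (y + of_int n) - h (y + of_int n)))\<^sup>2 \<le> (\<Sum>l\<in>L. (cmod (c l y - P l y))\<^sup>2) * real m" if n: "n \<in> fibre T y" for n
        proof -
          have "G (y + of_int n) = (\<Sum>l\<in>L. exponential l (y + of_int n) * c l y)"
            unfolding c_def using elim n
            by (intro fibre_reconstruction[symmetric, of L "fibre T y"]) (auto simp: G_def fibre_def)
          then have "G (y + of_int n) - h (y + of_int n) = (\<Sum>l\<in>L. exponential l (y + of_int n) * (c l y - P l y))"
            by (simp add: h_def trig_polys_periodic[OF P(1)] algebra_simps sum_subtractf)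
          also have "cmod \<dots> \<le> (\<Sum>l\<in>L. cmod (c l y - P l y))"
            by (rule sum_norm_le) (simp add: norm_mult)
          finally have "(cmod (G (y + of_int n) - h (y + of_int n)))\<^sup>2 \<le> (\<Sum>l\<in>L. cmod (c l y - P l y))\<^sup>2" by (intro power_mono) auto
          also have "\<dots> \<le> (\<Sum>l\<in>L. (cmod (c l y - P l y))\<^sup>2) * real m"
            unfolding m_def by (rule sum_squared_le_sum_of_squares)
          finally show ?thesis .
        qed
        have "(\<Sum>n\<in>{-K..K}. F (y + of_int n)) = (\<Sum>n\<in>fibre T y. (cmod (G (y + of_int n) - h (y + of_int n)))\<^sup>2)"
          unfolding F_def using elim by (intro fsum) simp
        also have "\<dots> \<le> (\<Sum>n\<in>fibre T y. (\<Sum>l\<in>L. (cmod (c l y - P l y))\<^sup>2) * real m)"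
          by (rule sum_mono) (rule bd)
        also have "\<dots> = R y" using elim by (simp add: R_def m_def power2_eq_square finite_spectrum_def)
        finally show ?case .
      qed
    qed
    also have "\<dots> = (real m)\<^sup>2 * (\<Sum>l\<in>L. \<integral>y. (cmod (c l y - P l y))\<^sup>2 \<partial>unit_lebesgue)"
      unfolding R_def using P(2) by simp
    also have "\<dots> < (real m)\<^sup>2 * (\<Sum>l\<in>L. \<delta>)"
      using P(3) L m by (intro mult_strict_left_mono sum_strict_mono) auto
    also have "\<dots> = \<epsilon>" using m by (simp add: \<delta>_def m_def[symmetric] power2_eq_square power3_eq_cube)
    finally show ?thesis .
  qed
  finally show "\<exists>h\<in>lin_comb (exponential ` {l + of_int k | l k. l \<in> L}). (\<integral>x. (cmod (g x - h x))\<^sup>2 \<partial>lebesgue_on T) < \<epsilon>"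
    using hE by blast
qed

lemma AE_unit_ex:
  assumes "AE y in lborel. 0 \<le> y \<longrightarrow> y < (1::real) \<longrightarrow> P y"
  shows "\<exists>y. 0 \<le> y \<and> y < 1 \<and> P y"
proof (rule ccontr)
  assume *: "\<not> ?thesis"
  have "AE y in lborel. y \<notin> {0..<1::real}" using assms by (rule AE_mp) (use * in \<open>auto intro!: AE_I2\<close>)
  then have "{0..<1::real} \<in> null_sets lborel" by (simp add: AE_iff_null_sets)
  then show False by (simp add: null_sets_def)
qed

section \<open>Self-similar tiles with at most two prime factors\<close>

text \<open>The complement common to the fibres fixes their cardinality, which its iterated substitutions show to
  have no prime factors besides \<open>p\<close> and \<open>q\<close>, and it then fixes their spectrum.\<close>

lemma fibres_common_spectrum:
  assumes b: "b \<ge> 2" and D: "finite D" "card D = b" "primitive_digits D"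
    and T: "is_attractor b D T" "interior T \<noteq> {}"
    and pq: "prime p" "prime q" "p \<noteq> q" "\<And>r. prime r \<Longrightarrow> r dvd b \<Longrightarrow> r = p \<or> r = q"
  shows "\<exists>K L. (\<forall>y. 0 \<le> y \<longrightarrow> y < 1 \<longrightarrow> fibre T y \<subseteq> {-K..K}) \<and> finite L \<and> L \<noteq> {} \<and>
    (AE y in lborel. 0 \<le> y \<longrightarrow> y < 1 \<longrightarrow> finite_spectrum L (fibre T y))"
proof -
  obtain a where a: "\<And>x. x \<in> T \<Longrightarrow> \<bar>x\<bar> \<le> a" using T(1) compact_imp_bounded[of T] by (auto simp: bounded_iff is_attractor_def)
  define K where "K = max 0 \<lceil>a\<rceil> + 1"
  have K0: "K \<ge> 0" by (simp add: K_def)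
  have K: "fibre T y \<subseteq> {-K..K}" if "0 \<le> y" "y < 1" for y
  proof
    fix n assume "n \<in> fibre T y"
    then have "\<bar>y + of_int n\<bar> \<le> a" using a by (simp add: fibre_def)
    then have "\<bar>real_of_int n\<bar> < a + 1" using that by linarith
    also have "a + 1 \<le> of_int K" unfolding K_def by linarith
    finally have "\<bar>n\<bar> < K" by linarith
    then show "n \<in> {-K..K}" by auto
  qed
  obtain N B where NB: "AE y in lborel. 0 \<le> y \<longrightarrow> y < 1 \<longrightarrow> tiles N (fibre T y) B"
    using fibres_tile[OF b D(1,2) T K0 K] by blast
  define Bs where "Bs = rec_nat B (\<lambda>_ B. (\<lambda>(d, x). d + int b * x) ` (D \<times> B))"
  have Bs0: "Bs 0 = B" and BsS: "Bs (Suc n) = (\<lambda>(d, x). d + int b * x) ` (D \<times> Bs n)" for n by (simp_all add: Bs_def)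
  have "AE y in lborel. 0 \<le> y \<longrightarrow> y < 1 \<longrightarrow> tiles (b ^ n * N) (fibre T y) (Bs n)" for n
  proof (induction n)
    case 0 then show ?case using NB by (simp add: Bs0)
  next
    case (Suc n)
    from fibres_tile_substitution[OF b D(1,2) T(1) K Suc] show ?case by (simp add: BsS mult.assoc)
  qed
  then have "AE y in lborel. \<forall>n. 0 \<le> y \<longrightarrow> y < 1 \<longrightarrow> tiles (b ^ n * N) (fibre T y) (Bs n)"
    by (subst AE_all_countable) blast
  then have all: "AE y in lborel. 0 \<le> y \<longrightarrow> y < 1 \<longrightarrow> (\<forall>n. tiles (b ^ n * N) (fibre T y) (Bs n))"
    by eventually_elim blast
  obtain y0 where y0: "0 \<le> y0" "y0 < 1" "\<And>n. tiles (b ^ n * N) (fibre T y0) (Bs n)" using AE_unit_ex[OF all] by blast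
  define m where "m = card (fibre T y0)"
  have t0: "tiles N (fibre T y0) B" using y0(3)[of 0] by (simp add: Bs0)
  have card: "card (fibre T y) = m" if "tiles N (fibre T y) B" for y
  proof -
    have "card (fibre T y) * card B = m * card B" using tiles_card[OF that] tiles_card[OF t0] by (simp add: m_def)
    moreover have "card B > 0" using tiles_finite[OF t0] tiles_nonempty[OF t0] by (simp add: card_gt_0_iff)
    ultimately show ?thesis by simp
  qed
  have mpq: "r = p \<or> r = q" if r: "prime r" "r dvd m" for r
  proof (rule ccontr)
    assume "\<not> ?thesis"
    then have "\<not> r dvd b" using pq(4) r by blast
    then have "\<not> r dvd card (fibre T y0)"
      using b by (intro tiles_card_coprime[OF D(1,3,2) _ K[OF y0(1,2)] y0(3) BsS r(1)]) auto
    then show False using r by (simp add: m_def)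
  qed
  obtain L where L: "\<And>A. card A = m \<Longrightarrow> tiles N A B \<Longrightarrow> finite_spectrum L A"
    using common_spectrum[OF pq(1-3) tiles_pos[OF t0] mpq, where B = B] by blast
  have fL: "finite L" "card L = m" using finite_spectrumD(1,3)[OF L[OF card[OF t0] t0]] card[OF t0] by simp_all
  have "m > 0" using tiles_finite[OF t0] tiles_nonempty[OF t0] by (simp add: m_def card_gt_0_iff)
  then have "L \<noteq> {}" using fL by auto
  moreover have "AE y in lborel. 0 \<le> y \<longrightarrow> y < 1 \<longrightarrow> finite_spectrum L (fibre T y)"
    using NB
  proof (eventually_elim, intro impI)
    fix y :: real assume "0 \<le> y \<longrightarrow> y < 1 \<longrightarrow> tiles N (fibre T y) B" "0 \<le> y" "y < 1"
    then have "tiles N (fibre T y) B" by blast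
    from L[OF card[OF this] this] show "finite_spectrum L (fibre T y)" .
  qed
  ultimately show ?thesis using fL(1) K by blast
qed

lemma integral_affine_image:
  fixes f :: "real \<Rightarrow> 'b::euclidean_space"
  assumes S: "S \<in> sets lebesgue" and T: "(\<lambda>x. c + s * x) ` S \<in> sets lebesgue" and s: "s > 0"
  shows "integrable (lebesgue_on ((\<lambda>x. c + s * x) ` S)) f \<longleftrightarrow> integrable (lebesgue_on S) (\<lambda>x. f (c + s * x))"
    and "(\<integral>x. f x \<partial>lebesgue_on ((\<lambda>x. c + s * x) ` S)) = s *\<^sub>R (\<integral>x. f (c + s * x) \<partial>lebesgue_on S)"
proof -
  let ?T = "(\<lambda>x. c + s * x) ` S"
  have SL: "S \<inter> space lebesgue \<in> sets lebesgue" "?T \<inter> space lebesgue \<in> sets lebesgue" using S T by simp_all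
  have ind: "indicator ?T (c + s * x) = (indicator S x :: real)" for x
    using s by (auto simp: indicator_def)
  show "integrable (lebesgue_on ?T) f \<longleftrightarrow> integrable (lebesgue_on S) (\<lambda>x. f (c + s * x))"
    unfolding integrable_restrict_space[OF SL(1)] integrable_restrict_space[OF SL(2)]
    using lebesgue_integrable_real_affine_iff[of s "\<lambda>x. indicator ?T x *\<^sub>R f x" c] s by (simp add: ind)
  show "(\<integral>x. f x \<partial>lebesgue_on ?T) = s *\<^sub>R (\<integral>x. f (c + s * x) \<partial>lebesgue_on S)"
    unfolding integral_restrict_space[OF SL(1)] integral_restrict_space[OF SL(2)]
    using lebesgue_integral_real_affine[of s "\<lambda>x. indicator ?T x *\<^sub>R f x" c] s by (simp add: ind)
qed

lemma exponential_affine: "s \<noteq> 0 \<Longrightarrow> exponential (l / s) (c + s * x) = exponential (l / s) c * exponential l x"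
  by (simp add: exponential_add exponential_scale)

lemma L2_orthogonal_basis_affine:
  assumes S: "compact S" "interior S \<noteq> {}" and s: "s > 0"
    and T: "compact ((\<lambda>x. c + s * x) ` S)" "interior ((\<lambda>x. c + s * x) ` S) \<noteq> {}"
    and basis: "L2_orthogonal_basis (lebesgue_on S) (exponential ` \<Lambda>)"
  shows "L2_orthogonal_basis (lebesgue_on ((\<lambda>x. c + s * x) ` S)) (exponential ` (\<lambda>l. l / s) ` \<Lambda>)"
proof (rule L2_orthogonal_basisI[OF compact_interior_measure[OF T]])
  note mS = compact_interior_measure(1)[OF S] and mT = compact_interior_measure(1)[OF T]
  let ?T = "(\<lambda>x. c + s * x) ` S"
  show "(\<integral>x. exponential (r - r') x \<partial>lebesgue_on ?T) = 0"
    if rr: "r \<in> (\<lambda>l. l / s) ` \<Lambda>" "r' \<in> (\<lambda>l. l / s) ` \<Lambda>" "exponential r \<noteq> exponential r'" for r r'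
  proof -
    obtain l l' where l: "l \<in> \<Lambda>" "l' \<in> \<Lambda>" "r = l / s" "r' = l' / s" using rr by blast
    have "exponential l \<noteq> exponential l'"
    proof
      assume eq: "exponential l = exponential l'"
      have "exponential r x = exponential r' x" for x
        using fun_cong[OF eq, of "x / s"] l by (simp add: exponential_def)
      then show False using rr(3) by blast
    qed
    then have "L2_inner (lebesgue_on S) (exponential l) (exponential l') = 0"
      using basis l unfolding L2_orthogonal_basis_def pairwise_def by blast
    then have "(\<integral>x. exponential (l - l') x \<partial>lebesgue_on S) = 0"
      unfolding L2_inner_def cnj_exponential by (simp add: exponential_add_left[symmetric])
    moreover have "exponential (r - r') (c + s * x) = exponential (r - r') c * exponential (l - l') x" for x
      using s l exponential_affine[of s "l - l'" c x] by (simp add: diff_divide_distrib)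
    ultimately show ?thesis unfolding integral_affine_image(2)[OF mS mT s] by simp
  qed
  fix g and \<epsilon> :: real assume g: "g \<in> L2_space (lebesgue_on ?T)" and e: "\<epsilon> > 0"
  define f where "f x = g (c + s * x)" for x
  have "f \<in> L2_space (lebesgue_on S)"
    unfolding L2_space_def
  proof (intro CollectI conjI)
    show "integrable (lebesgue_on S) (\<lambda>x. (cmod (f x))\<^sup>2)"
      using g integral_affine_image(1)[OF mS mT s, of "\<lambda>x. (cmod (g x))\<^sup>2"] by (simp add: L2_space_def f_def)
    have "(\<lambda>x. if x \<in> ?T then g x else 0) \<in> borel_measurable lebesgue"
      using g mT by (intro borel_measurable_if_I) (auto simp: L2_space_def)
    moreover have "(\<lambda>x. c + s * x) \<in> lebesgue \<rightarrow>\<^sub>M lebesgue"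
      using lebesgue_affine_measurable[of "\<lambda>_::real. s" c] s by simp
    ultimately have "(\<lambda>x. if c + s * x \<in> ?T then g (c + s * x) else 0) \<in> borel_measurable lebesgue"
      by (rule measurable_compose[rotated])
    moreover have "c + s * x \<in> ?T \<longleftrightarrow> x \<in> S" for x using s by auto
    ultimately have "(\<lambda>x. if x \<in> S then f x else 0) \<in> borel_measurable lebesgue" by (simp add: f_def cong: if_cong)
    then show "f \<in> borel_measurable (lebesgue_on S)" by (rule borel_measurable_if_D)
  qed
  moreover define \<delta> where "\<delta> = sqrt (\<epsilon> / s)"
  have d: "\<delta> > 0" "\<delta>\<^sup>2 = \<epsilon> / s" using e s by (auto simp: \<delta>_def)
  ultimately obtain F a where F: "finite F" "F \<subseteq> exponential ` \<Lambda>" "L2_norm (lebesgue_on S) (\<lambda>x. f x - (\<Sum>\<phi>\<in>F. a \<phi> * \<phi> x)) < \<delta>"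
    using basis unfolding L2_orthogonal_basis_def by blast
  have n: "(\<integral>x. (cmod (f x - (\<Sum>\<phi>\<in>F. a \<phi> * \<phi> x)))\<^sup>2 \<partial>lebesgue_on S) < \<epsilon> / s"
  proof -
    have "(L2_norm (lebesgue_on S) (\<lambda>x. f x - (\<Sum>\<phi>\<in>F. a \<phi> * \<phi> x)))\<^sup>2 < \<delta>\<^sup>2"
      using F(3) by (intro power_strict_mono) (auto simp: L2_norm_def)
    then show ?thesis unfolding d(2) L2_norm_def by simp
  qed
  define h where "h x = (\<Sum>\<phi>\<in>F. a \<phi> * \<phi> ((x - c) / s))" for x
  have "h \<in> lin_comb (exponential ` (\<lambda>l. l / s) ` \<Lambda>)"
  proof -
    have "(\<lambda>x. a \<phi> * \<phi> ((x - c) / s)) \<in> lin_comb (exponential ` (\<lambda>l. l / s) ` \<Lambda>)" if phi: "\<phi> \<in> F" for \<phi>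
    proof -
      obtain l where l: "l \<in> \<Lambda>" "\<phi> = exponential l" using F(2) phi by blast
      have "\<phi> ((x - c) / s) = exponential (l / s) (- c) * exponential (l / s) x" for x
        unfolding l by (simp add: exponential_def algebra_simps diff_divide_distrib flip: exp_add)
      moreover have "(\<lambda>x. a \<phi> * (exponential (l / s) (- c) * exponential (l / s) x)) \<in> lin_comb (exponential ` (\<lambda>l. l / s) ` \<Lambda>)"
        using l by (intro lin_comb_scale lin_comb_base) auto
      ultimately show ?thesis by simp
    qed
    then have "(\<lambda>x. \<Sum>\<phi>\<in>F. a \<phi> * \<phi> ((x - c) / s)) \<in> lin_comb (exponential ` (\<lambda>l. l / s) ` \<Lambda>)" by (rule lin_comb_sum)
    then show ?thesis unfolding h_def .
  qed
  moreover have "(\<integral>x. (cmod (g x - h x))\<^sup>2 \<partial>lebesgue_on ?T) < \<epsilon>"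
  proof -
    have "(\<integral>x. (cmod (g x - h x))\<^sup>2 \<partial>lebesgue_on ?T) = s * (\<integral>x. (cmod (f x - (\<Sum>\<phi>\<in>F. a \<phi> * \<phi> x)))\<^sup>2 \<partial>lebesgue_on S)"
      unfolding integral_affine_image(2)[OF mS mT s] using s by (simp add: f_def h_def)
    also have "\<dots> < s * (\<epsilon> / s)" using n s by (intro mult_strict_left_mono)
    finally show ?thesis using s by simp
  qed
  ultimately show "\<exists>h\<in>lin_comb (exponential ` (\<lambda>l. l / s) ` \<Lambda>). (\<integral>x. (cmod (g x - h x))\<^sup>2 \<partial>lebesgue_on ?T) < \<epsilon>" by blast
qed

text \<open>Subtracting a digit and dividing by the greatest common divisor \<open>g\<close> of the differences changes the
  attractor by an affine map only.\<close>

lemma normalize_digits: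
  assumes D: "finite D" "card D \<ge> 2"
  shows "\<exists>d0 g D0. g > 0 \<and> D = (\<lambda>e. d0 + g * e) ` D0 \<and> finite D0 \<and> card D0 = card D \<and> primitive_digits D0"
proof -
  obtain d0 where d0: "d0 \<in> D" using D by fastforce
  define g where "g = Gcd ((\<lambda>d. d - d0) ` D)"
  have "\<not> D \<subseteq> {d0}" using D card_mono[of "{d0}" D] by auto
  then obtain d1 where "d1 \<in> D" "d1 \<noteq> d0" by blast
  then have "g \<noteq> 0" by (auto simp: g_def Gcd_0_iff)
  moreover have "g \<ge> 0" by (simp add: g_def)
  ultimately have g: "g > 0" by simp
  define D0 where "D0 = (\<lambda>d. (d - d0) div g) ` D"
  have dv: "g dvd d - d0" if "d \<in> D" for d unfolding g_def using that by (intro Gcd_dvd) auto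
  have rec: "d0 + g * ((d - d0) div g) = d" if "d \<in> D" for d using dv[OF that] by simp
  have D_eq: "D = (\<lambda>e. d0 + g * e) ` D0" unfolding D0_def image_image using rec by (simp cong: image_cong)
  have inj: "inj_on (\<lambda>d. (d - d0) div g) D" by (rule inj_onI) (metis rec)
  have prim: "primitive_digits D0"
    unfolding primitive_digits_def
  proof (intro conjI allI impI)
    show "0 \<in> D0" unfolding D0_def using d0 by (intro image_eqI[of _ _ d0]) auto
    fix M :: nat assume M: "M > 1"
    show "\<exists>d\<in>D0. \<not> int M dvd d"
    proof (rule ccontr)
      assume "\<not> ?thesis"
      then have all: "\<And>d. d \<in> D0 \<Longrightarrow> int M dvd d" by blast
      have "g * int M dvd g"
        unfolding g_def
      proof (rule Gcd_greatest)
        fix z assume "z \<in> (\<lambda>d. d - d0) ` D"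
        then obtain d where d: "d \<in> D" "z = d - d0" by blast
        have "int M dvd (d - d0) div g" using d all by (auto simp: D0_def)
        then have "g * int M dvd g * ((d - d0) div g)" by (rule mult_dvd_mono[OF dvd_refl])
        then show "Gcd ((\<lambda>d. d - d0) ` D) * int M dvd z" using rec[OF d(1)] d(2) unfolding g_def by (metis add_diff_cancel_left')
      qed
      then have "g * int M \<le> g" using g by (intro zdvd_imp_le)
      moreover have "g * 1 < g * int M" using g M by (intro mult_strict_left_mono) auto
      ultimately show False by simp
    qed
  qed
  show ?thesis using g D_eq D(1) prim card_image[OF inj] by (intro exI[of _ d0] exI[of _ g] exI[of _ D0]) (auto simp: D0_def)
qed

lemma two_primes_cover:
  assumes "prime p" "prime q"
  shows "\<exists>p' q'. prime p' \<and> prime q' \<and> p' \<noteq> q' \<and> (\<forall>r::nat. prime r \<longrightarrow> r dvd p ^ \<alpha> * q ^ \<beta> \<longrightarrow> r = p' \<or> r = q')"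
proof -
  have *: "r = p \<or> r = q" if "prime r" "r dvd p ^ \<alpha> * q ^ \<beta>" for r
  proof -
    have "r dvd p \<or> r dvd q" using that by (meson prime_dvd_mult_iff prime_dvd_power)
    then show ?thesis using that assms primes_dvd_imp_eq by blast
  qed
  show ?thesis
  proof (cases "p = q")
    case False then show ?thesis using assms * by blast
  next
    case True
    obtain q' where "prime q'" "q' > p" using bigger_prime by blast
    then show ?thesis using assms * True by (intro exI[of _ p] exI[of _ q']) auto
  qed
qed

theorem corollary1p9:
  fixes b p q \<alpha> \<beta> :: nat and D :: "int set"
  assumes "b \<ge> 2"
    and "prime p" and "prime q" and "b = p ^ \<alpha> * q ^ \<beta>"
    and "card D = b"
    and "self_similar_tile b D"
  shows "spectral_set (attractor b D)"
proof -
  define T where "T = attractor b D"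
  have "is_attractor b D T" unfolding T_def attractor_def
    by (rule theI'[OF ex1_is_attractor[OF assms(1,5)]])
  then have T: "compact T" "T = (\<Union>d\<in>D. (\<lambda>x. inverse (real b) * (x + of_int d)) ` T)"
    unfolding is_attractor_def by blast+
  have int: "interior T \<noteq> {}" using assms(6) unfolding self_similar_tile_def T_def .
  have finD: "finite D" using assms(1,5) by (intro card_ge_0_finite) simp
  obtain d0 g D0 where D0: "g > 0" "D = (\<lambda>e. d0 + g * e) ` D0" "finite D0" "card D0 = b" "primitive_digits D0"
    using normalize_digits[OF finD] assms(1,5) by auto
  obtain p' q' where pq: "prime p'" "prime q'" "p' \<noteq> q'" "\<And>r. prime r \<Longrightarrow> r dvd b \<Longrightarrow> r = p' \<or> r = q'"
    using two_primes_cover[OF assms(2,3)] assms(4) by blast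
  \<comment> \<open>The fixed point of \<open>x \<mapsto> (x + d0) / b\<close>, so that \<open>T = c + s S\<close> turns the equation for \<open>T\<close> with the
    digits \<open>d0 + g e\<close> into the equation for \<open>S\<close> with the digits \<open>e\<close>.\<close>
  define c where "c = of_int d0 / (real b - 1)"
  define s where "s = real_of_int g"
  have s: "s > 0" using D0(1) by (simp add: s_def)
  have b1: "real b > 1" using assms(1) by simp
  define S where "S = (\<lambda>x. (x - c) / s) ` T"
  have TS: "T = (\<lambda>x. c + s * x) ` S" unfolding S_def image_image using s by simp
  have memS: "x \<in> S \<longleftrightarrow> c + s * x \<in> T" for x unfolding TS using s by auto
  have cS: "compact S" unfolding S_def using T(1) s by (intro compact_continuous_image continuous_intros) auto
  have iS: "interior S \<noteq> {}"
  proof -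
    have "open ((\<lambda>x. c + s * x) -` interior T)" by (intro open_vimage continuous_intros) auto
    moreover have "(\<lambda>x. c + s * x) -` interior T \<subseteq> S" using memS interior_subset[of T] by auto
    ultimately have sub: "(\<lambda>x. c + s * x) -` interior T \<subseteq> interior S" by (intro interior_maximal)
    obtain t where "t \<in> interior T" using int by blast
    then have "(t - c) / s \<in> (\<lambda>x. c + s * x) -` interior T" using s by simp
    then show ?thesis using sub by blast
  qed
  have "S = (\<Union>d\<in>D0. (\<lambda>x. inverse (real b) * (x + of_int d)) ` S)"
  proof -
    have cb: "c + of_int d0 = real b * c" using b1 by (simp add: c_def field_simps)
    have eq: "c + s * (inverse (real b) * (t + of_int e)) = inverse (real b) * ((c + s * t) + of_int (d0 + g * e))" for t e
    proof -
      have "inverse (real b) * ((c + s * t) + of_int (d0 + g * e)) = inverse (real b) * ((c + of_int d0) + s * (t + of_int e))"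
        by (simp add: s_def algebra_simps)
      also have "\<dots> = c + s * (inverse (real b) * (t + of_int e))" unfolding cb using b1 by (simp add: field_simps)
      finally show ?thesis by simp
    qed
    show ?thesis
    proof (intro equalityI subsetI)
      fix x assume "x \<in> S"
      then have "c + s * x \<in> T" by (simp add: memS)
      then obtain d t where d: "d \<in> D" "t \<in> T" "c + s * x = inverse (real b) * (t + of_int d)" using T(2) by blast
      obtain e where e: "e \<in> D0" "d = d0 + g * e" using d(1) D0(2) by blast
      obtain t' where t': "t' \<in> S" "t = c + s * t'" using d(2) TS by blast
      have "c + s * x = c + s * (inverse (real b) * (t' + of_int e))" unfolding eq using d e t' by simp
      then have "x = inverse (real b) * (t' + of_int e)" using s by simp
      then show "x \<in> (\<Union>d\<in>D0. (\<lambda>x. inverse (real b) * (x + of_int d)) ` S)" using e t' by blast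
    next
      fix x assume "x \<in> (\<Union>d\<in>D0. (\<lambda>x. inverse (real b) * (x + of_int d)) ` S)"
      then obtain e t' where e: "e \<in> D0" "t' \<in> S" "x = inverse (real b) * (t' + of_int e)" by blast
      have "c + s * t' \<in> T" "d0 + g * e \<in> D" using e memS D0(2) by auto
      then have "inverse (real b) * ((c + s * t') + of_int (d0 + g * e)) \<in> T" by (subst T(2)) blast
      then show "x \<in> S" unfolding memS e(3) eq .
    qed
  qed
  moreover have "S \<noteq> {}" using iS interior_subset[of S] by blast
  ultimately have aS: "is_attractor b D0 S" unfolding is_attractor_def using cS by blast
  obtain K L where KL: "\<And>y. 0 \<le> y \<Longrightarrow> y < 1 \<Longrightarrow> fibre S y \<subseteq> {-K..K}" "finite L" "L \<noteq> {}"
    "AE y in lborel. 0 \<le> y \<longrightarrow> y < 1 \<longrightarrow> finite_spectrum L (fibre S y)"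
    using fibres_common_spectrum[OF assms(1) D0(3,4,5) aS iS pq] by blast
  have "L2_orthogonal_basis (lebesgue_on S) (exponential ` {l + of_int k | l k. l \<in> L})"
    by (rule spectral_basis_from_fibres[OF cS iS KL])
  then have "L2_orthogonal_basis (lebesgue_on T) (exponential ` (\<lambda>l. l / s) ` {l + of_int k | l k. l \<in> L})"
    using L2_orthogonal_basis_affine[OF cS iS s, of c] T(1) int unfolding TS[symmetric] by blast
  then show ?thesis
    unfolding spectral_set_def T_def[symmetric] using compact_interior_measure[OF T(1) int] by blast
qed

end
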